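(* Let $\Omega\subset\mathbb{R}^2$ be a bounded, possibly multiply connected domain with Lipschitz boundary and let $f\in H^{-1}(\Omega)$. For every $\mathrm{Pe}\ge 0$, the optimal value $\mathcal{J}(\mathrm{Pe})$ of the optimal cooling problem (defined in the context) satisfies $$\mathcal{J}(\mathrm{Pe})\ \ge\ \mathcal{L}(\mathrm{Pe})\ \ge\ 0,$$ where $$\mathcal{L}(\mathrm{Pe}) := \sup\left\{ \int_\Omega \Big( f\xi-\tfrac14|\nabla\xi|^2\Big)\,d\mathbf{x} - a \;:\; a\in\mathbb{R},\ \xi\in H^1_0(\Omega),\ \mathcal{Q}(a,\xi)\succeq 0\right\}.$$
   Context: Optimal cooling problem. Admissible velocities are $\mathbf{u}\in L^2(\Omega;\mathbb{R}^2)$ that are weakly divergence free and satisfy $\mathbf{u}\cdot\hat{\mathbf{n}}=0$ on $\partial\Omega$ in the weak sense (i.e. $\int_\Omega \mathbf{u}\cdot\nabla\varphi\,d\mathbf{x}=0$ for all $\varphi\in H^1(\Omega)$), with $\|\mathbf{u}\|_{L^2}\le \mathrm{Pe}$. For each such $\mathbf{u}$, $T\in H^1_0(\Omega)$ is the unique weak solution of $-\Delta T+\mathbf{u}\cdot\nabla T=f$ in $\Omega$, $T=0$ on $\partial\Omega$, i.e. $\int_\Omega (\nabla\xi\cdot\nabla T+\xi\,\mathbf{u}\cdot\nabla T-f\xi)\,d\mathbf{x}=0$ for all $\xi\in H^1_0(\Omega)$. Then $\mathcal{J}(\mathrm{Pe})$ is the minimum (infimum) of $\int_\Omega|\nabla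 T|^2\,d\mathbf{x}$ over all such $\mathbf{u}$. The pairing of $f\in H^{-1}(\Omega)$ with $\xi\in H^1_0(\Omega)$ is written $\int_\Omega f\xi\,d\mathbf{x}$. Streamfunctions. Let $\Gamma_0$ be the exterior boundary of $\Omega$ and $\Gamma_1,\dots,\Gamma_p$ the other connected components of $\partial\Omega$ (if any). $\mathcal{H}$ is the space of $\psi\in H^1(\Omega)$ with $\psi|_{\Gamma_0}=0$ and $\psi|_{\Gamma_i}$ equal to a constant $c_i\in\mathbb{R}$ for each $1\le i\le p$; thus $\mathcal{H}=H^1_0(\Omega)$ if $\Omega$ is simply connected. With $\nabla^\perp\psi=(\partial_y\psi,-\partial_x\psi)$, every weakly divergence-free $\mathbf{u}\in L^2(\Omega;\mathbb{R}^2)$ with $\mathbf{u}\cdot\hat{\mathbf n}=0$ on $\partial\Omega$ equals $\mathrm{Pe}\,\nabla^\perp\psi$ for some $\psi\in\mathcal{H}$ (when $\mathrm{Pe}>0$). Trilinear term. There is a constant $c(\Omega)>0$ such that $\left|\int_\Omega \xi\,\nabla^\perp\psi\cdot\nabla\theta\,d\mathbf{x}\right|\le c(\Omega)\|\nabla\xi\|_{L^2}\|\nabla\psi\|_{L^2}\|\nabla\theta\|_{L^2}$ for $\xi,\theta\in H^1_0(\Omega)$, $\psi\in\mathcal{H}$; the integral is understood as the continuous extension in $\xi$ from $H^1_0(\Omega)\cap L^\infty(\Omega)$. The term $\int_\Omega\xi\,\mathbf{u}\cdot\nabla T\,d\mathbf{x}$ is understood in the same way. Quadratic form. For $(a,\xi)\in\mathbb{R}\times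 H^1_0(\Omega)$, $\mathcal{Q}(a,\xi):\mathcal{H}\times H^1_0(\Omega)\to\mathbb{R}$ is $$\mathcal{Q}(a,\xi)[\psi,\theta]=\int_\Omega \big(a|\nabla\psi|^2+|\nabla\theta|^2-\mathrm{Pe}\,\xi\,\nabla^\perp\psi\cdot\nabla\theta\big)\,d\mathbf{x},$$ and $\mathcal{Q}(a,\xi)\succeq0$ means $\mathcal{Q}(a,\xi)[\psi,\theta]\ge0$ for all $(\psi,\theta)\in\mathcal{H}\times H^1_0(\Omega)$. *)

theory Defs
  imports "HOL-Analysis.Analysis"
begin

section \<open>Bounded planar domains with Lipschitz boundary\<close>

text \<open>Near every boundary point, after an orthogonal change of coordinates, the set is the region
  strictly above the graph of a Lipschitz function.  Since \<open>\<gamma>\<close> is arbitrary, no translation is needed.\<close>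

definition lipschitz_boundary :: "(real^2) set \<Rightarrow> bool" where
  "lipschitz_boundary \<Omega> \<longleftrightarrow>
     (\<forall>x\<in>frontier \<Omega>. \<exists>r>0. \<exists>(R :: real^2 \<Rightarrow> real^2) (\<gamma> :: real \<Rightarrow> real) C.
        orthogonal_transformation R \<and> C-lipschitz_on UNIV \<gamma> \<and>
        \<Omega> \<inter> ball x r = {y \<in> ball x r. (R y)$2 > \<gamma> ((R y)$1)})"

definition exterior_boundary :: "(real^2) set \<Rightarrow> (real^2) set" where
  "exterior_boundary \<Omega> = frontier (outside (closure \<Omega>))"


section \<open>Test functions\<close>

definition partial_deriv :: "2 \<Rightarrow> (real^2 \<Rightarrow> real) \<Rightarrow> real^2 \<Rightarrow> real" where
  "partial_deriv i \<phi> x = frechet_derivative \<phi> (at x) (axis i 1)"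

primrec C_k :: "nat \<Rightarrow> (real^2 \<Rightarrow> real) \<Rightarrow> bool" where
  "C_k 0 \<phi> \<longleftrightarrow> continuous_on UNIV \<phi>"
| "C_k (Suc k) \<phi> \<longleftrightarrow> (\<forall>x. \<phi> differentiable (at x)) \<and> (\<forall>i. C_k k (partial_deriv i \<phi>))"

definition smooth :: "(real^2 \<Rightarrow> real) \<Rightarrow> bool" where
  "smooth \<phi> \<longleftrightarrow> (\<forall>k. C_k k \<phi>)"

definition test_functions :: "(real^2) set \<Rightarrow> (real^2 \<Rightarrow> real) set" where
  "test_functions \<Omega> = {\<phi>. smooth \<phi> \<and> compact (closure {x. \<phi> x \<noteq> 0}) \<and> closure {x. \<phi> x \<noteq> 0} \<subseteq> \<Omega>}"


section \<open>Lebesgue and Sobolev spaces\<close>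

text \<open>Elements of the function spaces are functions on the whole plane of which only the values on
  \<open>\<Omega>\<close> matter.  They are Borel representatives of their classes modulo equality almost everywhere;
  the integrals below do not depend on the representative.\<close>

definition L2 :: "(real^2) set \<Rightarrow> (real^2 \<Rightarrow> 'b::euclidean_space) set" where
  "L2 \<Omega> = {v. set_borel_measurable lborel \<Omega> v \<and> set_integrable lborel \<Omega> (\<lambda>x. (norm (v x))\<^sup>2)}"

definition L2_norm :: "(real^2) set \<Rightarrow> (real^2 \<Rightarrow> 'b::euclidean_space) \<Rightarrow> real" where
  "L2_norm \<Omega> v = sqrt (LINT x:\<Omega>|lborel. (norm (v x))\<^sup>2)"

definition L_infinity :: "(real^2) set \<Rightarrow> (real^2 \<Rightarrow> real) set" where
  "L_infinity \<Omega> = {v. set_borel_measurable lborel \<Omega> v \<and> (\<exists>M. AE x in lborel. x \<in> \<Omega> \<longrightarrow> \<bar>v x\<bar> \<le> M)}"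

definition has_weak_gradient :: "(real^2) set \<Rightarrow> (real^2 \<Rightarrow> real) \<Rightarrow> (real^2 \<Rightarrow> real^2) \<Rightarrow> bool" where
  "has_weak_gradient \<Omega> u g \<longleftrightarrow>
     (\<forall>\<phi>\<in>test_functions \<Omega>. \<forall>i.
        (LINT x:\<Omega>|lborel. u x * partial_deriv i \<phi> x) = - (LINT x:\<Omega>|lborel. g x $ i * \<phi> x))"

definition H1 :: "(real^2) set \<Rightarrow> (real^2 \<Rightarrow> real) set" where
  "H1 \<Omega> = {u \<in> L2 \<Omega>. \<exists>g\<in>L2 \<Omega>. has_weak_gradient \<Omega> u g}"

text \<open>The weak gradient is unique up to equality almost everywhere in \<open>\<Omega>\<close>.\<close>

definition grad :: "(real^2) set \<Rightarrow> (real^2 \<Rightarrow> real) \<Rightarrow> real^2 \<Rightarrow> real^2" where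
  "grad \<Omega> u = (SOME g. g \<in> L2 \<Omega> \<and> has_weak_gradient \<Omega> u g)"

definition H1_norm :: "(real^2) set \<Rightarrow> (real^2 \<Rightarrow> real) \<Rightarrow> real" where
  "H1_norm \<Omega> u = sqrt ((L2_norm \<Omega> u)\<^sup>2 + (L2_norm \<Omega> (grad \<Omega> u))\<^sup>2)"

definition H10 :: "(real^2) set \<Rightarrow> (real^2 \<Rightarrow> real) set" where
  "H10 \<Omega> = {u \<in> H1 \<Omega>. \<exists>\<phi>. (\<forall>n. \<phi> n \<in> test_functions \<Omega>) \<and>
                          (\<lambda>n::nat. H1_norm \<Omega> (\<lambda>x. \<phi> n x - u x)) \<longlonglongrightarrow> 0}"

text \<open>The dual of \<open>H10 \<Omega>\<close>; the pairing of \<open>f\<close> with \<open>\<xi>\<close> is \<open>f \<xi>\<close>.  Linearity and boundedness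
  make \<open>f \<xi>\<close> independent of the representative of \<open>\<xi>\<close>.\<close>

definition H_minus_1 :: "(real^2) set \<Rightarrow> ((real^2 \<Rightarrow> real) \<Rightarrow> real) set" where
  "H_minus_1 \<Omega> = {f.
     (\<forall>\<xi>\<in>H10 \<Omega>. \<forall>\<zeta>\<in>H10 \<Omega>. f (\<lambda>x. \<xi> x + \<zeta> x) = f \<xi> + f \<zeta>) \<and>
     (\<forall>\<xi>\<in>H10 \<Omega>. \<forall>c. f (\<lambda>x. c * \<xi> x) = c * f \<xi>) \<and>
     (\<exists>C. \<forall>\<xi>\<in>H10 \<Omega>. \<bar>f \<xi>\<bar> \<le> C * H1_norm \<Omega> \<xi>)}"


section \<open>Boundary traces and streamfunctions\<close>

text \<open>One-dimensional Hausdorff measure in the plane, normalised to be the length of rectifiable curves.\<close>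

definition hausdorff1_pre :: "real \<Rightarrow> (real^2) set \<Rightarrow> ennreal" where
  "hausdorff1_pre \<delta> A =
     (INF C \<in> {C :: nat \<Rightarrow> (real^2) set. A \<subseteq> (\<Union>i. C i) \<and> (\<forall>i. bounded (C i) \<and> diameter (C i) \<le> \<delta>)}.
        \<Sum>i. ennreal (diameter (C i)))"

definition hausdorff1_outer :: "(real^2) set \<Rightarrow> ennreal" where
  "hausdorff1_outer A = (SUP \<delta>\<in>{0<..}. hausdorff1_pre \<delta> A)"

definition hausdorff1 :: "(real^2) measure" where
  "hausdorff1 = measure_of UNIV (sets borel) hausdorff1_outer"

text \<open>\<open>g\<close> is the trace of \<open>\<psi> \<in> H1 \<Omega>\<close> on the boundary: the trace map is the continuous extension, from
  \<open>H1 \<Omega>\<close> to square integrable functions on the boundary, of the restriction of functions that are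
  smooth up to the boundary.\<close>

definition has_trace :: "(real^2) set \<Rightarrow> (real^2 \<Rightarrow> real) \<Rightarrow> (real^2 \<Rightarrow> real) \<Rightarrow> bool" where
  "has_trace \<Omega> \<psi> g \<longleftrightarrow> set_borel_measurable hausdorff1 (frontier \<Omega>) g \<and>
     (\<exists>\<phi>. (\<forall>n. smooth (\<phi> n)) \<and>
          (\<lambda>n::nat. H1_norm \<Omega> (\<lambda>x. \<phi> n x - \<psi> x)) \<longlonglongrightarrow> 0 \<and>
          (\<lambda>n. \<integral>\<^sup>+x\<in>frontier \<Omega>. ennreal ((\<phi> n x - g x)\<^sup>2) \<partial>hausdorff1) \<longlonglongrightarrow> 0)"

definition streamfunctions :: "(real^2) set \<Rightarrow> (real^2 \<Rightarrow> real) set" where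
  "streamfunctions \<Omega> = {\<psi> \<in> H1 \<Omega>. \<exists>g. has_trace \<Omega> \<psi> g \<and>
     (\<forall>x\<in>exterior_boundary \<Omega>. g x = 0) \<and>
     (\<forall>\<Gamma>\<in>components (frontier \<Omega>) - {exterior_boundary \<Omega>}. \<exists>c. \<forall>x\<in>\<Gamma>. g x = c)}"

definition grad_perp :: "(real^2) set \<Rightarrow> (real^2 \<Rightarrow> real) \<Rightarrow> real^2 \<Rightarrow> real^2" where
  "grad_perp \<Omega> \<psi> x = vector [grad \<Omega> \<psi> x $ 2, - (grad \<Omega> \<psi> x $ 1)]"


section \<open>The advection term\<close>

definition advection_bounded ::
  "(real^2) set \<Rightarrow> (real^2 \<Rightarrow> real) \<Rightarrow> (real^2 \<Rightarrow> real^2) \<Rightarrow> (real^2 \<Rightarrow> real) \<Rightarrow> real" where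
  "advection_bounded \<Omega> \<xi> w \<theta> = (LINT x:\<Omega>|lborel. \<xi> x * (w x \<bullet> grad \<Omega> \<theta> x))"

text \<open>For unbounded \<open>\<xi> \<in> H10 \<Omega>\<close> the integrand need not be integrable: the term is the
  continuous extension in \<open>\<xi>\<close> from \<open>H10 \<Omega> \<inter> L_infinity \<Omega>\<close>, which exists for the divergence-free
  fields \<open>w\<close> considered here.\<close>

definition advection ::
  "(real^2) set \<Rightarrow> (real^2 \<Rightarrow> real) \<Rightarrow> (real^2 \<Rightarrow> real^2) \<Rightarrow> (real^2 \<Rightarrow> real) \<Rightarrow> real" where
  "advection \<Omega> \<xi> w \<theta> =
     (if \<xi> \<in> L_infinity \<Omega> then advection_bounded \<Omega> \<xi> w \<theta>
      else (THE l. \<forall>X :: nat \<Rightarrow> real^2 \<Rightarrow> real.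
              (\<forall>n. X n \<in> H10 \<Omega> \<inter> L_infinity \<Omega>) \<and> (\<lambda>n. H1_norm \<Omega> (\<lambda>x. X n x - \<xi> x)) \<longlonglongrightarrow> 0
              \<longrightarrow> (\<lambda>n. advection_bounded \<Omega> (X n) w \<theta>) \<longlonglongrightarrow> l))"


section \<open>The optimal cooling problem and its lower bound\<close>

definition admissible_velocities :: "(real^2) set \<Rightarrow> real \<Rightarrow> (real^2 \<Rightarrow> real^2) set" where
  "admissible_velocities \<Omega> Pe = {u \<in> L2 \<Omega>.
     (\<forall>\<phi>\<in>H1 \<Omega>. (LINT x:\<Omega>|lborel. u x \<bullet> grad \<Omega> \<phi> x) = 0) \<and> L2_norm \<Omega> u \<le> Pe}"

definition weak_solution ::
  "(real^2) set \<Rightarrow> ((real^2 \<Rightarrow> real) \<Rightarrow> real) \<Rightarrow> (real^2 \<Rightarrow> real^2) \<Rightarrow> (real^2 \<Rightarrow> real) \<Rightarrow> bool" where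
  "weak_solution \<Omega> f u T \<longleftrightarrow> T \<in> H10 \<Omega> \<and>
     (\<forall>\<xi>\<in>H10 \<Omega>.
        (LINT x:\<Omega>|lborel. grad \<Omega> \<xi> x \<bullet> grad \<Omega> T x) + advection \<Omega> \<xi> u T - f \<xi> = 0)"

definition dirichlet_energy :: "(real^2) set \<Rightarrow> (real^2 \<Rightarrow> real) \<Rightarrow> real" where
  "dirichlet_energy \<Omega> T = (LINT x:\<Omega>|lborel. (norm (grad \<Omega> T x))\<^sup>2)"

definition optimal_cooling ::
  "(real^2) set \<Rightarrow> ((real^2 \<Rightarrow> real) \<Rightarrow> real) \<Rightarrow> real \<Rightarrow> ereal" where
  "optimal_cooling \<Omega> f Pe =
     Inf {ereal (dirichlet_energy \<Omega> T) | u T. u \<in> admissible_velocities \<Omega> Pe \<and> weak_solution \<Omega> f u T}"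

definition quadratic_form ::
  "(real^2) set \<Rightarrow> real \<Rightarrow> real \<Rightarrow> (real^2 \<Rightarrow> real) \<Rightarrow> (real^2 \<Rightarrow> real) \<Rightarrow> (real^2 \<Rightarrow> real) \<Rightarrow> real" where
  "quadratic_form \<Omega> Pe a \<xi> \<psi> \<theta> =
     a * dirichlet_energy \<Omega> \<psi> + dirichlet_energy \<Omega> \<theta> - Pe * advection \<Omega> \<xi> (grad_perp \<Omega> \<psi>) \<theta>"

definition quadratic_form_nonneg :: "(real^2) set \<Rightarrow> real \<Rightarrow> real \<Rightarrow> (real^2 \<Rightarrow> real) \<Rightarrow> bool" where
  "quadratic_form_nonneg \<Omega> Pe a \<xi> \<longleftrightarrow>
     (\<forall>\<psi>\<in>streamfunctions \<Omega>. \<forall>\<theta>\<in>H10 \<Omega>. quadratic_form \<Omega> Pe a \<xi> \<psi> \<theta> \<ge> 0)"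

definition cooling_lower_bound ::
  "(real^2) set \<Rightarrow> ((real^2 \<Rightarrow> real) \<Rightarrow> real) \<Rightarrow> real \<Rightarrow> ereal" where
  "cooling_lower_bound \<Omega> f Pe =
     Sup {ereal (f \<xi> - 1/4 * dirichlet_energy \<Omega> \<xi> - a) | a \<xi>.
            \<xi> \<in> H10 \<Omega> \<and> quadratic_form_nonneg \<Omega> Pe a \<xi>}"

end

theory Submission
  imports Defs
begin

text \<open>Put \<open>\<theta> = T - \<xi> / 2\<close>. Testing the equation for \<open>T\<close> with \<open>\<xi>\<close>, the claim for one velocity \<open>u\<close>
  and one pair \<open>(a, \<xi>)\<close> becomes \<open>a + \<parallel>\<nabla>\<theta>\<parallel>\<^sup>2 - \<integral> \<xi> u\<cdot>\<nabla>T \<ge> 0\<close>, which is the positivity of the quadratic form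
  at \<open>\<psi>\<close>, \<open>\<theta>\<close> with \<open>u = Pe \<nabla>\<^sup>\<bottom>\<psi>\<close>, because \<open>\<integral> \<xi> u\<cdot>\<nabla>\<xi> = 0\<close>.

  The terms with unbounded factors are controlled by duality instead of the trilinear estimate. The weak equation
  bounds the functional \<open>X \<mapsto> \<integral> X u\<cdot>\<nabla>T\<close> on test functions in the \<open>H1\<close> norm, and the positivity of the
  quadratic form bounds \<open>X \<mapsto> \<integral> X u\<cdot>\<nabla>\<xi>\<close>. On the space of all \<open>\<theta>\<close> with such a bound the operator \<open>u\<cdot>\<nabla>\<close> is
  skew, as truncation shows, and polarization at \<open>T\<close>, \<open>\<xi>\<close> and \<open>T + \<xi>\<close> gives the required identities.

  Streamfunctions that are smooth and locally constant near the boundary suffice. Their rotated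
  gradients are dense in the admissible fields: an admissible \<open>v\<close> orthogonal to all of them is
  divergence free and has no circulation along any closed path, so it is continuous by Weyl's lemma and
  \<open>v = \<nabla>p\<close> for some \<open>p\<close> of class \<open>C1\<close>. The bounded functions \<open>k sin (p / k)\<close> belong to \<open>H1\<close>, hence
  \<open>\<integral> cos (p / k) \<bar>v\<bar>\<^sup>2 = 0\<close> for all \<open>k\<close>, and \<open>v = 0\<close> in the limit.\<close>

section \<open>Square integrable functions\<close>

text \<open>The obstacle is the advection term at unbounded arguments: its integrand need not be
  integrable there, and its value is a definite description, about which nothing is known before a
  limit has been shown to exist. The equation and the quadratic form are therefore evaluated only
  where a scalar argument is a test function and the term is an honest integral; everything about
  \<open>T\<close> and \<open>\<xi>\<close> together is a limit along approximating test functions.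
  The bound that such a limit needs comes for \<open>T\<close> from the boundedness of
  \<open>f\<close>, and for \<open>\<xi>\<close> from inserting all multiples of one function into
  the inequality \<open>Q \<ge> 0\<close>. The shift by \<open>\<xi> / 2\<close> completes the
  square: it absorbs the cross term that testing the equation with \<open>\<xi>\<close> leaves and
  produces the factor 1/4. Holes enter through the constants that a streamfunction may take in them:
  the streamfunction of a closed path is a smoothed winding number, so that circulations around
  holes are tested as well.\<close>

definition l2 :: "'a measure \<Rightarrow> ('a \<Rightarrow> 'b::euclidean_space) set" where
  "l2 M = {f \<in> borel_measurable M. integrable M (\<lambda>x. (norm (f x))\<^sup>2)}"

definition l2norm :: "'a measure \<Rightarrow> ('a \<Rightarrow> 'b::euclidean_space) \<Rightarrow> real" where
  "l2norm M f = sqrt (\<integral>x. (norm (f x))\<^sup>2 \<partial>M)"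

lemma l2norm_nonneg [simp]: "0 \<le> l2norm M f"
  by (simp add: l2norm_def)

lemma l2norm_power2: "(l2norm M f)\<^sup>2 = (\<integral>x. (norm (f x))\<^sup>2 \<partial>M)"
  by (simp add: l2norm_def)

lemma l2_measurable [measurable_dest]: "f \<in> l2 M \<Longrightarrow> f \<in> borel_measurable M"
  by (simp add: l2_def)

lemma l2_integrable_norm2: "f \<in> l2 M \<Longrightarrow> integrable M (\<lambda>x. (norm (f x))\<^sup>2)"
  by (simp add: l2_def)

lemma l2_dominated:
  fixes f :: "'a \<Rightarrow> 'b::euclidean_space" and g :: "'a \<Rightarrow> 'c::euclidean_space"
  assumes "f \<in> l2 M" and [measurable]: "g \<in> borel_measurable M"
    and "AE x in M. norm (g x) \<le> norm (f x)"
  shows "g \<in> l2 M" "l2norm M g \<le> l2norm M f"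
proof -
  have i: "integrable M (\<lambda>x. (norm (f x))\<^sup>2)" using assms(1) by (simp add: l2_def)
  have ae: "AE x in M. (norm (g x))\<^sup>2 \<le> (norm (f x))\<^sup>2"
    using assms(3) by eventually_elim (simp add: power_mono)
  have j: "integrable M (\<lambda>x. (norm (g x))\<^sup>2)"
    by (rule Bochner_Integration.integrable_bound[OF i]) (use ae in auto)
  then show "g \<in> l2 M" by (simp add: l2_def)
  show "l2norm M g \<le> l2norm M f"
    unfolding l2norm_def by (intro real_sqrt_le_mono integral_mono_AE i j ae)
qed

lemma l2_scaleR:
  assumes "f \<in> l2 M"
  shows "(\<lambda>x. c *\<^sub>R f x) \<in> l2 M" "l2norm M (\<lambda>x. c *\<^sub>R f x) = \<bar>c\<bar> * l2norm M f"
  using assms by (auto simp: l2_def l2norm_def power_mult_distrib real_sqrt_mult)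

lemma l2_mult:
  fixes f :: "'a \<Rightarrow> real"
  assumes "f \<in> l2 M"
  shows "(\<lambda>x. c * f x) \<in> l2 M" "l2norm M (\<lambda>x. c * f x) = \<bar>c\<bar> * l2norm M f"
  using l2_scaleR[OF assms, of c] by simp_all

lemma l2_add:
  assumes [measurable]: "f \<in> l2 M" "g \<in> l2 M"
  shows "(\<lambda>x. f x + g x) \<in> l2 M"
proof -
  have "norm ((norm (f x + g x))\<^sup>2) \<le> norm (2 * (norm (f x))\<^sup>2 + 2 * (norm (g x))\<^sup>2)" for x
  proof -
    have "(norm (f x + g x))\<^sup>2 \<le> (norm (f x) + norm (g x))\<^sup>2"
      by (intro power_mono norm_triangle_ineq norm_ge_zero)
    also have "\<dots> \<le> 2 * (norm (f x))\<^sup>2 + 2 * (norm (g x))\<^sup>2"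
      using sum_squares_bound[of "norm (f x)" "norm (g x)"] by (simp add: power2_sum)
    finally show ?thesis by simp
  qed
  moreover have "integrable M (\<lambda>x. 2 * (norm (f x))\<^sup>2 + 2 * (norm (g x))\<^sup>2)"
    using assms by (simp add: l2_def)
  ultimately have "integrable M (\<lambda>x. (norm (f x + g x))\<^sup>2)"
    using Bochner_Integration.integrable_bound[of M "\<lambda>x. 2 * (norm (f x))\<^sup>2 + 2 * (norm (g x))\<^sup>2"
        "\<lambda>x. (norm (f x + g x))\<^sup>2"] by auto
  then show ?thesis by (simp add: l2_def)
qed

lemma l2_minus: "f \<in> l2 M \<Longrightarrow> (\<lambda>x. - f x) \<in> l2 M"
  by (auto simp: l2_def)

lemma l2_diff: "f \<in> l2 M \<Longrightarrow> g \<in> l2 M \<Longrightarrow> (\<lambda>x. f x - g x) \<in> l2 M"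
  using l2_add[OF _ l2_minus, of f M g] by simp

lemma l2norm_minus_commute: "l2norm M (\<lambda>x. f x - g x) = l2norm M (\<lambda>x. g x - f x)"
  by (simp add: l2norm_def norm_minus_commute)

lemma l2_zero: "(\<lambda>x. 0) \<in> l2 M"
  by (simp add: l2_def)

lemma l2norm_zero [simp]: "l2norm M (\<lambda>x. 0) = 0"
  by (simp add: l2norm_def)

lemma l2_inner:
  assumes [measurable]: "f \<in> l2 M" "g \<in> l2 M"
  shows "integrable M (\<lambda>x. f x \<bullet> g x)"
proof (rule Bochner_Integration.integrable_bound)
  show "integrable M (\<lambda>x. (norm (f x))\<^sup>2 + (norm (g x))\<^sup>2)"
    using assms by (simp add: l2_def)
  have "\<bar>f x \<bullet> g x\<bar> \<le> (norm (f x))\<^sup>2 + (norm (g x))\<^sup>2" for x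
  proof -
    have "\<bar>f x \<bullet> g x\<bar> \<le> norm (f x) * norm (g x)" by (rule Cauchy_Schwarz_ineq2)
    also have "\<dots> \<le> 2 * norm (f x) * norm (g x)" by simp
    also have "\<dots> \<le> (norm (f x))\<^sup>2 + (norm (g x))\<^sup>2"
      by (rule sum_squares_bound)
    finally show ?thesis .
  qed
  then show "AE x in M. norm (f x \<bullet> g x) \<le> norm ((norm (f x))\<^sup>2 + (norm (g x))\<^sup>2)" by simp
qed measurable

lemma l2_mult_integrable:
  fixes f g :: "'a \<Rightarrow> real"
  shows "f \<in> l2 M \<Longrightarrow> g \<in> l2 M \<Longrightarrow> integrable M (\<lambda>x. f x * g x)"
  using l2_inner[of f M g] by simp

lemma l2norm_power2_inner: "(l2norm M f)\<^sup>2 = (\<integral>x. f x \<bullet> f x \<partial>M)"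
  by (simp add: l2norm_power2 power2_norm_eq_inner)

lemma l2norm_power2_diff_scaleR:
  assumes "f \<in> l2 M" "g \<in> l2 M"
  shows "(l2norm M (\<lambda>x. f x - t *\<^sub>R g x))\<^sup>2 = (l2norm M f)\<^sup>2 - 2 * t * (\<integral>x. f x \<bullet> g x \<partial>M) + t\<^sup>2 * (l2norm M g)\<^sup>2"
proof -
  have "(l2norm M (\<lambda>x. f x - t *\<^sub>R g x))\<^sup>2
      = (\<integral>x. f x \<bullet> f x - (2 * t) * (f x \<bullet> g x) + t\<^sup>2 * (g x \<bullet> g x) \<partial>M)"
    unfolding l2norm_power2_inner
    by (intro Bochner_Integration.integral_cong refl)
       (simp add: algebra_simps inner_commute power2_eq_square)
  also have "\<dots> = (\<integral>x. f x \<bullet> f x \<partial>M) - (2 * t) * (\<integral>x. f x \<bullet> g x \<partial>M) + t\<^sup>2 * (\<integral>x. g x \<bullet> g x \<partial>M)"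
    using l2_inner[OF assms] l2_inner[OF assms(1,1)] l2_inner[OF assms(2,2)] by simp
  finally show ?thesis by (simp add: l2norm_power2_inner)
qed

text \<open>The discriminant of a quadratic polynomial that is nonnegative on the whole line. It
  yields the Cauchy-Schwarz inequality and, with constant term 0, the orthogonality in the
  projection argument.\<close>

lemma discriminant_le:
  fixes A B C :: real
  assumes "\<And>t. 0 \<le> A - 2 * t * B + t\<^sup>2 * C" "0 \<le> C"
  shows "B\<^sup>2 \<le> A * C"
proof (cases "C = 0")
  case True
  have "B = 0"
  proof (rule ccontr)
    assume "B \<noteq> 0"
    \<comment> \<open>With \<open>C = 0\<close> the polynomial takes the value -1 at this
      point.\<close>
    then show False using assms(1)[of "(A + 1) / (2 * B)"] True by simp
  qed
  then show ?thesis using True by simp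
next
  case False
  have "0 \<le> A - 2 * (B / C) * B + (B / C)\<^sup>2 * C" by (rule assms(1))
  also have "\<dots> = A - B\<^sup>2 / C" using False by (simp add: power2_eq_square)
  finally show ?thesis using False assms(2) by (simp add: pos_divide_le_eq)
qed

lemma l2norm_Cauchy_Schwarz:
  assumes "f \<in> l2 M" "g \<in> l2 M"
  shows "\<bar>\<integral>x. f x \<bullet> g x \<partial>M\<bar> \<le> l2norm M f * l2norm M g"
proof -
  have "(\<integral>x. f x \<bullet> g x \<partial>M)\<^sup>2 \<le> (l2norm M f)\<^sup>2 * (l2norm M g)\<^sup>2"
    by (rule discriminant_le) (simp_all flip: l2norm_power2_diff_scaleR[OF assms])
  then have "(\<integral>x. f x \<bullet> g x \<partial>M)\<^sup>2 \<le> (l2norm M f * l2norm M g)\<^sup>2" by (simp add: power_mult_distrib)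
  then show ?thesis by (simp add: abs_le_square_iff[symmetric])
qed

lemma l2norm_Cauchy_Schwarz_mult:
  fixes f g :: "'a \<Rightarrow> real"
  shows "f \<in> l2 M \<Longrightarrow> g \<in> l2 M \<Longrightarrow> \<bar>\<integral>x. f x * g x \<partial>M\<bar> \<le> l2norm M f * l2norm M g"
  using l2norm_Cauchy_Schwarz[of f M g] by simp

lemma l2norm_triangle:
  assumes "f \<in> l2 M" "g \<in> l2 M"
  shows "l2norm M (\<lambda>x. f x + g x) \<le> l2norm M f + l2norm M g"
proof -
  have "(l2norm M (\<lambda>x. f x + g x))\<^sup>2 = (l2norm M f)\<^sup>2 + 2 * (\<integral>x. f x \<bullet> g x \<partial>M) + (l2norm M g)\<^sup>2"
    using l2norm_power2_diff_scaleR[OF assms, of "-1"] by simp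
  also have "\<dots> \<le> (l2norm M f + l2norm M g)\<^sup>2"
    using l2norm_Cauchy_Schwarz[OF assms] by (simp add: power2_sum)
  finally show ?thesis by (simp add: power2_le_iff_abs_le)
qed

lemma l2norm_triangle3:
  assumes "f \<in> l2 M" "g \<in> l2 M" "h \<in> l2 M"
  shows "l2norm M (\<lambda>x. f x - h x) \<le> l2norm M (\<lambda>x. f x - g x) + l2norm M (\<lambda>x. g x - h x)"
  using l2norm_triangle[OF l2_diff[OF assms(1,2)] l2_diff[OF assms(2,3)]] by simp

lemma l2norm_abs_diff_le:
  assumes "f \<in> l2 M" "g \<in> l2 M"
  shows "\<bar>l2norm M f - l2norm M g\<bar> \<le> l2norm M (\<lambda>x. f x - g x)"
  using l2norm_triangle[OF l2_diff[OF assms] assms(2)] l2norm_triangle[OF l2_diff[OF assms(2,1)] assms(1)]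
  by (simp add: l2norm_minus_commute[of M f g])

lemma tendsto_n2:
  assumes "\<And>n. F n \<in> l2 M" "f \<in> l2 M" "(\<lambda>n. l2norm M (\<lambda>x. F n x - f x)) \<longlonglongrightarrow> 0"
  shows "(\<lambda>n. l2norm M (F n)) \<longlonglongrightarrow> l2norm M f"
proof -
  have "(\<lambda>n. l2norm M (F n) - l2norm M f) \<longlonglongrightarrow> 0"
    by (rule Lim_null_comparison[OF _ assms(3)])
       (use l2norm_abs_diff_le[OF assms(1,2)] in auto)
  then show ?thesis by (simp add: LIM_zero_iff)
qed

lemma l2norm_tendsto_lincomb:
  assumes "\<And>n. F n \<in> l2 M" "f \<in> l2 M" "\<And>n. G n \<in> l2 M" "g \<in> l2 M"
    and "(\<lambda>n. l2norm M (\<lambda>x. F n x - f x)) \<longlonglongrightarrow> 0" "(\<lambda>n. l2norm M (\<lambda>x. G n x - g x)) \<longlonglongrightarrow> 0"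
  shows "(\<lambda>n. l2norm M (\<lambda>x. (F n x + c *\<^sub>R G n x) - (f x + c *\<^sub>R g x))) \<longlonglongrightarrow> 0"
proof (rule Lim_null_comparison[OF always_eventually], intro allI)
  fix n
  have "l2norm M (\<lambda>x. (F n x + c *\<^sub>R G n x) - (f x + c *\<^sub>R g x))
      = l2norm M (\<lambda>x. (F n x - f x) + c *\<^sub>R (G n x - g x))"
    by (simp add: algebra_simps)
  also have "\<dots> \<le> l2norm M (\<lambda>x. F n x - f x) + l2norm M (\<lambda>x. c *\<^sub>R (G n x - g x))"
    by (intro l2norm_triangle l2_diff l2_scaleR assms)
  also have "l2norm M (\<lambda>x. c *\<^sub>R (G n x - g x)) = \<bar>c\<bar> * l2norm M (\<lambda>x. G n x - g x)"
    by (intro l2_scaleR l2_diff assms)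
  finally show "norm (l2norm M (\<lambda>x. (F n x + c *\<^sub>R G n x) - (f x + c *\<^sub>R g x)))
      \<le> l2norm M (\<lambda>x. F n x - f x) + \<bar>c\<bar> * l2norm M (\<lambda>x. G n x - g x)" by simp
next
  show "(\<lambda>n. l2norm M (\<lambda>x. F n x - f x) + \<bar>c\<bar> * l2norm M (\<lambda>x. G n x - g x)) \<longlonglongrightarrow> 0"
    using tendsto_add[OF assms(5) tendsto_mult_right_zero[OF assms(6), of "\<bar>c\<bar>"]] by simp
qed

lemma tendsto_integral_inner:
  assumes "\<And>n. F n \<in> l2 M" "f \<in> l2 M" "g \<in> l2 M" "(\<lambda>n. l2norm M (\<lambda>x. F n x - f x)) \<longlonglongrightarrow> 0"
  shows "(\<lambda>n. \<integral>x. F n x \<bullet> g x \<partial>M) \<longlonglongrightarrow> (\<integral>x. f x \<bullet> g x \<partial>M)"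
proof -
  have "(\<lambda>n. (\<integral>x. F n x \<bullet> g x \<partial>M) - (\<integral>x. f x \<bullet> g x \<partial>M)) \<longlonglongrightarrow> 0"
  proof (rule Lim_null_comparison)
    show "(\<lambda>n. l2norm M (\<lambda>x. F n x - f x) * l2norm M g) \<longlonglongrightarrow> 0"
      by (intro tendsto_mult_left_zero assms)
    show "\<forall>\<^sub>F n in sequentially. norm ((\<integral>x. F n x \<bullet> g x \<partial>M) - (\<integral>x. f x \<bullet> g x \<partial>M))
        \<le> l2norm M (\<lambda>x. F n x - f x) * l2norm M g"
      using l2norm_Cauchy_Schwarz[OF l2_diff[OF assms(1,2)] assms(3)] assms
      by (simp add: inner_diff_left l2_inner)
  qed
  then show ?thesis by (simp add: LIM_zero_iff)
qed

lemma l2norm_cong_AE: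
  assumes "AE x in M. f x = g x" "f \<in> borel_measurable M" "g \<in> borel_measurable M"
  shows "l2norm M f = l2norm M g"
  unfolding l2norm_def using assms by (intro arg_cong[where f=sqrt] integral_cong_AE) auto

lemma l2norm_eq_0_AE:
  assumes "f \<in> l2 M" "l2norm M f = 0"
  shows "AE x in M. f x = 0"
  using assms integral_nonneg_eq_0_iff_AE[of M "\<lambda>x. (norm (f x))\<^sup>2"]
  by (simp add: l2norm_def l2_def)

lemma l2norm_dominated_convergence:
  fixes F :: "nat \<Rightarrow> 'a \<Rightarrow> 'b::euclidean_space" and g :: "'a \<Rightarrow> 'c::euclidean_space"
  assumes "\<And>n. F n \<in> borel_measurable M" "g \<in> l2 M"
    and "\<And>n. AE x in M. norm (F n x) \<le> norm (g x)"
    and "AE x in M. (\<lambda>n. F n x) \<longlonglongrightarrow> 0"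
  shows "(\<lambda>n. l2norm M (F n)) \<longlonglongrightarrow> 0"
proof -
  note [measurable] = assms(1)
  have "(\<lambda>n. \<integral>x. (norm (F n x))\<^sup>2 \<partial>M) \<longlonglongrightarrow> (\<integral>x. 0 \<partial>M)"
  proof (rule integral_dominated_convergence[where w="\<lambda>x. (norm (g x))\<^sup>2"])
    show "integrable M (\<lambda>x. (norm (g x))\<^sup>2)" using assms(2) by (simp add: l2_def)
    show "AE x in M. (\<lambda>n. (norm (F n x))\<^sup>2) \<longlonglongrightarrow> 0"
      using assms(4)
    proof eventually_elim
      case (elim x)
      show ?case using tendsto_power[OF tendsto_norm_zero[OF elim], of 2] by simp
    qed
    show "AE x in M. norm ((norm (F n x))\<^sup>2) \<le> (norm (g x))\<^sup>2" for n
      using assms(3)[of n] by eventually_elim (simp add: power_mono)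
  qed measurable
  then show ?thesis
    unfolding l2norm_def using tendsto_real_sqrt by fastforce
qed

section \<open>Completeness and orthogonal projection over a finite measure\<close>

lemma (in finite_measure) l2_bounded:
  fixes f :: "'a \<Rightarrow> 'b::euclidean_space"
  assumes "f \<in> borel_measurable M" "AE x in M. norm (f x) \<le> K"
  shows "f \<in> l2 M"
proof -
  have "(\<lambda>x. K) \<in> l2 M" by (simp add: l2_def)
  then show ?thesis by (rule l2_dominated) (use assms in \<open>auto elim: eventually_mono\<close>)
qed

lemma (in finite_measure) l2_integrable:
  assumes "f \<in> l2 M" shows "integrable M f"
proof (rule Bochner_Integration.integrable_bound)
  show "integrable M (\<lambda>x. 1 + (norm (f x))\<^sup>2)" using assms by (simp add: l2_def)
  have "norm (f x) \<le> 1 + (norm (f x))\<^sup>2" for x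
    using sum_squares_bound[of 1 "norm (f x)"] norm_ge_zero[of "f x"] by (simp; linarith)
  then show "AE x in M. norm (f x) \<le> norm (1 + (norm (f x))\<^sup>2)" by simp
qed (use assms in \<open>simp add: l2_def\<close>)

lemma l2_norm: "f \<in> l2 M \<Longrightarrow> (\<lambda>x. norm (f x)) \<in> l2 M" "l2norm M (\<lambda>x. norm (f x)) = l2norm M f"
  by (auto simp: l2_def l2norm_def)

lemma (in finite_measure) integral_norm_le_n2:
  assumes "f \<in> l2 M"
  shows "(\<integral>x. norm (f x) \<partial>M) \<le> l2norm M (\<lambda>x. 1::real) * l2norm M f"
  using l2norm_Cauchy_Schwarz_mult[OF l2_bounded[of "\<lambda>x. 1::real" 1] l2_norm(1)[OF assms]]
  by (simp add: l2_norm(2))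

text \<open>Over a finite measure, convergence in \<open>l2norm\<close> implies convergence in mean,
  which has an almost everywhere convergent subsequence.\<close>

lemma (in finite_measure) l2norm_tendsto_AE_subseq:
  fixes F :: "nat \<Rightarrow> 'a \<Rightarrow> 'b::euclidean_space"
  assumes "\<And>n. F n \<in> l2 M" "f \<in> l2 M" "(\<lambda>n. l2norm M (\<lambda>x. F n x - f x)) \<longlonglongrightarrow> 0"
  shows "\<exists>r::nat\<Rightarrow>nat. strict_mono r \<and> (AE x in M. (\<lambda>n. F (r n) x) \<longlonglongrightarrow> f x)"
proof -
  have "\<exists>r::nat\<Rightarrow>nat. strict_mono r \<and> (AE x in M. (\<lambda>n. F (r n) x - f x) \<longlonglongrightarrow> 0)"
  proof (rule tendsto_L1_AE_subseq)
    show "(\<lambda>n. \<integral>x. norm (F n x - f x) \<partial>M) \<longlonglongrightarrow> 0"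
    proof (rule Lim_null_comparison)
      show "(\<lambda>n. l2norm M (\<lambda>x. 1::real) * l2norm M (\<lambda>x. F n x - f x)) \<longlonglongrightarrow> 0"
        by (intro tendsto_mult_right_zero assms)
      show "\<forall>\<^sub>F n in sequentially. norm (\<integral>x. norm (F n x - f x) \<partial>M)
          \<le> l2norm M (\<lambda>x. 1::real) * l2norm M (\<lambda>x. F n x - f x)"
        using integral_norm_le_n2[OF l2_diff[OF assms(1,2)]] by simp
    qed
  qed (intro Bochner_Integration.integrable_diff l2_integrable assms)
  then show ?thesis by (simp add: LIM_zero_iff)
qed

text \<open>Riesz-Fischer: over a finite measure the sequence is also Cauchy in mean, so a
  subsequence converges almost everywhere, and Fatou's lemma turns its pointwise limit into a limit
  in norm.\<close>

lemma (in finite_measure) l2norm_complete: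
  fixes F :: "nat \<Rightarrow> 'a \<Rightarrow> 'b::euclidean_space"
  assumes F: "\<And>n. F n \<in> l2 M"
    and C: "\<And>e. e > 0 \<Longrightarrow> \<exists>N. \<forall>m\<ge>N. \<forall>n\<ge>N. l2norm M (\<lambda>x. F m x - F n x) < e"
  shows "\<exists>f\<in>l2 M. (\<lambda>n. l2norm M (\<lambda>x. F n x - f x)) \<longlonglongrightarrow> 0"
proof -
  note [measurable] = F[THEN l2_measurable]
  \<comment> \<open>\<open>K\<close> is the square root of the total measure, the constant in the
    comparison of the mean with \<open>l2norm\<close>; the \<open>K + 1\<close> below avoids
    division by 0.\<close>
  define K where "K = l2norm M (\<lambda>x. 1::real)"
  have K: "0 \<le> K" by (simp add: K_def)
  obtain r :: "nat \<Rightarrow> nat" where r: "strict_mono r" "AE x in M. Cauchy (\<lambda>i. F (r i) x)"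
  proof (rule cauchy_L1_AE_cauchy_subseq[of M F])
    show "integrable M (F n)" for n by (rule l2_integrable[OF F])
    fix e :: real assume "e > 0"
    then have "e / (K + 1) > 0" using K by simp
    from C[OF this] obtain N where N: "\<And>m n. m \<ge> N \<Longrightarrow> n \<ge> N \<Longrightarrow> l2norm M (\<lambda>x. F m x - F n x) < e / (K + 1)"
      by auto
    have "(\<integral>x. norm (F m x - F n x) \<partial>M) < e" if "m \<ge> N" "n \<ge> N" for m n
    proof -
      have "(\<integral>x. norm (F m x - F n x) \<partial>M) \<le> K * l2norm M (\<lambda>x. F m x - F n x)"
        using integral_norm_le_n2[OF l2_diff[OF F F]] by (simp add: K_def)
      also have "\<dots> \<le> (K + 1) * l2norm M (\<lambda>x. F m x - F n x)"
        by (simp add: mult_right_mono)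
      also have "\<dots> < e" using N[OF that] K by (simp add: pos_less_divide_eq mult.commute)
      finally show ?thesis .
    qed
    then show "\<exists>N. \<forall>i\<ge>N. \<forall>j\<ge>N. (\<integral>x. norm (F i x - F j x) \<partial>M) < e" by blast
  qed auto
  \<comment> \<open>The value 0 off the convergence set is a default that makes \<open>f\<close>
    measurable, as a limit of functions cut off on the same set.\<close>
  define f where "f x = (if convergent (\<lambda>i. F (r i) x) then lim (\<lambda>i. F (r i) x) else 0)" for x
  have f_meas [measurable]: "f \<in> borel_measurable M"
  proof -
    have "{x \<in> space M. Cauchy (\<lambda>i. F (r i) x)} \<in> sets M" by measurable
    then have [measurable]: "Measurable.pred M (\<lambda>x. convergent (\<lambda>i. F (r i) x))"
      by (simp add: Cauchy_convergent_iff pred_def)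
    have "(\<lambda>x. lim (\<lambda>i. if convergent (\<lambda>j. F (r j) x) then F (r i) x else 0)) \<in> borel_measurable M"
      by measurable
    moreover have "f x = lim (\<lambda>i. if convergent (\<lambda>j. F (r j) x) then F (r i) x else 0)" for x
      by (simp add: f_def limI)
    ultimately show ?thesis by presburger
  qed
  have ae: "AE x in M. (\<lambda>i. F (r i) x) \<longlonglongrightarrow> f x"
    using r(2) by eventually_elim (simp add: f_def Cauchy_convergent_iff convergent_LIMSEQ_iff)
  \<comment> \<open>Fatou's lemma along the subsequence; as \<open>r\<close> is strictly increasing,
    \<open>r i \<ge> i\<close>, so the bound from \<open>N\<close> on applies to the indices
    \<open>r i\<close>.\<close>
  have fatou: "(\<lambda>x. F m x - f x) \<in> l2 M \<and> l2norm M (\<lambda>x. F m x - f x) \<le> e"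
    if "e > 0" and N: "\<And>n. n \<ge> N \<Longrightarrow> l2norm M (\<lambda>x. F m x - F n x) \<le> e" for m e N
  proof -
    have "(\<integral>\<^sup>+x. ennreal ((norm (F m x - f x))\<^sup>2) \<partial>M)
        = (\<integral>\<^sup>+x. liminf (\<lambda>i. ennreal ((norm (F m x - F (r i) x))\<^sup>2)) \<partial>M)"
    proof (rule nn_integral_cong_AE, use ae in eventually_elim)
      case (elim x)
      then have "(\<lambda>i. ennreal ((norm (F m x - F (r i) x))\<^sup>2)) \<longlonglongrightarrow> ennreal ((norm (F m x - f x))\<^sup>2)"
        by (intro tendsto_ennrealI tendsto_intros)
      then show ?case by (rule lim_imp_Liminf[OF sequentially_bot, symmetric])
    qed
    also have "\<dots> \<le> liminf (\<lambda>i. \<integral>\<^sup>+x. ennreal ((norm (F m x - F (r i) x))\<^sup>2) \<partial>M)"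
      by (rule nn_integral_liminf) measurable
    also have "\<dots> \<le> limsup (\<lambda>i. \<integral>\<^sup>+x. ennreal ((norm (F m x - F (r i) x))\<^sup>2) \<partial>M)"
      by (rule Liminf_le_Limsup) simp
    also have "\<dots> \<le> ennreal (e\<^sup>2)"
    proof (rule Limsup_bounded, rule eventually_sequentiallyI[of N])
      fix i assume "i \<ge> N"
      then have "r i \<ge> N" using seq_suble[OF r(1), of i] by simp
      have "(\<integral>\<^sup>+x. ennreal ((norm (F m x - F (r i) x))\<^sup>2) \<partial>M) = ennreal ((l2norm M (\<lambda>x. F m x - F (r i) x))\<^sup>2)"
        using nn_integral_eq_integral[OF l2_integrable_norm2[OF l2_diff[OF F F]], of m "r i"]
        by (simp add: l2norm_power2)
      also have "\<dots> \<le> ennreal (e\<^sup>2)"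
        by (intro ennreal_leI power_mono N[OF \<open>r i \<ge> N\<close>]) simp
      finally show "(\<integral>\<^sup>+x. ennreal ((norm (F m x - F (r i) x))\<^sup>2) \<partial>M) \<le> ennreal (e\<^sup>2)" .
    qed
    finally have le: "(\<integral>\<^sup>+x. ennreal ((norm (F m x - f x))\<^sup>2) \<partial>M) \<le> ennreal (e\<^sup>2)" .
    then have int: "integrable M (\<lambda>x. (norm (F m x - f x))\<^sup>2)"
      by (intro integrableI_bounded) (auto intro: le_less_trans)
    have "(\<integral>x. (norm (F m x - f x))\<^sup>2 \<partial>M) \<le> e\<^sup>2"
      using le int by (simp add: nn_integral_eq_integral)
    then have "l2norm M (\<lambda>x. F m x - f x) \<le> e"
      unfolding l2norm_def using \<open>e > 0\<close> by (simp add: real_le_lsqrt)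
    then show ?thesis using int by (simp add: l2_def)
  qed
  obtain N where N: "\<And>m n. m \<ge> N \<Longrightarrow> n \<ge> N \<Longrightarrow> l2norm M (\<lambda>x. F m x - F n x) < 1"
    using C[of 1] by auto
  \<comment> \<open>One square integrable difference is enough to make \<open>f\<close> square
    integrable.\<close>
  have "(\<lambda>x. F N x - f x) \<in> l2 M" using fatou[of 1 N N] less_imp_le[OF N[of N]] by simp
  from l2_diff[OF F[of N] this] have "f \<in> l2 M" by simp
  moreover have "(\<lambda>n. l2norm M (\<lambda>x. F n x - f x)) \<longlonglongrightarrow> 0"
  proof (rule LIMSEQ_I)
    fix e :: real assume e: "e > 0"
    obtain N where N: "\<And>m n. m \<ge> N \<Longrightarrow> n \<ge> N \<Longrightarrow> l2norm M (\<lambda>x. F m x - F n x) < e / 2"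
      using C[of "e / 2"] e by auto
    have "l2norm M (\<lambda>x. F m x - f x) < e" if "m \<ge> N" for m
    proof -
      have "l2norm M (\<lambda>x. F m x - f x) \<le> e / 2"
        using fatou[of "e/2" N m] e less_imp_le[OF N[OF that]] by simp
      then show ?thesis using e by simp
    qed
    then show "\<exists>no. \<forall>n\<ge>no. norm (l2norm M (\<lambda>x. F n x - f x) - 0) < e" by auto
  qed
  ultimately show ?thesis by blast
qed

text \<open>Minimising sequences for the distance to a subspace are Cauchy by the parallelogram law; the
  residual of their limit is orthogonal to the subspace.\<close>

lemma (in finite_measure) l2norm_projection:
  fixes W :: "('a \<Rightarrow> 'b::euclidean_space) set"
  assumes W: "W \<subseteq> l2 M" and W0: "(\<lambda>x. 0) \<in> W"
    and Wadd: "\<And>f g c. f \<in> W \<Longrightarrow> g \<in> W \<Longrightarrow> (\<lambda>x. f x + c *\<^sub>R g x) \<in> W"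
    and u: "u \<in> l2 M"
  shows "\<exists>w\<in>l2 M. (\<exists>F. (\<forall>n. F n \<in> W) \<and> (\<lambda>n. l2norm M (\<lambda>x. F n x - w x)) \<longlonglongrightarrow> 0)
     \<and> (\<forall>g\<in>W. (\<integral>x. (u x - w x) \<bullet> g x \<partial>M) = 0)"
proof -
  define D where "D = (\<lambda>f. (l2norm M (\<lambda>x. u x - f x))\<^sup>2) ` W"
  define d where "d = Inf D"
  have bdd: "bdd_below D" by (rule bdd_belowI[of _ 0]) (auto simp: D_def)
  have ne: "D \<noteq> {}" using W0 by (auto simp: D_def)
  have dle: "d \<le> (l2norm M (\<lambda>x. u x - f x))\<^sup>2" if "f \<in> W" for f
    unfolding d_def using that bdd by (intro cInf_lower) (auto simp: D_def)
  have "\<exists>f\<in>W. (l2norm M (\<lambda>x. u x - f x))\<^sup>2 < d + 1 / real (Suc n)" for n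
  proof -
    have "\<exists>y\<in>D. y < d + 1 / real (Suc n)"
      using ne bdd by (intro cInf_lessD) (auto simp: d_def)
    then show ?thesis by (auto simp: D_def)
  qed
  then obtain F where F: "\<And>n. F n \<in> W" "\<And>n. (l2norm M (\<lambda>x. u x - F n x))\<^sup>2 < d + 1 / real (Suc n)"
    by metis
  have Fl: "F n \<in> l2 M" for n using F(1) W by auto
  \<comment> \<open>The midpoint of two members of the minimising sequence lies in \<open>W\<close>,
    so it is no closer to \<open>u\<close> than the infimum \<open>d\<close>; this is what bounds
    the distance of the two members.\<close>
  have par: "(l2norm M (\<lambda>x. F m x - F n x))\<^sup>2 \<le> 2 / real (Suc m) + 2 / real (Suc n)" for m n
  proof -
    define a where "a = (\<lambda>x. u x - F m x)"
    define b where "b = (\<lambda>x. u x - F n x)"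
    have ab: "a \<in> l2 M" "b \<in> l2 M" unfolding a_def b_def by (intro l2_diff u Fl)+
    have mid: "(\<lambda>x. (1/2) *\<^sub>R (F m x + F n x)) \<in> W"
      using Wadd[OF W0 Wadd[OF F(1)[of m] F(1)[of n], of 1], of "1/2"] by simp
    have "(l2norm M (\<lambda>x. F m x - F n x))\<^sup>2 = (l2norm M (\<lambda>x. a x - 1 *\<^sub>R b x))\<^sup>2"
      using l2norm_minus_commute[of M "F m" "F n"] by (simp add: a_def b_def)
    also have "\<dots> = 2 * (l2norm M a)\<^sup>2 + 2 * (l2norm M b)\<^sup>2 - (l2norm M (\<lambda>x. a x - (-1) *\<^sub>R b x))\<^sup>2"
      unfolding l2norm_power2_diff_scaleR[OF ab] by simp
    also have "(\<lambda>x. a x - (-1) *\<^sub>R b x) = (\<lambda>x. 2 *\<^sub>R (u x - (1/2) *\<^sub>R (F m x + F n x)))"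
      by (auto simp: a_def b_def algebra_simps scaleR_2)
    also have "(l2norm M \<dots>)\<^sup>2 = 4 * (l2norm M (\<lambda>x. u x - (1/2) *\<^sub>R (F m x + F n x)))\<^sup>2"
      using W mid by (subst l2_scaleR(2)) (auto intro!: l2_diff u simp: power_mult_distrib)
    finally have "(l2norm M (\<lambda>x. F m x - F n x))\<^sup>2
       = 2 * (l2norm M a)\<^sup>2 + 2 * (l2norm M b)\<^sup>2 - 4 * (l2norm M (\<lambda>x. u x - (1/2) *\<^sub>R (F m x + F n x)))\<^sup>2" .
    with dle[OF mid] F(2)[of m] F(2)[of n] show ?thesis by (simp add: a_def b_def)
  qed
  have "\<exists>N. \<forall>m\<ge>N. \<forall>n\<ge>N. l2norm M (\<lambda>x. F m x - F n x) < e" if e: "e > 0" for e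
  proof -
    obtain N where N: "inverse (real (Suc N)) < e\<^sup>2 / 4"
      using reals_Archimedean[of "e\<^sup>2 / 4"] e by auto
    have "l2norm M (\<lambda>x. F m x - F n x) < e" if mn: "m \<ge> N" "n \<ge> N" for m n
    proof -
      have "1 / real (Suc m) \<le> inverse (real (Suc N))" "1 / real (Suc n) \<le> inverse (real (Suc N))"
        using mn by (simp_all add: inverse_eq_divide frac_le)
      then have "(l2norm M (\<lambda>x. F m x - F n x))\<^sup>2 < e\<^sup>2" using par[of m n] N by simp
      then show ?thesis using e by (simp add: power2_less_imp_less)
    qed
    then show ?thesis by blast
  qed
  from l2norm_complete[OF Fl this] obtain w where w: "w \<in> l2 M" "(\<lambda>n. l2norm M (\<lambda>x. F n x - w x)) \<longlonglongrightarrow> 0"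
    by blast
  have uw: "(\<lambda>x. u x - w x) \<in> l2 M" by (intro l2_diff u w)
  have "(\<integral>x. (u x - w x) \<bullet> g x \<partial>M) = 0" if g: "g \<in> W" for g
  proof -
    have gl: "g \<in> l2 M" using g W by auto
    have lim: "(\<lambda>n. (l2norm M (\<lambda>x. (u x - F n x) - t *\<^sub>R g x))\<^sup>2)
          \<longlonglongrightarrow> (l2norm M (\<lambda>x. (u x - w x) - t *\<^sub>R g x))\<^sup>2" for t
    proof (intro tendsto_power tendsto_n2 l2_diff u Fl w l2_scaleR gl)
      show "(\<lambda>n. l2norm M (\<lambda>x. u x - F n x - t *\<^sub>R g x - (u x - w x - t *\<^sub>R g x))) \<longlonglongrightarrow> 0"
        using w(2) by (simp add: l2norm_minus_commute[of M w])
    qed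
    have ge: "d \<le> (l2norm M (\<lambda>x. (u x - w x) - t *\<^sub>R g x))\<^sup>2" for t
    proof (rule LIMSEQ_le_const[OF lim], intro exI allI impI)
      fix n :: nat
      show "d \<le> (l2norm M (\<lambda>x. u x - F n x - t *\<^sub>R g x))\<^sup>2"
        using dle[OF Wadd[OF F(1)[of n] g, of t]] by (simp add: algebra_simps)
    qed
    have le: "(l2norm M (\<lambda>x. u x - w x))\<^sup>2 \<le> d"
    proof (rule LIMSEQ_le[OF _ LIMSEQ_inverse_real_of_nat_add[of d]])
      show "(\<lambda>n. (l2norm M (\<lambda>x. u x - F n x))\<^sup>2) \<longlonglongrightarrow> (l2norm M (\<lambda>x. u x - w x))\<^sup>2"
        using lim[of 0] by simp
      show "\<exists>N. \<forall>n\<ge>N. (l2norm M (\<lambda>x. u x - F n x))\<^sup>2 \<le> d + inverse (real (Suc n))"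
        using F(2) less_imp_le by (auto simp: inverse_eq_divide)
    qed
    \<comment> \<open>Since \<open>w\<close> attains the infimum, the polynomial in \<open>t\<close>
      has constant term 0, and the discriminant bound forces its linear coefficient to
      vanish.\<close>
    have "(\<integral>x. (u x - w x) \<bullet> g x \<partial>M)\<^sup>2 \<le> 0 * (l2norm M g)\<^sup>2"
    proof (rule discriminant_le)
      fix t
      show "0 \<le> 0 - 2 * t * (\<integral>x. (u x - w x) \<bullet> g x \<partial>M) + t\<^sup>2 * (l2norm M g)\<^sup>2"
        using ge[of t] le unfolding l2norm_power2_diff_scaleR[OF uw gl] by simp
    qed simp
    then show ?thesis by simp
  qed
  with w F(1) show ?thesis by blast
qed

section \<open>Smooth functions of one variable\<close>

text \<open>Level 0 is empty: since \<open>smooth1\<close> asks for every level, each derivative is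
  itself differentiable and hence continuous.\<close>

primrec D_k :: "nat \<Rightarrow> (real \<Rightarrow> real) \<Rightarrow> bool" where
  "D_k 0 g \<longleftrightarrow> True"
| "D_k (Suc k) g \<longleftrightarrow> (\<forall>x. g field_differentiable at x) \<and> D_k k (deriv g)"

definition smooth1 :: "(real \<Rightarrow> real) \<Rightarrow> bool" where
  "smooth1 g \<longleftrightarrow> (\<forall>k. D_k k g)"

lemma smooth1_iff: "smooth1 g \<longleftrightarrow> (\<forall>x. g field_differentiable at x) \<and> smooth1 (deriv g)"
proof
  assume s: "smooth1 g"
  have "D_k (Suc k) g" for k using s by (simp only: smooth1_def)
  then show "(\<forall>x. g field_differentiable at x) \<and> smooth1 (deriv g)" by (simp add: smooth1_def)
next
  assume s: "(\<forall>x. g field_differentiable at x) \<and> smooth1 (deriv g)"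
  show "smooth1 g" unfolding smooth1_def
  proof
    fix k show "D_k k g" using s by (cases k) (auto simp: smooth1_def)
  qed
qed

lemma smooth1_DERIV: "smooth1 g \<Longrightarrow> (g has_real_derivative deriv g x) (at x)"
  by (simp add: smooth1_iff[of g] field_differentiable_derivI)

lemma smooth1_deriv: "smooth1 g \<Longrightarrow> smooth1 (deriv g)"
  by (simp add: smooth1_iff[of g])

lemma smooth1_continuous: "smooth1 g \<Longrightarrow> continuous_on A g"
  by (intro continuous_at_imp_continuous_on ballI DERIV_isCont[OF smooth1_DERIV])

lemma smooth1_measurable [measurable_dest]: "smooth1 g \<Longrightarrow> g \<in> borel_measurable borel"
  by (intro borel_measurable_continuous_onI smooth1_continuous)

lemma D_k_SucI:
  assumes "\<And>x. (g has_real_derivative g' x) (at x)" "D_k k g'"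
  shows "D_k (Suc k) g"
proof -
  have "deriv g = g'" using assms(1) DERIV_imp_deriv by blast
  then show ?thesis using assms field_differentiable_def by auto
qed

lemma D_k_DERIV: "D_k (Suc k) g \<Longrightarrow> (g has_real_derivative deriv g x) (at x)"
  using field_differentiable_derivI by auto

lemma D_k_Suc_imp: "D_k (Suc k) g \<Longrightarrow> D_k k g"
  by (induction k arbitrary: g) auto

lemma D_k_const: "D_k k (\<lambda>x. c)"
proof (induction k arbitrary: c)
  case (Suc k) show ?case by (rule D_k_SucI[where g'="\<lambda>x. 0"]) (auto intro: Suc)
qed simp

lemma D_k_add: "D_k k f \<Longrightarrow> D_k k g \<Longrightarrow> D_k k (\<lambda>x. f x + g x)"
proof (induction k arbitrary: f g)
  case (Suc k)
  note [derivative_intros] = D_k_DERIV[OF Suc.prems(1)] D_k_DERIV[OF Suc.prems(2)]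
  show ?case
    by (rule D_k_SucI[where g'="\<lambda>x. deriv f x + deriv g x"])
       (use Suc in \<open>auto intro!: derivative_eq_intros\<close>)
qed simp

lemma D_k_mult: "D_k k f \<Longrightarrow> D_k k g \<Longrightarrow> D_k k (\<lambda>x. f x * g x)"
proof (induction k arbitrary: f g)
  case (Suc k)
  note [derivative_intros] = D_k_DERIV[OF Suc.prems(1)] D_k_DERIV[OF Suc.prems(2)]
  show ?case
    by (rule D_k_SucI[where g'="\<lambda>x. deriv f x * g x + deriv g x * f x"])
       (use Suc D_k_Suc_imp in \<open>auto intro!: derivative_eq_intros D_k_add simp del: D_k.simps(2) intro: D_k_Suc_imp\<close>,
        use Suc in auto)
qed simp

lemma D_k_inverse: "D_k k f \<Longrightarrow> (\<And>x. f x \<noteq> 0) \<Longrightarrow> D_k k (\<lambda>x. inverse (f x))"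
proof (induction k arbitrary: f)
  case (Suc k)
  have i: "D_k k (\<lambda>x. inverse (f x))" using Suc D_k_Suc_imp by blast
  show ?case
  proof (rule D_k_SucI[where g'="\<lambda>x. (-1) * (deriv f x * (inverse (f x) * inverse (f x)))"])
    show "((\<lambda>x. inverse (f x)) has_real_derivative (-1) * (deriv f x * (inverse (f x) * inverse (f x)))) (at x)" for x
      using DERIV_inverse_fun[OF D_k_DERIV[OF Suc.prems(1)] Suc.prems(2), of x]
      by (simp add: power2_eq_square power_Suc)
    show "D_k k (\<lambda>x. (-1) * (deriv f x * (inverse (f x) * inverse (f x))))"
      using Suc.prems i by (intro D_k_mult D_k_const) auto
  qed
qed simp

lemma D_k_affine: "D_k k f \<Longrightarrow> D_k k (\<lambda>x. f (c * x + d))"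
proof (induction k arbitrary: f)
  case (Suc k)
  show ?case
  proof (rule D_k_SucI[where g'="\<lambda>x. deriv f (c * x + d) * c"])
    show "((\<lambda>x. f (c * x + d)) has_real_derivative deriv f (c * x + d) * c) (at x)" for x
      by (rule DERIV_chain2[OF D_k_DERIV[OF Suc.prems]]) (auto intro!: derivative_eq_intros)
    show "D_k k (\<lambda>x. deriv f (c * x + d) * c)"
      using Suc by (intro D_k_mult D_k_const) auto
  qed
qed simp

lemma smooth1_const: "smooth1 (\<lambda>x. c)"
  by (simp add: smooth1_def D_k_const)
lemma smooth1_add: "smooth1 f \<Longrightarrow> smooth1 g \<Longrightarrow> smooth1 (\<lambda>x. f x + g x)"
  by (simp add: smooth1_def D_k_add)
lemma smooth1_mult: "smooth1 f \<Longrightarrow> smooth1 g \<Longrightarrow> smooth1 (\<lambda>x. f x * g x)"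
  by (simp add: smooth1_def D_k_mult)
lemma smooth1_inverse: "smooth1 f \<Longrightarrow> (\<And>x. f x \<noteq> 0) \<Longrightarrow> smooth1 (\<lambda>x. inverse (f x))"
  by (simp add: smooth1_def D_k_inverse)
lemma smooth1_affine: "smooth1 f \<Longrightarrow> smooth1 (\<lambda>x. f (c * x + d))"
  by (simp add: smooth1_def D_k_affine)

text \<open>Differentiation shifts the phase by \<open>pi / 2\<close>, so one induction over the
  family with arbitrary \<open>d\<close> covers both sine and cosine.\<close>

lemma D_k_sin_cos: "D_k k (\<lambda>x. c * sin (x + d))"
proof (induction k arbitrary: d)
  case (Suc k)
  show ?case
  proof (rule D_k_SucI)
    show "((\<lambda>x. c * sin (x + d)) has_real_derivative c * sin (x + (d + pi / 2))) (at x)" for x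
      by (auto intro!: derivative_eq_intros simp: sin_add cos_add)
  qed (rule Suc)
qed simp

lemma smooth1_sin: "smooth1 sin"
  using D_k_sin_cos[of _ 1 0] by (simp add: smooth1_def)

lemma smooth1_cos: "smooth1 cos"
  using D_k_sin_cos[of _ 1 "pi / 2"] by (simp add: smooth1_def sin_add)

section \<open>A smooth step function built from \<open>exp (-1/t)\<close>\<close>

definition exp_recip :: "nat \<Rightarrow> real \<Rightarrow> real" where
  "exp_recip n t = (if t > 0 then (inverse t) ^ n * exp (- inverse t) else 0)"

lemma exp_recip_tendsto_0: "(exp_recip n \<longlongrightarrow> 0) (at 0)"
proof -
  have "((\<lambda>t. (inverse t) ^ n * exp (- inverse t)) \<longlongrightarrow> 0) (at_right (0::real))"
  proof -
    have "((\<lambda>x::real. x ^ n / exp x) \<longlongrightarrow> 0) at_top" by (rule tendsto_power_div_exp_0)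
    from filterlim_compose[OF this filterlim_inverse_at_top_right]
    show ?thesis by (simp add: exp_minus field_simps)
  qed
  then have r: "(exp_recip n \<longlongrightarrow> 0) (at_right 0)"
    by (rule Lim_transform_eventually) (auto simp: exp_recip_def eventually_at_filter)
  have l: "(exp_recip n \<longlongrightarrow> 0) (at_left 0)"
    by (rule Lim_transform_eventually[OF tendsto_const])
       (auto simp: exp_recip_def eventually_at_filter)
  from r l show ?thesis by (simp add: filterlim_split_at)
qed

text \<open>The functions \<open>t^(-n) exp (-1/t)\<close>, extended by 0, form a family whose
  derivatives are combinations of its members. Infinite differentiability is then an induction over
  all \<open>n\<close> at once.\<close>

lemma exp_recip_DERIV:
  "(exp_recip n has_real_derivative exp_recip (n + 2) t - real n * exp_recip (n + 1) t) (at t)"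
proof -
  consider "t < 0" | "t = 0" | "t > 0" by linarith
  then show ?thesis
  proof cases
    case 1
    have "((\<lambda>x. 0) has_real_derivative 0) (at t)" by simp
    then have "(exp_recip n has_real_derivative 0) (at t)"
      by (rule has_field_derivative_transform_within_open[where S="{..<0}"])
         (use 1 in \<open>auto simp: exp_recip_def\<close>)
    then show ?thesis using 1 by (simp add: exp_recip_def)
  next
    case 2
    \<comment> \<open>The difference quotient of \<open>exp_recip n\<close> at 0 is
      \<open>exp_recip (n + 1)\<close> itself.\<close>
    have "((\<lambda>h. exp_recip (n + 1) h) \<longlongrightarrow> 0) (at 0)" by (rule exp_recip_tendsto_0)
    then have "((\<lambda>h. (exp_recip n (0 + h) - exp_recip n 0) / h) \<longlongrightarrow> 0) (at 0)"
      by (rule Lim_transform_eventually)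
         (auto simp: eventually_at_filter exp_recip_def field_simps)
    then show ?thesis using 2 by (simp add: DERIV_def exp_recip_def)
  next
    case 3
    define i where "i = inverse t"
    have inv: "(inverse has_real_derivative - (i * i)) (at t)"
      using DERIV_inverse[of t] 3 by (simp add: i_def power2_eq_square)
    have pow: "((\<lambda>t. (inverse t) ^ n) has_real_derivative - (real n * i ^ (n + 1))) (at t)"
      using DERIV_power[OF inv, of n] by (cases n) (simp_all add: i_def algebra_simps)
    have ex: "((\<lambda>t. exp (- inverse t)) has_real_derivative exp (- i) * (i * i)) (at t)"
      using DERIV_fun_exp[OF DERIV_minus[OF inv]] by (simp add: i_def)
    have "((\<lambda>t. (inverse t) ^ n * exp (- inverse t)) has_real_derivative
        exp_recip (n + 2) t - real n * exp_recip (n + 1) t) (at t)"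
      using DERIV_mult[OF pow ex] 3 by (simp add: exp_recip_def i_def algebra_simps)
    then show ?thesis
      by (rule has_field_derivative_transform_within_open[where S="{0<..}"])
         (use 3 in \<open>auto simp: exp_recip_def\<close>)
  qed
qed

lemma smooth1_exp_recip: "smooth1 (exp_recip n)"
proof -
  have "D_k k (exp_recip n)" for k
  proof (induction k arbitrary: n)
    case (Suc k)
    show ?case
    proof (rule D_k_SucI[OF exp_recip_DERIV])
      have "D_k k (\<lambda>t. exp_recip (n + 2) t + (- real n) * exp_recip (n + 1) t)"
        by (intro D_k_add D_k_mult D_k_const Suc)
      then show "D_k k (\<lambda>t. exp_recip (n + 2) t - real n * exp_recip (n + 1) t)" by simp
    qed
  qed simp
  then show ?thesis by (simp add: smooth1_def)
qed

text \<open>The quotient \<open>e t / (e t + e (1 - t))\<close> does it, where \<open>e t\<close> is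
  \<open>exp (-1/t)\<close> for positive \<open>t\<close> and 0 otherwise: the denominator is
  positive because \<open>t\<close> or \<open>1 - t\<close> is, and the numerator of the derivative
  is a sum of products of nonnegative terms.\<close>

lemma smooth_step_exists:
  "\<exists>B. smooth1 B \<and> (\<forall>t\<le>0. B t = 0) \<and> (\<forall>t\<ge>1. B t = 1) \<and> (\<forall>t. 0 \<le> deriv B t) \<and> (\<forall>t. 0 \<le> B t \<and> B t \<le> 1)"
proof -
  define e where "e = exp_recip 0"
  define e' where "e' = exp_recip 2"
  define s where "s t = e t + e ((-1) * t + 1)" for t
  define B where "B t = e t * inverse (s t)" for t
  have epos: "e t > 0" if "t > 0" for t using that by (simp add: e_def exp_recip_def)
  have e0: "e t = 0" if "t \<le> 0" for t using that by (simp add: e_def exp_recip_def)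
  have enn: "e t \<ge> 0" for t by (simp add: e_def exp_recip_def)
  have e'nn: "e' t \<ge> 0" for t by (simp add: e'_def exp_recip_def)
  have spos: "s t > 0" for t
    using epos[of t] epos[of "1 - t"] enn[of t] enn[of "1 - t"]
    by (cases "t > 0") (auto simp: s_def algebra_simps intro: add_pos_nonneg add_nonneg_pos)
  have es: "smooth1 e" by (simp add: e_def smooth1_exp_recip)
  have ss: "smooth1 s" unfolding s_def by (intro smooth1_add es smooth1_affine)
  have Bs: "smooth1 B"
    unfolding B_def using spos by (intro smooth1_mult smooth1_inverse es ss) (metis less_irrefl)
  have eD: "(e has_real_derivative e' t) (at t)" for t
    using exp_recip_DERIV[of 0 t] by (simp add: e_def e'_def numeral_2_eq_2)
  have eD1: "((\<lambda>t. e ((-1) * t + 1)) has_real_derivative e' ((-1) * t + 1) * (-1)) (at t)" for t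
    by (rule DERIV_chain2[OF eD]) (auto intro!: derivative_eq_intros)
  have BD: "(B has_real_derivative (e' t * e ((-1) * t + 1) + e t * e' ((-1) * t + 1)) / (s t)\<^sup>2) (at t)" for t
  proof -
    have "s t \<noteq> 0" using spos[of t] by simp
    have sD: "(s has_real_derivative e' t + e' ((-1) * t + 1) * (-1)) (at t)"
      unfolding s_def by (intro DERIV_add eD eD1)
    have "((\<lambda>t. e t / s t) has_real_derivative
        (e' t * s t - e t * (e' t + e' ((-1) * t + 1) * (-1))) / (s t * s t)) (at t)"
      by (intro DERIV_divide eD sD \<open>s t \<noteq> 0\<close>)
    moreover have "e' t * s t - e t * (e' t + e' ((-1) * t + 1) * (-1))
        = e' t * e ((-1) * t + 1) + e t * e' ((-1) * t + 1)"
      by (simp add: s_def algebra_simps)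
    ultimately show ?thesis by (simp add: B_def[abs_def] divide_inverse power2_eq_square)
  qed
  have "deriv B t \<ge> 0" for t
    unfolding DERIV_imp_deriv[OF BD] using enn e'nn by auto
  moreover have "B t = 0" if "t \<le> 0" for t using e0[OF that] by (simp add: B_def)
  moreover have "B t = 1" if "t \<ge> 1" for t
    using e0[of "1 - t"] that epos[of t] by (simp add: B_def s_def)
  moreover have "0 \<le> B t \<and> B t \<le> 1" for t
    using spos[of t] enn[of t] enn[of "(-1) * t + 1"] by (auto simp: B_def s_def field_simps)
  ultimately show ?thesis using Bs by blast
qed

definition step :: "real \<Rightarrow> real" where
  "step = (SOME B. smooth1 B \<and> (\<forall>t\<le>0. B t = 0) \<and> (\<forall>t\<ge>1. B t = 1) \<and> (\<forall>t. 0 \<le> deriv B t) \<and> (\<forall>t. 0 \<le> B t \<and> B t \<le> 1))"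

lemma smooth1_step: "smooth1 step"
  and step_eq_0: "t \<le> 0 \<Longrightarrow> step t = 0"
  and step_eq_1: "t \<ge> 1 \<Longrightarrow> step t = 1"
  and deriv_step_nonneg: "0 \<le> deriv step t"
  and step_nonneg: "0 \<le> step t"
  and step_le_1: "step t \<le> 1"
  using someI_ex[OF smooth_step_exists, folded step_def] by blast+

lemma deriv_step_eq_0:
  assumes "t < 0 \<or> t > 1" shows "deriv step t = 0"
  using assms
proof
  assume "t < 0"
  have "(step has_real_derivative 0) (at t)"
    by (rule has_field_derivative_transform_within_open[where S="{..<0}" and f="\<lambda>x. 0"])
       (use \<open>t < 0\<close> in \<open>auto simp: step_eq_0\<close>)
  then show ?thesis by (rule DERIV_imp_deriv)
next
  assume "t > 1"
  have "(step has_real_derivative 0) (at t)"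
    by (rule has_field_derivative_transform_within_open[where S="{1<..}" and f="\<lambda>x. 1"])
       (use \<open>t > 1\<close> in \<open>auto simp: step_eq_1\<close>)
  then show ?thesis by (rule DERIV_imp_deriv)
qed

section \<open>Smooth functions of two variables\<close>

lemma partial_deriv_eq: "(f has_derivative f') (at x) \<Longrightarrow> partial_deriv i f x = f' (axis i 1)"
  unfolding partial_deriv_def using frechet_derivative_at by metis

lemma C_k_SucI:
  assumes "\<And>x. (f has_derivative (\<lambda>h. \<Sum>i\<in>UNIV. g i x * h $ i)) (at x)" "\<And>i. C_k k (g i)"
  shows "C_k (Suc k) f"
proof -
  have "partial_deriv i f = g i" for i
  proof
    fix x
    have "partial_deriv i f x = (\<Sum>j\<in>UNIV. g j x * axis i 1 $ j)" by (rule partial_deriv_eq[OF assms(1)])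
    also have "\<dots> = g i x" by (simp add: axis_def if_distrib cong: if_cong)
    finally show "partial_deriv i f x = g i x" .
  qed
  moreover have "f differentiable at x" for x
    using assms(1) differentiable_def by blast
  ultimately show ?thesis using assms(2) by simp
qed

lemma differentiable_has_derivative_partial:
  fixes f :: "real^2 \<Rightarrow> real"
  assumes "f differentiable (at x)"
  shows "(f has_derivative (\<lambda>h. \<Sum>i\<in>UNIV. partial_deriv i f x * h $ i)) (at x)"
proof -
  define f' where "f' = frechet_derivative f (at x)"
  have d: "(f has_derivative f') (at x)" using assms by (simp add: f'_def frechet_derivative_works[symmetric])
  have lin: "linear f'" using d has_derivative_linear by blast
  have "f' h = (\<Sum>i\<in>UNIV. partial_deriv i f x * h $ i)" for h
  proof -
    have "f' h = f' (\<Sum>i\<in>UNIV. h $ i *\<^sub>R axis i 1)"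
      using basis_expansion[of h] by (simp add: scalar_mult_eq_scaleR)
    also have "\<dots> = (\<Sum>i\<in>UNIV. h $ i * f' (axis i 1))"
      by (simp add: linear_sum[OF lin] linear_scale[OF lin])
    finally show ?thesis using partial_deriv_eq[OF d] by (simp add: mult.commute)
  qed
  then show ?thesis using d by (metis (no_types, lifting) ext)
qed

lemma C_k_Suc_imp: "C_k (Suc k) f \<Longrightarrow> C_k k f"
proof (induction k arbitrary: f)
  case 0
  then show ?case by (auto intro!: differentiable_imp_continuous_on simp: differentiable_on_def intro: differentiable_at_withinI)
qed auto

lemma C_k_has_derivative:
  "C_k (Suc k) f \<Longrightarrow> (f has_derivative (\<lambda>h. \<Sum>i\<in>UNIV. partial_deriv i f x * h $ i)) (at x)"
  by (rule differentiable_has_derivative_partial) simp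

lemma C_k_const: "C_k k (\<lambda>x. c)"
proof (induction k arbitrary: c)
  case (Suc k) show ?case by (rule C_k_SucI[where g="\<lambda>i x. 0"]) (auto intro: Suc)
qed simp

lemma C_k_coord: "C_k k (\<lambda>x. x $ j)"
proof (cases k)
  case 0 then show ?thesis by (auto intro: continuous_intros)
next
  case (Suc k)
  have "((\<lambda>x. x $ j) has_derivative (\<lambda>h. \<Sum>i\<in>UNIV. (if i = j then 1 else 0) * h $ i)) (at x)" for x :: "real^2"
    using bounded_linear_imp_has_derivative[OF bounded_linear_vec_nth]
    by (simp add: if_distrib[where f="\<lambda>a. a * _"] cong: if_cong)
  from C_k_SucI[where g="\<lambda>i x. if i = j then 1 else 0", OF this]
  show ?thesis using Suc C_k_const by simp
qed

lemma C_k_add: "C_k k f \<Longrightarrow> C_k k g \<Longrightarrow> C_k k (\<lambda>x. f x + g x)"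
proof (induction k arbitrary: f g)
  case 0 then show ?case by (auto intro: continuous_intros)
next
  case (Suc k)
  show ?case
  proof (rule C_k_SucI[where g="\<lambda>i x. partial_deriv i f x + partial_deriv i g x"])
    show "((\<lambda>x. f x + g x) has_derivative (\<lambda>h. \<Sum>i\<in>UNIV. (partial_deriv i f x + partial_deriv i g x) * h $ i)) (at x)" for x
      using has_derivative_add[OF C_k_has_derivative[OF Suc.prems(1)] C_k_has_derivative[OF Suc.prems(2)], of x]
      by (simp add: sum.distrib algebra_simps)
  qed (use Suc in auto)
qed

lemma C_k_mult: "C_k k f \<Longrightarrow> C_k k g \<Longrightarrow> C_k k (\<lambda>x. f x * g x)"
proof (induction k arbitrary: f g)
  case 0 then show ?case by (auto intro: continuous_intros)
next
  case (Suc k)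
  have fg: "C_k k f" "C_k k g" using Suc.prems by (auto intro: C_k_Suc_imp simp del: C_k.simps)
  show ?case
  proof (rule C_k_SucI[where g="\<lambda>i x. f x * partial_deriv i g x + partial_deriv i f x * g x"])
    show "((\<lambda>x. f x * g x) has_derivative (\<lambda>h. \<Sum>i\<in>UNIV. (f x * partial_deriv i g x + partial_deriv i f x * g x) * h $ i)) (at x)" for x
      using has_derivative_mult[OF C_k_has_derivative[OF Suc.prems(1)] C_k_has_derivative[OF Suc.prems(2)], of x]
      by (simp add: sum.distrib sum_distrib_left sum_distrib_right algebra_simps)
  qed (use Suc fg in \<open>auto intro!: C_k_add\<close>)
qed

lemma C_k_smooth1: "C_k k f \<Longrightarrow> smooth1 g \<Longrightarrow> C_k k (\<lambda>x. g (f x))"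
proof (induction k arbitrary: f g)
  case 0 then show ?case
    by (auto intro: continuous_on_compose2[OF smooth1_continuous])
next
  case (Suc k)
  have f: "C_k k f" using Suc.prems by (auto intro: C_k_Suc_imp simp del: C_k.simps)
  show ?case
  proof (rule C_k_SucI[where g="\<lambda>i x. deriv g (f x) * partial_deriv i f x"])
    show "((\<lambda>x. g (f x)) has_derivative (\<lambda>h. \<Sum>i\<in>UNIV. (deriv g (f x) * partial_deriv i f x) * h $ i)) (at x)" for x
      using has_derivative_compose[OF C_k_has_derivative[OF Suc.prems(1)]
          smooth1_DERIV[OF Suc.prems(2), unfolded has_field_derivative_def], of x]
      by (simp add: sum_distrib_left mult.assoc)
  qed (use Suc f smooth1_deriv in \<open>auto intro!: C_k_mult\<close>)
qed

lemma smooth_const: "smooth (\<lambda>x. c)" by (simp add: smooth_def C_k_const)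
lemma smooth_coord: "smooth (\<lambda>x. x $ j)" by (simp add: smooth_def C_k_coord)
lemma smooth_add: "smooth f \<Longrightarrow> smooth g \<Longrightarrow> smooth (\<lambda>x. f x + g x)"
  by (simp add: smooth_def C_k_add)
lemma smooth_mult: "smooth f \<Longrightarrow> smooth g \<Longrightarrow> smooth (\<lambda>x. f x * g x)"
  by (simp add: smooth_def C_k_mult)
lemma smooth_diff: "smooth f \<Longrightarrow> smooth g \<Longrightarrow> smooth (\<lambda>x. f x - g x)"
  using smooth_add[OF _ smooth_mult[OF smooth_const[of "-1"]], of f g] by simp
lemma smooth_smooth1: "smooth f \<Longrightarrow> smooth1 g \<Longrightarrow> smooth (\<lambda>x. g (f x))"
  by (simp add: smooth_def C_k_smooth1)

lemma smooth_differentiable: "smooth f \<Longrightarrow> f differentiable (at x)"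
  unfolding smooth_def by (metis C_k.simps(2))

lemma smooth_partial_deriv: "smooth f \<Longrightarrow> smooth (partial_deriv i f)"
  unfolding smooth_def by (metis C_k.simps(2))

lemma smooth_continuous_on: "smooth f \<Longrightarrow> continuous_on A f"
  unfolding smooth_def by (metis C_k.simps(1) continuous_on_subset subset_UNIV)

lemma smooth_borel [measurable_dest]: "smooth f \<Longrightarrow> f \<in> borel_measurable borel"
  by (intro borel_measurable_continuous_onI smooth_continuous_on)

definition classical_grad :: "(real^2 \<Rightarrow> real) \<Rightarrow> real^2 \<Rightarrow> real^2" where
  "classical_grad f x = (\<chi> i. partial_deriv i f x)"

lemma classical_grad_nth [simp]: "classical_grad f x $ i = partial_deriv i f x"
  by (simp add: classical_grad_def)

lemma has_derivative_classical_grad: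
  "f differentiable (at x) \<Longrightarrow> (f has_derivative (\<lambda>h. classical_grad f x \<bullet> h)) (at x)"
  using differentiable_has_derivative_partial[of f x] by (simp add: inner_vec_def)

lemma classical_grad_eqI:
  assumes "(f has_derivative (\<lambda>h. g \<bullet> h)) (at x)"
  shows "classical_grad f x = g"
  using partial_deriv_eq[OF assms] by (simp add: vec_eq_iff inner_axis)

lemma classical_grad_add:
  assumes "f differentiable (at x)" "g differentiable (at x)"
  shows "classical_grad (\<lambda>x. f x + g x) x = classical_grad f x + classical_grad g x"
  using has_derivative_add[OF assms[THEN has_derivative_classical_grad]]
  by (intro classical_grad_eqI) (simp add: inner_add_left)

lemma classical_grad_mult:
  assumes "f differentiable (at x)" "g differentiable (at x)"
  shows "classical_grad (\<lambda>x. f x * g x) x = f x *\<^sub>R classical_grad g x + g x *\<^sub>R classical_grad f x"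
  using has_derivative_mult[OF assms[THEN has_derivative_classical_grad]]
  by (intro classical_grad_eqI) (simp add: inner_add_left mult.commute)

lemma classical_grad_const [simp]: "classical_grad (\<lambda>x. c) x = 0"
  by (rule classical_grad_eqI) simp

lemma classical_grad_cmult:
  "f differentiable (at x) \<Longrightarrow> classical_grad (\<lambda>x. c * f x) x = c *\<^sub>R classical_grad f x"
  using classical_grad_mult[of "\<lambda>x. c" x f] by simp

lemma classical_grad_smooth1:
  assumes "f differentiable (at x)" "smooth1 g"
  shows "classical_grad (\<lambda>x. g (f x)) x = deriv g (f x) *\<^sub>R classical_grad f x"
  using has_derivative_compose[OF has_derivative_classical_grad[OF assms(1)]
          smooth1_DERIV[OF assms(2), unfolded has_field_derivative_def]]
  by (intro classical_grad_eqI) simp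

lemma classical_grad_coord: "classical_grad (\<lambda>x. x $ j) x = axis j 1"
  using bounded_linear_imp_has_derivative[OF bounded_linear_vec_nth]
  by (intro classical_grad_eqI) (simp add: inner_axis')

lemma smooth_classical_grad_continuous: "smooth f \<Longrightarrow> continuous_on A (classical_grad f)"
  unfolding classical_grad_def
  by (intro continuous_on_vec_lambda smooth_continuous_on smooth_partial_deriv)

lemma classical_grad_eq_0:
  assumes "open U" "x \<in> U" "\<And>y. y \<in> U \<Longrightarrow> f y = c"
  shows "classical_grad f x = 0"
  by (rule classical_grad_eqI, rule has_derivative_transform_within_open[where f="\<lambda>x. c", OF _ assms(1,2)])
     (use assms(3) in auto)

section \<open>Integration\<close>

text \<open>On the convex set \<open>S\<close> the mean value theorem bounds the difference
  quotients by \<open>K\<close>, so a multiple of the integrable \<open>f\<close> dominates. The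
  rough weight \<open>f\<close> is kept apart from the parameter, which enters only the bounded
  factor \<open>F\<close>.\<close>

lemma DERIV_integral_param:
  fixes F F' :: "real \<Rightarrow> 'a \<Rightarrow> real" and f :: "'a \<Rightarrow> real"
  assumes f: "integrable M f" and S: "open S" "convex S" "t0 \<in> S"
    and Fm: "\<And>t. t \<in> S \<Longrightarrow> F t \<in> borel_measurable M" and F'm: "F' t0 \<in> borel_measurable M"
    and D: "\<And>t x. t \<in> S \<Longrightarrow> x \<in> space M \<Longrightarrow> ((\<lambda>t. F t x) has_real_derivative F' t x) (at t)"
    and K: "\<And>t x. t \<in> S \<Longrightarrow> x \<in> space M \<Longrightarrow> \<bar>F' t x\<bar> \<le> K"
    and b: "\<And>t x. t \<in> S \<Longrightarrow> x \<in> space M \<Longrightarrow> \<bar>F t x\<bar> \<le> L"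
  shows "((\<lambda>t. \<integral>x. f x * F t x \<partial>M) has_real_derivative (\<integral>x. f x * F' t0 x \<partial>M)) (at t0)"
  unfolding has_field_derivative_iff tendsto_at_iff_sequentially comp_def
proof (intro allI impI)
  fix X :: "nat \<Rightarrow> real" assume X: "\<forall>i. X i \<in> UNIV - {t0}" "X \<longlonglongrightarrow> t0"
  have fm [measurable]: "f \<in> borel_measurable M" using f by simp
  note [measurable] = F'm
  have int: "integrable M (\<lambda>x. f x * F t x)" if "t \<in> S" for t
  proof (rule Bochner_Integration.integrable_bound)
    show "integrable M (\<lambda>x. L * f x)" using f by simp
    show "(\<lambda>x. f x * F t x) \<in> borel_measurable M" using Fm[OF that] by measurable
    show "AE x in M. norm (f x * F t x) \<le> norm (L * f x)"
    proof (rule AE_I2)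
      fix x assume "x \<in> space M"
      then have "\<bar>F t x\<bar> \<le> \<bar>L\<bar>" using b[OF that] by fastforce
      then show "norm (f x * F t x) \<le> norm (L * f x)"
        using mult_left_mono[OF _ abs_ge_zero[of "f x"], of "\<bar>F t x\<bar>" "\<bar>L\<bar>"]
        by (simp add: abs_mult ac_simps)
    qed
  qed
  \<comment> \<open>Only finitely many \<open>X n\<close> can lie outside \<open>S\<close>; the
    value 0 there keeps the dominating bound valid for every \<open>n\<close>.\<close>
  define s where "s n x = (if X n \<in> S then f x * ((F (X n) x - F t0 x) / (X n - t0)) else 0)" for n x
  have evS: "\<forall>\<^sub>F n in sequentially. X n \<in> S"
    using topological_tendstoD[OF X(2) S(1,3)] .
  have "(\<lambda>n. \<integral>x. s n x \<partial>M) \<longlonglongrightarrow> (\<integral>x. f x * F' t0 x \<partial>M)"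
  proof (rule integral_dominated_convergence[where w="\<lambda>x. norm (f x * K)"])
    show "(\<lambda>x. f x * F' t0 x) \<in> borel_measurable M" by measurable
    show "s n \<in> borel_measurable M" for n
    proof (cases "X n \<in> S")
      case True
      note [measurable] = Fm[OF True] Fm[OF S(3)]
      show ?thesis unfolding s_def using True by simp
    qed (simp add: s_def[abs_def])
    show "integrable M (\<lambda>x. norm (f x * K))" using f by simp
    show "AE x in M. (\<lambda>n. s n x) \<longlonglongrightarrow> f x * F' t0 x"
    proof (rule AE_I2)
      fix x assume x: "x \<in> space M"
      have "(\<lambda>n. (F (X n) x - F t0 x) / (X n - t0)) \<longlonglongrightarrow> F' t0 x"
        using D[OF S(3) x] X
        unfolding has_field_derivative_iff tendsto_at_iff_sequentially comp_def by blast
      then have "(\<lambda>n. f x * ((F (X n) x - F t0 x) / (X n - t0))) \<longlonglongrightarrow> f x * F' t0 x"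
        by (intro tendsto_intros)
      then show "(\<lambda>n. s n x) \<longlonglongrightarrow> f x * F' t0 x"
        by (rule Lim_transform_eventually) (use evS in \<open>auto elim!: eventually_mono simp: s_def\<close>)
    qed
    show "AE x in M. norm (s n x) \<le> norm (f x * K)" for n
    proof (rule AE_I2)
      fix x assume x: "x \<in> space M"
      have "\<bar>(F (X n) x - F t0 x) / (X n - t0)\<bar> \<le> K" if "X n \<in> S"
      proof -
        have "norm (F (X n) x - F t0 x) \<le> K * norm (X n - t0)"
          by (rule field_differentiable_bound[OF S(2), of "\<lambda>t. F t x" "\<lambda>t. F' t x"])
             (use D K x that S(3) in \<open>auto intro: has_field_derivative_at_within\<close>)
        then show ?thesis using X(1)[rule_format, of n] by (simp add: abs_divide pos_divide_le_eq)
      qed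
      then have "\<bar>f x\<bar> * \<bar>(F (X n) x - F t0 x) / (X n - t0)\<bar> \<le> \<bar>f x\<bar> * \<bar>K\<bar>" if "X n \<in> S"
        using that by (intro mult_left_mono) auto
      then show "norm (s n x) \<le> norm (f x * K)"
        by (auto simp: s_def abs_mult)
    qed
  qed
  then show "(\<lambda>n. ((\<integral>x. f x * F (X n) x \<partial>M) - (\<integral>x. f x * F t0 x \<partial>M)) / (X n - t0)) \<longlonglongrightarrow> (\<integral>x. f x * F' t0 x \<partial>M)"
  proof (rule Lim_transform_eventually)
    show "\<forall>\<^sub>F n in sequentially. (\<integral>x. s n x \<partial>M)
        = ((\<integral>x. f x * F (X n) x \<partial>M) - (\<integral>x. f x * F t0 x \<partial>M)) / (X n - t0)"
      using evS
    proof eventually_elim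
      case (elim n)
      have "(\<integral>x. s n x \<partial>M) = (\<integral>x. (f x * F (X n) x - f x * F t0 x) / (X n - t0) \<partial>M)"
        by (intro Bochner_Integration.integral_cong refl) (simp add: s_def elim algebra_simps)
      also have "\<dots> = ((\<integral>x. f x * F (X n) x \<partial>M) - (\<integral>x. f x * F t0 x \<partial>M)) / (X n - t0)"
        using int[OF elim] int[OF S(3)] by simp
      finally show ?case .
    qed
  qed
qed

lemma lborel_integral_translation:
  fixes f :: "'a::euclidean_space \<Rightarrow> 'b::{banach, second_countable_topology}"
  assumes [measurable]: "f \<in> borel_measurable borel"
  shows "(\<integral>x. f (c + x) \<partial>lborel) = (\<integral>x. f x \<partial>lborel)"
proof -
  have "(\<integral>x. f x \<partial>lborel) = (\<integral>x. f x \<partial>distr lborel borel ((+) c))" by (simp add: lborel_distr_plus)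
  also have "\<dots> = (\<integral>x. f (c + x) \<partial>lborel)" by (rule integral_distr) auto
  finally show ?thesis by simp
qed

lemma integrable_continuous_compact_support:
  fixes f :: "'a::euclidean_space \<Rightarrow> 'b::{banach, second_countable_topology}"
  assumes "continuous_on UNIV f" "compact K" "\<And>x. x \<notin> K \<Longrightarrow> f x = 0"
  shows "integrable lborel f"
proof -
  have "integrable lborel (\<lambda>x. indicator K x *\<^sub>R f x)"
    using assms by (intro borel_integrable_compact) (auto intro: continuous_on_subset)
  moreover have "(\<lambda>x. indicator K x *\<^sub>R f x) = f" using assms(3) by (auto simp: indicator_def)
  ultimately show ?thesis by simp
qed

lemma continuous_compact_support_bounded:
  fixes f :: "'a::metric_space \<Rightarrow> 'b::real_normed_vector"
  assumes "continuous_on UNIV f" "compact K" "\<And>x. x \<notin> K \<Longrightarrow> f x = 0"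
  shows "\<exists>L. 0 < L \<and> (\<forall>x. norm (f x) \<le> L)"
proof -
  have "bounded (f ` K)"
    using assms by (intro compact_imp_bounded compact_continuous_image) (auto intro: continuous_on_subset)
  then obtain L where "L > 0" "\<forall>y\<in>f ` K. norm y \<le> L" using bounded_pos by blast
  then have "norm (f x) \<le> L" for x using assms(3)[of x] by (cases "x \<in> K") auto
  then show ?thesis using \<open>L > 0\<close> by blast
qed

text \<open>The integral of \<open>f\<close> does not change under translations along the axis, so
  its derivative in the translation parameter, which is the integral of the partial derivative, is
  0.\<close>

lemma integral_partial_deriv_eq_0:
  fixes f :: "real^2 \<Rightarrow> real"
  assumes d: "\<And>x. f differentiable (at x)" and c: "continuous_on UNIV (partial_deriv i f)"
    and K: "compact K" "\<And>x. x \<notin> K \<Longrightarrow> f x = 0"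
  shows "(\<integral>x. partial_deriv i f x \<partial>lborel) = 0"
proof -
  define e where "e = (axis i 1 :: real^2)"
  have fc: "continuous_on UNIV f"
    by (intro differentiable_imp_continuous_on) (simp add: differentiable_on_def d differentiable_at_withinI)
  have pK: "partial_deriv i f x = 0" if "x \<notin> K" for x
  proof -
    have "classical_grad f x = 0"
      using K that compact_imp_closed by (intro classical_grad_eq_0[of "- K" x f 0]) auto
    then show ?thesis using classical_grad_nth by (metis zero_index)
  qed
  obtain R where R: "\<And>x. x \<in> K \<Longrightarrow> norm x \<le> R" using K compact_imp_bounded bounded_iff by metis
  obtain L1 where L1: "\<And>x. \<bar>partial_deriv i f x\<bar> \<le> L1"
    using continuous_compact_support_bounded[OF c K(1)] pK by auto
  obtain L2 where L2: "\<And>x. \<bar>f x\<bar> \<le> L2"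
    using continuous_compact_support_bounded[OF fc K(1)] K(2) by auto
  \<comment> \<open>A weight that is 1 on the supports of all translates by less than 1. It supplies
    the integrable factor that differentiation under the integral asks for.\<close>
  define w where "w = (indicator (cball 0 (R + 1)) :: real^2 \<Rightarrow> real)"
  have [measurable]: "f \<in> borel_measurable borel" "partial_deriv i f \<in> borel_measurable borel"
    using fc c by (auto intro: borel_measurable_continuous_onI)
  have "emeasure lborel (cball (0::real^2) (R + 1)) < \<infinity>"
    by (rule emeasure_bounded_finite) simp
  then have wi: "integrable lborel w" unfolding w_def by simp
  have out: "w x = 1" if "\<bar>t\<bar> < 1" "x + t *\<^sub>R e \<in> K" for x t
  proof -
    have "norm x \<le> norm (x + t *\<^sub>R e) + norm (t *\<^sub>R e)" by (metis add_diff_cancel norm_triangle_ineq4)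
    also have "\<dots> \<le> R + 1" using R[OF that(2)] that(1) by (simp add: e_def)
    finally show ?thesis by (simp add: w_def)
  qed
  have D: "((\<lambda>t. \<integral>x. w x * f (x + t *\<^sub>R e) \<partial>lborel) has_real_derivative
      (\<integral>x. w x * partial_deriv i f (x + 0 *\<^sub>R e) \<partial>lborel)) (at 0)"
  proof (rule DERIV_integral_param[where S="{-1<..<1}" and K=L1 and L=L2 and F'="\<lambda>t x. partial_deriv i f (x + t *\<^sub>R e)"])
    fix t and x :: "real^2"
    have "((\<lambda>t. x + t *\<^sub>R e) has_derivative (\<lambda>h. h *\<^sub>R e)) (at t)"
      by (auto intro!: derivative_eq_intros)
    from has_derivative_compose[OF this has_derivative_classical_grad[OF d]]
    show "((\<lambda>t. f (x + t *\<^sub>R e)) has_real_derivative partial_deriv i f (x + t *\<^sub>R e)) (at t)"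
      by (rule has_derivative_imp_has_field_derivative) (simp add: e_def inner_axis)
  qed (use wi L1 L2 in \<open>auto simp: convex_real_interval\<close>)
  have "(\<lambda>x. w x * f (x + t *\<^sub>R e)) = (\<lambda>x. f (t *\<^sub>R e + x))" if "\<bar>t\<bar> < 1" for t
    using out[OF that] K(2) by (fastforce simp: add.commute)
  then have const: "(\<integral>x. w x * f (x + t *\<^sub>R e) \<partial>lborel) = (\<integral>x. f x \<partial>lborel)" if "\<bar>t\<bar> < 1" for t
    using that by (simp add: lborel_integral_translation)
  have "((\<lambda>t. \<integral>x. w x * f (x + t *\<^sub>R e) \<partial>lborel) has_real_derivative 0) (at 0)"
    by (rule has_field_derivative_transform_within_open[where S="{-1<..<1}" and f="\<lambda>t. \<integral>x. f x \<partial>lborel"])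
       (auto simp: const)
  then have "(\<integral>x. w x * partial_deriv i f (x + 0 *\<^sub>R e) \<partial>lborel) = 0"
    using D DERIV_unique by blast
  moreover have "(\<lambda>x. w x * partial_deriv i f (x + 0 *\<^sub>R e)) = partial_deriv i f"
    using out[of 0] pK by fastforce
  ultimately show ?thesis by simp
qed

section \<open>Test functions\<close>

lemma test_functionsI:
  assumes "smooth f" "compact K" "K \<subseteq> \<Omega>" "\<And>x. x \<notin> K \<Longrightarrow> f x = 0"
  shows "f \<in> test_functions \<Omega>"
proof -
  have sub: "closure {x. f x \<noteq> 0} \<subseteq> K"
    using assms by (intro closure_minimal) (auto simp: compact_imp_closed)
  then have "compact (closure {x. f x \<noteq> 0})"
    using compact_Int_closed[OF assms(2) closed_closure[of "{x. f x \<noteq> 0}"]] by (simp add: inf.absorb2)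
  then show ?thesis using assms sub by (auto simp: test_functions_def)
qed

lemma test_functionsE:
  assumes "f \<in> test_functions \<Omega>"
  obtains K where "smooth f" "compact K" "K \<subseteq> \<Omega>" "\<And>x. x \<notin> K \<Longrightarrow> f x = 0"
    "\<And>x. x \<notin> K \<Longrightarrow> classical_grad f x = 0"
proof -
  let ?K = "closure {x. f x \<noteq> 0}"
  have K: "compact ?K" "?K \<subseteq> \<Omega>" "smooth f" using assms by (auto simp: test_functions_def)
  have z: "f x = 0" if "x \<notin> ?K" for x
    using that closure_subset[of "{x. f x \<noteq> 0}"] by (metis (mono_tags) mem_Collect_eq subsetD)
  have zg: "classical_grad f x = 0" if "x \<notin> ?K" for x
  proof (rule classical_grad_eq_0)
    show "open (- ?K)" by (rule open_Compl[OF closed_closure])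
    show "x \<in> - ?K" using that by simp
    show "f y = 0" if "y \<in> - ?K" for y using z[of y] that by simp
  qed
  show ?thesis by (rule that[OF K(3,1,2) z zg])
qed

lemma test_functions_smooth: "f \<in> test_functions \<Omega> \<Longrightarrow> smooth f"
  by (simp add: test_functions_def)

lemma test_functions_mult:
  assumes "f \<in> test_functions \<Omega>" "smooth g"
  shows "(\<lambda>x. f x * g x) \<in> test_functions \<Omega>"
proof (rule test_functionsE[OF assms(1)])
  fix K assume K: "smooth f" "compact K" "K \<subseteq> \<Omega>" "\<And>x. x \<notin> K \<Longrightarrow> f x = 0"
  show ?thesis
    by (rule test_functionsI[OF smooth_mult[OF K(1) assms(2)] K(2,3)]) (simp add: K(4))
qed

lemma test_functions_cmult: "f \<in> test_functions \<Omega> \<Longrightarrow> (\<lambda>x. c * f x) \<in> test_functions \<Omega>"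
  using test_functions_mult[OF _ smooth_const[of c]] by (simp add: mult.commute)

lemma test_functions_add:
  assumes "f \<in> test_functions \<Omega>" "g \<in> test_functions \<Omega>"
  shows "(\<lambda>x. f x + g x) \<in> test_functions \<Omega>"
proof -
  obtain K where K: "smooth f" "compact K" "K \<subseteq> \<Omega>" "\<And>x. x \<notin> K \<Longrightarrow> f x = 0"
    using assms(1) by (rule test_functionsE) blast
  obtain K' where K': "smooth g" "compact K'" "K' \<subseteq> \<Omega>" "\<And>x. x \<notin> K' \<Longrightarrow> g x = 0"
    using assms(2) by (rule test_functionsE) blast
  show ?thesis by (rule test_functionsI[of _ "K \<union> K'"]) (use K K' in \<open>auto intro: smooth_add\<close>)
qed

lemma test_functions_smooth1:
  assumes "f \<in> test_functions \<Omega>" "smooth1 g" "g 0 = 0"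
  shows "(\<lambda>x. g (f x)) \<in> test_functions \<Omega>"
proof (rule test_functionsE[OF assms(1)])
  fix K assume K: "smooth f" "compact K" "K \<subseteq> \<Omega>" "\<And>x. x \<notin> K \<Longrightarrow> f x = 0"
  show ?thesis
    by (rule test_functionsI[OF smooth_smooth1[OF K(1) assms(2)] K(2,3)]) (simp add: K(4) assms(3))
qed

lemma test_functions_zero: "(\<lambda>x. 0) \<in> test_functions \<Omega>"
  by (rule test_functionsI[of _ "{}"]) (auto intro: smooth_const)

lemma test_functions_bounded:
  assumes "f \<in> test_functions \<Omega>"
  shows "\<exists>L. 0 < L \<and> (\<forall>x. \<bar>f x\<bar> \<le> L)" "\<exists>L. 0 < L \<and> (\<forall>x. norm (classical_grad f x) \<le> L)"
proof -
  obtain K where K: "smooth f" "compact K" "K \<subseteq> \<Omega>" "\<And>x. x \<notin> K \<Longrightarrow> f x = 0"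
    "\<And>x. x \<notin> K \<Longrightarrow> classical_grad f x = 0"
    using assms by (rule test_functionsE) blast
  show "\<exists>L. 0 < L \<and> (\<forall>x. \<bar>f x\<bar> \<le> L)"
    using continuous_compact_support_bounded[OF smooth_continuous_on K(2,4)] K(1) by simp
  show "\<exists>L. 0 < L \<and> (\<forall>x. norm (classical_grad f x) \<le> L)"
    using continuous_compact_support_bounded[OF smooth_classical_grad_continuous K(2,5)] K(1) by simp
qed

section \<open>Weak gradients\<close>

locale planar_domain =
  fixes \<Omega> :: "(real^2) set"
  assumes open_dom: "open \<Omega>" and bounded_dom: "bounded \<Omega>"
begin

abbreviation vol :: "(real^2) measure" where "vol \<equiv> restrict_space lborel \<Omega>"

lemma dom_measurable [measurable]: "\<Omega> \<in> sets borel" "\<Omega> \<in> sets lborel"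
  using open_dom by auto

lemma space_vol [simp]: "space vol = \<Omega>"
  by (simp add: space_restrict_space)

sublocale vol: finite_measure vol
proof
  have "emeasure lborel \<Omega> < \<infinity>" by (rule emeasure_bounded_finite[OF bounded_dom])
  then show "emeasure vol (space vol) \<noteq> \<infinity>" by (simp add: emeasure_restrict_space)
qed

lemma set_lint_eq: "(LINT x:\<Omega>|lborel. f x) = (\<integral>x. f x \<partial>vol)"
  for f :: "real^2 \<Rightarrow> 'b::{banach, second_countable_topology}"
  by (simp add: set_lebesgue_integral_def integral_restrict_space)

lemma borel_vol: "f \<in> borel_measurable borel \<Longrightarrow> f \<in> borel_measurable vol"
  by (rule measurable_restrict_space1) simp

lemma continuous_on_vol: "continuous_on \<Omega> f \<Longrightarrow> f \<in> borel_measurable vol"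
  using borel_measurable_continuous_on_restrict[of \<Omega> f]
  by (simp cong: measurable_cong_sets sets_restrict_space_cong)

lemma L2_eq: "L2 \<Omega> = l2 vol"
  by (auto simp: L2_def l2_def set_borel_measurable_def set_integrable_def
      borel_measurable_restrict_space_iff integrable_restrict_space)

lemma L2_norm_eq: "L2_norm \<Omega> = l2norm vol"
  by (auto simp: L2_norm_def l2norm_def set_lint_eq)

lemma has_weak_gradient_iff:
  "has_weak_gradient \<Omega> u g \<longleftrightarrow>
     (\<forall>\<phi>\<in>test_functions \<Omega>. \<forall>i. (\<integral>x. u x * partial_deriv i \<phi> x \<partial>vol) = - (\<integral>x. g x $ i * \<phi> x \<partial>vol))"
  by (simp add: has_weak_gradient_def set_lint_eq)

section \<open>The fundamental lemma of the calculus of variations\<close>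

lemma box_integral_eq_0:
  assumes gm [measurable]: "g \<in> borel_measurable vol" and gi: "integrable vol (\<lambda>x. g x * indicator (cbox a b) x)"
    and z: "\<And>\<phi>. \<phi> \<in> test_functions \<Omega> \<Longrightarrow> (\<integral>x. g x * \<phi> x \<partial>vol) = 0"
    and ab: "cbox a b \<subseteq> \<Omega>"
  shows "(\<integral>x. g x * indicator (box a b) x \<partial>vol) = 0"
proof -
  \<comment> \<open>Products of four steps that converge to the indicator of the open box. Each of
    them vanishes off the open box, so its support stays in \<open>cbox a b\<close>.\<close>
  define \<phi> where "\<phi> n x = (step (real n * x$1 + - (real n * a$1)) * step ((- real n) * x$1 + real n * b$1))
     * (step (real n * x$2 + - (real n * a$2)) * step ((- real n) * x$2 + real n * b$2))" for n and x :: "real^2"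
  have sm: "smooth (\<phi> n)" for n
    unfolding \<phi>_def by (intro smooth_mult smooth_smooth1[where g="\<lambda>t. step (_ * t + _)"] smooth_coord smooth1_affine smooth1_step)
  have supp: "\<phi> n x = 0" if "x \<notin> box a b" for n x
  proof -
    have "\<exists>i. x$i \<le> a$i \<or> b$i \<le> x$i" using that by (auto simp: mem_box_cart not_less)
    then obtain i where i: "x$i \<le> a$i \<or> b$i \<le> x$i" by blast
    have "step (real n * x$i + - (real n * a$i)) = 0 \<or> step ((- real n) * x$i + real n * b$i) = 0"
      using i by (auto intro!: step_eq_0 mult_left_mono)
    then show ?thesis using exhaust_2[of i] by (auto simp: \<phi>_def)
  qed
  have test: "\<phi> n \<in> test_functions \<Omega>" for n
    by (rule test_functionsI[OF sm _ ab]) (use supp box_subset_cbox[of a b] in auto)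
  have "(\<lambda>n. \<integral>x. g x * \<phi> n x \<partial>vol) \<longlonglongrightarrow> (\<integral>x. g x * indicator (box a b) x \<partial>vol)"
  proof (rule integral_dominated_convergence[where w="\<lambda>x. norm (g x * indicator (cbox a b) x)"])
    show "(\<lambda>x. g x * indicator (box a b) x) \<in> borel_measurable vol"
      by (rule borel_measurable_times[OF _ borel_vol]) measurable
    show "(\<lambda>x. g x * \<phi> n x) \<in> borel_measurable vol" for n
      by (rule borel_measurable_times[OF _ borel_vol[OF smooth_borel[OF sm]]]) measurable
    show "integrable vol (\<lambda>x. norm (g x * indicator (cbox a b) x))" by (rule integrable_norm[OF gi])
    have "\<bar>\<phi> n x\<bar> \<le> 1" for n x
      unfolding \<phi>_def by (auto simp: abs_mult abs_of_nonneg step_nonneg intro!: mult_le_one step_le_1)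
    then have "\<bar>\<phi> n x\<bar> \<le> indicator (cbox a b) x" for n x
      using supp[of x n] box_subset_cbox[of a b] by (cases "x \<in> box a b") auto
    then show "AE x in vol. norm (g x * \<phi> n x) \<le> norm (g x * indicator (cbox a b) x)" for n
      by (auto simp: abs_mult intro!: mult_left_mono)
    have "(\<lambda>n. \<phi> n x) \<longlonglongrightarrow> indicator (box a b) x" for x
    proof (cases "x \<in> box a b")
      case True
      have lim: "\<forall>\<^sub>F n in sequentially. step (real n * s + - (real n * t)) = 1" if "t < s" for s t
      proof -
        obtain N where N: "1 / (s - t) < real N" using reals_Archimedean2 by blast
        have "step (real n * s + - (real n * t)) = 1" if "n \<ge> N" for n
        proof (rule step_eq_1)
          have "1 \<le> real N * (s - t)" using N \<open>t < s\<close> by (simp add: pos_divide_less_eq)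
          also have "\<dots> \<le> real n * (s - t)" using that \<open>t < s\<close> by (intro mult_right_mono) auto
          finally show "1 \<le> real n * s + - (real n * t)" by (simp add: algebra_simps)
        qed
        then show ?thesis by (auto simp: eventually_sequentially)
      qed
      have lim': "\<forall>\<^sub>F n in sequentially. step ((- real n) * s + real n * t) = 1" if "s < t" for s t
        using lim[OF that] by (simp add: algebra_simps)
      have "\<forall>\<^sub>F n in sequentially. \<phi> n x = 1"
      proof -
        have ab: "a$1 < x$1" "a$2 < x$2" "x$1 < b$1" "x$2 < b$2" using True by (auto simp: mem_box_cart)
        show ?thesis
          using lim[OF ab(1)] lim[OF ab(2)] lim'[OF ab(3)] lim'[OF ab(4)]
          unfolding \<phi>_def by eventually_elim (simp only: mult_1_left)
      qed
      then show ?thesis using True by (simp add: tendsto_eventually)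
    qed (simp add: supp)
    then show "AE x in vol. (\<lambda>n. g x * \<phi> n x) \<longlonglongrightarrow> g x * indicator (box a b) x"
      by (auto intro!: tendsto_intros)
  qed
  then show ?thesis using z[OF test] by (simp add: LIMSEQ_const_iff)
qed

text \<open>Integrability is asked for on closed boxes only, because the lemma is applied to a
  difference with a function that is merely known to be continuous in the open set. Integrals over
  boxes determine those over all Borel subsets of a box by the pi-lambda theorem, and countably many
  boxes cover \<Omega>.\<close>

lemma fundamental_lemma_local:
  fixes g :: "real^2 \<Rightarrow> real"
  assumes gm [measurable]: "g \<in> borel_measurable vol"
    and gi: "\<And>a b. cbox a b \<subseteq> \<Omega> \<Longrightarrow> integrable vol (\<lambda>x. g x * indicator (cbox a b) x)"
    and z: "\<And>\<phi>. \<phi> \<in> test_functions \<Omega> \<Longrightarrow> (\<integral>x. g x * \<phi> x \<partial>vol) = 0"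
  shows "AE x in vol. g x = 0"
proof -
  define G where "G = (\<lambda>x. indicator \<Omega> x *\<^sub>R g x)"
  have Gbox: "(\<integral>x. G x * indicator (box a b) x \<partial>lborel) = 0" if "cbox a b \<subseteq> \<Omega>" for a b
    using box_integral_eq_0[OF gm gi[OF that] z that] by (simp add: G_def integral_restrict_space mult.assoc)
  have loc: "AE x in lborel. x \<in> box a b \<longrightarrow> G x = 0" if ab: "cbox a b \<subseteq> \<Omega>" for a b
  proof (cases "box a b = {}")
    case False
    define h where "h x = G x * indicator (box a b) x" for x
    have "integrable lborel (\<lambda>x. (indicator \<Omega> x *\<^sub>R (g x * indicator (cbox a b) x)) * indicator (box a b) x)"
      using gi[OF ab] by (intro integrable_real_mult_indicator) (auto simp: integrable_restrict_space)
    moreover have "(\<lambda>x. (indicator \<Omega> x *\<^sub>R (g x * indicator (cbox a b) x)) * indicator (box a b) x) = h"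
      using box_subset_cbox[of a b] by (auto simp: h_def G_def indicator_def fun_eq_iff)
    ultimately have hi: "integrable lborel h" by simp
    have "(\<integral>x\<in>A. h x \<partial>lborel) = 0" if "A \<in> sets borel" for A
    proof -
      have "A \<in> sigma_sets UNIV (range (\<lambda>(a, b). box a b :: (real^2) set))"
        using that unfolding borel_eq_box by simp
      then show ?thesis
      proof (rule sigma_sets_induct_disjoint[rotated 2])
        show "Int_stable (range (\<lambda>(a, b). box a b :: (real^2) set))"
        proof (rule Int_stableI)
          fix A B assume "A \<in> range (\<lambda>(a, b). box a b :: (real^2) set)" "B \<in> range (\<lambda>(a, b). box a b :: (real^2) set)"
          then obtain a b c d where "A = box a b" "B = box c d" by auto
          moreover obtain e f where "box a b \<inter> box c d = box e f" using box_Int_box by blast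
          ultimately show "A \<inter> B \<in> range (\<lambda>(a, b). box a b)" by (auto intro: image_eqI[of _ _ "(e, f)"])
        qed
      next
        fix A assume "A \<in> range (\<lambda>(a, b). box a b :: (real^2) set)"
        then obtain c d where A: "A = box c d" by auto
        obtain e f where ef: "box c d \<inter> box a b = box e f" using box_Int_box by blast
        have "(\<integral>x\<in>A. h x \<partial>lborel) = (\<integral>x. G x * indicator (box e f) x \<partial>lborel)"
          unfolding set_lebesgue_integral_def A h_def ef[symmetric]
          by (intro Bochner_Integration.integral_cong) (auto simp: indicator_def)
        also have "\<dots> = 0"
        \<comment> \<open>An empty open box may belong to a degenerate closed box outside \<Omega>;
          the inclusion of \<open>cbox e f\<close> in \<open>cbox a b\<close> is available when the
          open box is nonempty.\<close>
        proof (cases "box e f = {}")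
          case False
          have "closure (box e f) \<subseteq> closure (box a b)" using ef by (intro closure_mono) auto
          then have "cbox e f \<subseteq> \<Omega>" using ab False closure_box[OF False] closure_box[OF \<open>box a b \<noteq> {}\<close>] by auto
          then show ?thesis by (rule Gbox)
        qed simp
        finally show "(\<integral>x\<in>A. h x \<partial>lborel) = 0" .
      next
        fix A assume A: "A \<in> sigma_sets UNIV (range (\<lambda>(a, b). box a b :: (real^2) set))" "(\<integral>x\<in>A. h x \<partial>lborel) = 0"
        then have Ab: "A \<in> sets borel" unfolding borel_eq_box by simp
        have "(\<integral>x\<in>UNIV - A. h x \<partial>lborel) = (\<integral>x. h x - indicator A x *\<^sub>R h x \<partial>lborel)"
          unfolding set_lebesgue_integral_def
          by (intro Bochner_Integration.integral_cong) (auto simp: indicator_def)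
        also have "\<dots> = (\<integral>x. h x \<partial>lborel) - (\<integral>x\<in>A. h x \<partial>lborel)"
          unfolding set_lebesgue_integral_def using hi Ab
          by (intro Bochner_Integration.integral_diff integrable_mult_indicator) auto
        finally show "(\<integral>x\<in>UNIV - A. h x \<partial>lborel) = 0" using A Gbox[OF ab] by (simp add: h_def)
      next
        fix A :: "nat \<Rightarrow> (real^2) set"
        assume A: "disjoint_family A" "range A \<subseteq> sigma_sets UNIV (range (\<lambda>(a, b). box a b))"
          "\<And>i. (\<integral>x\<in>A i. h x \<partial>lborel) = 0"
        then have Ab: "A i \<in> sets lborel" for i unfolding sets_lborel borel_eq_box by auto
        have "(\<integral>x\<in>(\<Union>i. A i). h x \<partial>lborel) = (\<Sum>i. \<integral>x\<in>A i. h x \<partial>lborel)"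
        proof (rule lebesgue_integral_countable_add[OF Ab])
          show "A i \<inter> A j = {}" if "i \<noteq> j" for i j using A(1) that by (auto simp: disjoint_family_on_def)
          have "(\<Union>i. A i) \<in> sets lborel" using Ab by blast
          then show "set_integrable lborel (\<Union>i. A i) h"
            unfolding set_integrable_def by (rule integrable_mult_indicator[OF _ hi])
        qed
        then show "(\<integral>x\<in>(\<Union>i. A i). h x \<partial>lborel) = 0" using A(3) by simp
      qed (auto simp: set_lebesgue_integral_def)
    qed
    then have "AE x in lborel. h x = 0"
      by (intro density_unique_real[where f'="\<lambda>x. 0", OF hi]) auto
    then show ?thesis by eventually_elim (auto simp: h_def)
  qed simp
  \<comment> \<open>By the Lindelof property countably many of these boxes cover \<Omega>, so the
    exceptional null sets can be united.\<close>
  define \<F> where "\<F> = {box a b | a b. cbox a b \<subseteq> \<Omega>}"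
  obtain \<F>' where F': "\<F>' \<subseteq> \<F>" "countable \<F>'" "\<Union>\<F>' = \<Union>\<F>"
    using Lindelof_openin[of \<F> UNIV] by (auto simp: \<F>_def)
  have cover: "\<Omega> \<subseteq> \<Union>\<F>'"
  proof
    fix x assume "x \<in> \<Omega>"
    then obtain a b where "x \<in> box a b" "cbox a b \<subseteq> \<Omega>"
      using open_contains_cbox[of \<Omega>] open_dom by metis
    then show "x \<in> \<Union>\<F>'" unfolding F' by (auto simp: \<F>_def)
  qed
  have "AE x in lborel. \<forall>Q\<in>\<F>'. x \<in> Q \<longrightarrow> G x = 0"
    using F' loc by (subst AE_ball_countable) (auto simp: \<F>_def)
  then have "AE x in lborel. x \<in> \<Omega> \<longrightarrow> g x = 0"
    by eventually_elim (use cover in \<open>auto simp: G_def\<close>)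
  then show ?thesis by (simp add: AE_restrict_space_iff)
qed

lemma fundamental_lemma:
  fixes g :: "real^2 \<Rightarrow> real"
  assumes g: "integrable vol g" and z: "\<And>\<phi>. \<phi> \<in> test_functions \<Omega> \<Longrightarrow> (\<integral>x. g x * \<phi> x \<partial>vol) = 0"
  shows "AE x in vol. g x = 0"
proof (rule fundamental_lemma_local[OF _ _ z])
  fix a b assume "cbox a b \<subseteq> \<Omega>"
  then have "cbox a b \<in> sets vol" by (auto simp: sets_restrict_space_iff)
  then show "integrable vol (\<lambda>x. g x * indicator (cbox a b) x)" using g by (rule integrable_real_mult_indicator)
qed (use g in auto)

lemma AE_vol_iff: "(AE x in vol. P x) \<longleftrightarrow> (AE x in lborel. x \<in> \<Omega> \<longrightarrow> P x)"
  by (simp add: AE_restrict_space_iff)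

lemma vol_integral_eq:
  fixes f :: "real^2 \<Rightarrow> real"
  assumes "\<And>x. x \<notin> \<Omega> \<Longrightarrow> f x = 0"
  shows "(\<integral>x. f x \<partial>vol) = (\<integral>x. f x \<partial>lborel)"
proof -
  have "(\<lambda>x. indicator \<Omega> x *\<^sub>R f x) = f" using assms by (auto simp: indicator_def fun_eq_iff)
  then show ?thesis by (simp add: integral_restrict_space)
qed

lemma continuous_l2:
  fixes f :: "real^2 \<Rightarrow> 'b::euclidean_space"
  assumes "continuous_on UNIV f"
  shows "f \<in> l2 vol" "\<exists>L>0. \<forall>x\<in>\<Omega>. norm (f x) \<le> L"
proof -
  have "bounded (f ` closure \<Omega>)"
    using assms bounded_dom
    by (intro compact_imp_bounded compact_continuous_image) (auto intro: continuous_on_subset)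
  then obtain L where L: "L > 0" "\<forall>y\<in>f ` closure \<Omega>. norm y \<le> L" using bounded_pos by blast
  then have *: "\<forall>x\<in>\<Omega>. norm (f x) \<le> L" using closure_subset by blast
  show "f \<in> l2 vol"
    by (rule vol.l2_bounded[of _ L])
       (use * in \<open>auto intro!: continuous_on_vol intro: continuous_on_subset[OF assms]\<close>)
  show "\<exists>L>0. \<forall>x\<in>\<Omega>. norm (f x) \<le> L" using * L by blast
qed

lemma smooth_l2: "smooth f \<Longrightarrow> f \<in> l2 vol" "smooth f \<Longrightarrow> classical_grad f \<in> l2 vol"
  by (auto intro: continuous_l2 smooth_continuous_on smooth_classical_grad_continuous)

lemma l2_nth:
  fixes g :: "real^2 \<Rightarrow> real^2"
  assumes "g \<in> l2 vol" shows "(\<lambda>x. g x $ i) \<in> l2 vol"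
proof (rule l2_dominated(1)[OF assms])
  have "(\<lambda>x. x $ i) \<in> borel_measurable borel"
    by (intro borel_measurable_continuous_onI continuous_intros)
  then show "(\<lambda>x. g x $ i) \<in> borel_measurable vol"
    using measurable_compose[OF l2_measurable[OF assms]] by blast
  show "AE x in vol. norm (g x $ i) \<le> norm (g x)"
    using component_le_norm_cart[of "g _" i] by simp
qed

lemma l2_scaleR_bounded:
  fixes g :: "real^2 \<Rightarrow> 'b::euclidean_space"
  assumes g: "g \<in> l2 vol" and f: "f \<in> borel_measurable vol" "AE x in vol. \<bar>f x\<bar> \<le> L"
  shows "(\<lambda>x. f x *\<^sub>R g x) \<in> l2 vol" "l2norm vol (\<lambda>x. f x *\<^sub>R g x) \<le> \<bar>L\<bar> * l2norm vol g"
proof -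
  note [measurable] = g f(1)
  have ae: "AE x in vol. norm (f x *\<^sub>R g x) \<le> norm (L *\<^sub>R g x)"
    using f(2)
  proof eventually_elim
    case (elim x)
    then have "\<bar>f x\<bar> \<le> \<bar>L\<bar>" by simp
    then show ?case by (simp add: mult_right_mono)
  qed
  have m: "(\<lambda>x. f x *\<^sub>R g x) \<in> borel_measurable vol" by measurable
  from l2_dominated[OF l2_scaleR(1)[OF g] m ae]
  show "(\<lambda>x. f x *\<^sub>R g x) \<in> l2 vol" "l2norm vol (\<lambda>x. f x *\<^sub>R g x) \<le> \<bar>L\<bar> * l2norm vol g"
    by (auto simp: l2_scaleR(2)[OF g])
qed

lemma l2_smooth_scaleR:
  assumes "smooth f" "g \<in> l2 vol"
  shows "(\<lambda>x. f x *\<^sub>R g x) \<in> l2 vol"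
proof -
  obtain L where L: "\<forall>x\<in>\<Omega>. norm (f x) \<le> L"
    using continuous_l2(2)[OF smooth_continuous_on[OF assms(1)]] by blast
  show ?thesis
    by (rule l2_scaleR_bounded(1)[OF assms(2), of f L]) (use smooth_l2(1)[OF assms(1)] L in auto)
qed

section \<open>Calculus of \<open>H1\<close> functions\<close>

lemma weak_gradient_unique:
  assumes "g \<in> l2 vol" "g' \<in> l2 vol" "has_weak_gradient \<Omega> u g" "has_weak_gradient \<Omega> u g'"
  shows "AE x in vol. g x = g' x"
proof -
  have "AE x in vol. g x $ i - g' x $ i = 0" for i
  proof (rule fundamental_lemma)
    show "integrable vol (\<lambda>x. g x $ i - g' x $ i)"
      by (intro vol.l2_integrable l2_diff l2_nth assms)
    fix \<phi> assume t: "\<phi> \<in> test_functions \<Omega>"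
    then have p: "\<phi> \<in> l2 vol" using smooth_l2 test_functions_smooth by blast
    have "(\<integral>x. (g x $ i - g' x $ i) * \<phi> x \<partial>vol) = (\<integral>x. g x $ i * \<phi> x \<partial>vol) - (\<integral>x. g' x $ i * \<phi> x \<partial>vol)"
      using l2_mult_integrable[OF l2_nth[OF assms(1)] p] l2_mult_integrable[OF l2_nth[OF assms(2)] p]
      by (simp add: left_diff_distrib)
    also have "\<dots> = 0"
    proof -
      have "- (\<integral>x. g x $ i * \<phi> x \<partial>vol) = - (\<integral>x. g' x $ i * \<phi> x \<partial>vol)"
        using assms(3)[unfolded has_weak_gradient_iff, rule_format, OF t, of i]
          assms(4)[unfolded has_weak_gradient_iff, rule_format, OF t, of i] by (rule trans[OF sym])
      then show ?thesis by simp
    qed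
    finally show "(\<integral>x. (g x $ i - g' x $ i) * \<phi> x \<partial>vol) = 0" .
  qed
  from this[of 1] this[of 2] show ?thesis
    by eventually_elim (simp add: vec_eq_iff forall_2)
qed

text \<open>\<open>grad\<close> is a choice among representatives, so it agrees with a known weak
  gradient only almost everywhere. This is why later identities for integrals pass through
  congruence almost everywhere.\<close>

lemma H1I:
  assumes "u \<in> l2 vol" "g \<in> l2 vol" "has_weak_gradient \<Omega> u g"
  shows "u \<in> H1 \<Omega>" "AE x in vol. grad \<Omega> u x = g x"
proof -
  show "u \<in> H1 \<Omega>" using assms by (auto simp: H1_def L2_eq)
  have "\<exists>g. g \<in> L2 \<Omega> \<and> has_weak_gradient \<Omega> u g" using assms by (auto simp: L2_eq)
  from someI_ex[OF this, folded grad_def] show "AE x in vol. grad \<Omega> u x = g x"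
    using assms by (intro weak_gradient_unique) (auto simp: L2_eq)
qed

lemma H1D:
  assumes "u \<in> H1 \<Omega>"
  shows "u \<in> l2 vol" "grad \<Omega> u \<in> l2 vol" "has_weak_gradient \<Omega> u (grad \<Omega> u)"
proof -
  have "\<exists>g. g \<in> L2 \<Omega> \<and> has_weak_gradient \<Omega> u g" using assms by (auto simp: H1_def)
  from someI_ex[OF this, folded grad_def]
  show "grad \<Omega> u \<in> l2 vol" "has_weak_gradient \<Omega> u (grad \<Omega> u)" by (auto simp: L2_eq)
  show "u \<in> l2 vol" using assms by (simp add: H1_def L2_eq)
qed

lemma integral_test_lincomb:
  fixes u v w :: "real^2 \<Rightarrow> real"
  assumes "u \<in> l2 vol" "v \<in> l2 vol" "w \<in> l2 vol"
  shows "(\<integral>x. (u x + c * v x) * w x \<partial>vol) = (\<integral>x. u x * w x \<partial>vol) + c * (\<integral>x. v x * w x \<partial>vol)"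
  using l2_mult_integrable[OF assms(1,3)] l2_mult_integrable[OF assms(2,3)]
  by (simp add: distrib_right mult.assoc)

lemma smooth_partial_l2: "smooth \<phi> \<Longrightarrow> partial_deriv i \<phi> \<in> l2 vol"
  by (intro smooth_l2 smooth_partial_deriv)

lemma H1_lincomb:
  assumes u: "u \<in> H1 \<Omega>" and v: "v \<in> H1 \<Omega>"
  shows "(\<lambda>x. u x + c * v x) \<in> H1 \<Omega>"
    "AE x in vol. grad \<Omega> (\<lambda>x. u x + c * v x) x = grad \<Omega> u x + c *\<^sub>R grad \<Omega> v x"
proof -
  note U = H1D[OF u] and V = H1D[OF v]
  have "has_weak_gradient \<Omega> (\<lambda>x. u x + c * v x) (\<lambda>x. grad \<Omega> u x + c *\<^sub>R grad \<Omega> v x)"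
    unfolding has_weak_gradient_iff
  proof (intro ballI allI)
    fix \<phi> i assume t: "\<phi> \<in> test_functions \<Omega>"
    then have s: "smooth \<phi>" by (rule test_functions_smooth)
    show "(\<integral>x. (u x + c * v x) * partial_deriv i \<phi> x \<partial>vol) = - (\<integral>x. (grad \<Omega> u x + c *\<^sub>R grad \<Omega> v x) $ i * \<phi> x \<partial>vol)"
      using U(3) V(3) t integral_test_lincomb[OF U(1) V(1) smooth_partial_l2[OF s], of c i]
        integral_test_lincomb[OF l2_nth[OF U(2)] l2_nth[OF V(2)] smooth_l2(1)[OF s], of i c i]
      by (simp add: has_weak_gradient_iff)
  qed
  moreover have "(\<lambda>x. u x + c * v x) \<in> l2 vol" by (intro l2_add l2_mult U V)
  moreover have "(\<lambda>x. grad \<Omega> u x + c *\<^sub>R grad \<Omega> v x) \<in> l2 vol" by (intro l2_add l2_scaleR U V)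
  ultimately show "(\<lambda>x. u x + c * v x) \<in> H1 \<Omega>"
    "AE x in vol. grad \<Omega> (\<lambda>x. u x + c * v x) x = grad \<Omega> u x + c *\<^sub>R grad \<Omega> v x"
    using H1I by blast+
qed

text \<open>The plane is the union of the open sets \<Omega> and \<open>- K\<close>, and the
  function is continuous on each of them.\<close>

lemma continuous_on_extend_by_0:
  fixes f :: "real^2 \<Rightarrow> 'b::real_normed_vector"
  assumes "continuous_on \<Omega> f" "compact K" "K \<subseteq> \<Omega>" "\<And>x. x \<notin> K \<Longrightarrow> f x = 0"
  shows "continuous_on UNIV f"
proof -
  have o: "open (- K)" using assms(2) by (simp add: compact_imp_closed open_Compl)
  have "continuous_on (- K) f"
    using assms(4) by (subst continuous_on_cong[of _ "- K" f "\<lambda>x. 0"]) auto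
  then have "continuous_on (\<Omega> \<union> - K) f"
    using assms(1) open_dom o by (intro continuous_on_open_Un)
  moreover have "\<Omega> \<union> - K = UNIV" using assms(3) by auto
  ultimately show ?thesis by simp
qed

text \<open>Multiplied by a test function and extended by 0, \<open>p\<close> becomes continuously
  differentiable in the whole plane, whatever its behaviour near the boundary; the integral of the
  partial derivatives of such a product vanishes.\<close>

lemma weak_gradient_C1:
  assumes D: "\<And>x. x \<in> \<Omega> \<Longrightarrow> (p has_derivative (\<lambda>h. g x \<bullet> h)) (at x)" and g: "continuous_on \<Omega> g"
  shows "has_weak_gradient \<Omega> p g"
  unfolding has_weak_gradient_iff
proof (intro ballI allI)
  fix \<phi> and i :: 2 assume t: "\<phi> \<in> test_functions \<Omega>"
  from t obtain K where K: "smooth \<phi>" "compact K" "K \<subseteq> \<Omega>" "\<And>x. x \<notin> K \<Longrightarrow> \<phi> x = 0"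
    "\<And>x. x \<notin> K \<Longrightarrow> classical_grad \<phi> x = 0"
    by (rule test_functionsE) blast
  have pK: "partial_deriv i \<phi> x = 0" if "x \<notin> K" for x
    using K(5)[OF that] classical_grad_nth by (metis zero_index)
  have pc: "continuous_on \<Omega> p"
    by (intro continuous_at_imp_continuous_on ballI) (metis D has_derivative_continuous)
  define q where "q x = p x * \<phi> x" for x
  have qD: "(q has_derivative (\<lambda>h. (p x *\<^sub>R classical_grad \<phi> x + \<phi> x *\<^sub>R g x) \<bullet> h)) (at x)" for x
  proof (cases "x \<in> \<Omega>")
    case True
    show ?thesis
      using has_derivative_mult[OF D[OF True] has_derivative_classical_grad[OF smooth_differentiable[OF K(1)]]]
      by (simp add: q_def[abs_def] inner_add_left mult.commute)
  next
    case False
    \<comment> \<open>Off \<Omega> the values of \<open>p\<close> are arbitrary, but the product is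
      0 on a neighbourhood of \<open>x\<close>.\<close>
    then have x: "x \<in> - K" using K(3) by auto
    have "(q has_derivative (\<lambda>h. 0)) (at x)"
      by (rule has_derivative_transform_within_open[where f="\<lambda>x. 0" and s="- K"])
         (use x K in \<open>auto simp: q_def compact_imp_closed\<close>)
    then show ?thesis using x K(4,5) by simp
  qed
  have qp: "partial_deriv i q x = p x * partial_deriv i \<phi> x + g x $ i * \<phi> x" for x
    using partial_deriv_eq[OF qD, of i x] by (simp add: inner_axis)
  have c1: "continuous_on UNIV (\<lambda>x. p x * partial_deriv i \<phi> x)"
    by (rule continuous_on_extend_by_0[OF _ K(2,3)])
       (use pK in \<open>auto intro!: continuous_on_mult pc smooth_continuous_on[OF smooth_partial_deriv] K\<close>)
  have c2: "continuous_on UNIV (\<lambda>x. g x $ i * \<phi> x)"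
    by (rule continuous_on_extend_by_0[OF _ K(2,3)])
       (use K(4) in \<open>auto intro!: continuous_on_mult continuous_on_component g smooth_continuous_on[OF K(1)]\<close>)
  have i1: "integrable lborel (\<lambda>x. p x * partial_deriv i \<phi> x)"
    by (rule integrable_continuous_compact_support[OF c1 K(2)]) (use pK in auto)
  have i2: "integrable lborel (\<lambda>x. g x $ i * \<phi> x)"
    by (rule integrable_continuous_compact_support[OF c2 K(2)]) (use K(4) in auto)
  have "(\<integral>x. partial_deriv i q x \<partial>lborel) = 0"
  proof (rule integral_partial_deriv_eq_0[OF _ _ K(2)])
    show "q differentiable at x" for x using qD differentiable_def by blast
    show "continuous_on UNIV (partial_deriv i q)"
      unfolding qp[abs_def] by (intro continuous_on_add c1 c2)
    show "q x = 0" if "x \<notin> K" for x using K(4)[OF that] by (simp add: q_def)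
  qed
  then have "(\<integral>x. p x * partial_deriv i \<phi> x \<partial>lborel) + (\<integral>x. g x $ i * \<phi> x \<partial>lborel) = 0"
    unfolding qp using i1 i2 by simp
  moreover have "(\<integral>x. p x * partial_deriv i \<phi> x \<partial>vol) = (\<integral>x. p x * partial_deriv i \<phi> x \<partial>lborel)"
    using pK K(3) by (intro vol_integral_eq) auto
  moreover have "(\<integral>x. g x $ i * \<phi> x \<partial>vol) = (\<integral>x. g x $ i * \<phi> x \<partial>lborel)"
    using K(3,4) by (intro vol_integral_eq) auto
  ultimately show "(\<integral>x. p x * partial_deriv i \<phi> x \<partial>vol) = - (\<integral>x. g x $ i * \<phi> x \<partial>vol)" by simp
qed

lemma smooth_H1:
  assumes "smooth \<phi>"
  shows "\<phi> \<in> H1 \<Omega>" "AE x in vol. grad \<Omega> \<phi> x = classical_grad \<phi> x"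
proof -
  have "has_weak_gradient \<Omega> \<phi> (classical_grad \<phi>)"
    by (intro weak_gradient_C1 has_derivative_classical_grad smooth_differentiable
        smooth_classical_grad_continuous assms)
  from H1I[OF smooth_l2(1)[OF assms] smooth_l2(2)[OF assms] this]
  show "\<phi> \<in> H1 \<Omega>" "AE x in vol. grad \<Omega> \<phi> x = classical_grad \<phi> x" .
qed

lemma l2_mult_smooth_grad:
  assumes "\<theta> \<in> l2 vol" "smooth X"
  shows "(\<lambda>x. \<theta> x *\<^sub>R classical_grad X x) \<in> l2 vol"
proof -
  obtain L where L: "\<forall>x\<in>\<Omega>. norm (classical_grad X x) \<le> L"
    using continuous_l2(2)[OF smooth_classical_grad_continuous[OF assms(2)]] by blast
  show ?thesis
  proof (rule l2_dominated(1)[OF l2_scaleR(1)[OF assms(1), of L]])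
    show "(\<lambda>x. \<theta> x *\<^sub>R classical_grad X x) \<in> borel_measurable vol"
      by (intro borel_measurable_scaleR l2_measurable smooth_l2 assms)
    show "AE x in vol. norm (\<theta> x *\<^sub>R classical_grad X x) \<le> norm (L *\<^sub>R \<theta> x)"
    proof (rule AE_I2)
      fix x assume "x \<in> space vol"
      then have "norm (classical_grad X x) \<le> \<bar>L\<bar>" using L by fastforce
      then show "norm (\<theta> x *\<^sub>R classical_grad X x) \<le> norm (L *\<^sub>R \<theta> x)"
        using mult_left_mono[of "norm (classical_grad X x)" "\<bar>L\<bar>" "\<bar>\<theta> x\<bar>"]
        by (simp add: abs_mult mult.commute)
    qed
  qed
qed

text \<open>The factor \<phi> is moved to the test function: the weak gradient of \<theta> is tested
  with \<open>\<eta> x * \<phi> x\<close>, which has compact support in \<Omega> although \<phi>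
  need not.\<close>

lemma smooth_mult_H1:
  assumes \<phi>: "smooth \<phi>" and \<theta>: "\<theta> \<in> H1 \<Omega>"
  shows "(\<lambda>x. \<phi> x * \<theta> x) \<in> H1 \<Omega>"
    "AE x in vol. grad \<Omega> (\<lambda>x. \<phi> x * \<theta> x) x = \<phi> x *\<^sub>R grad \<Omega> \<theta> x + \<theta> x *\<^sub>R classical_grad \<phi> x"
proof -
  note T = H1D[OF \<theta>]
  have l: "(\<lambda>x. \<phi> x * \<theta> x) \<in> l2 vol" using l2_smooth_scaleR[OF \<phi> T(1)] by simp
  have l': "(\<lambda>x. \<phi> x *\<^sub>R grad \<Omega> \<theta> x + \<theta> x *\<^sub>R classical_grad \<phi> x) \<in> l2 vol"
    by (rule l2_add[OF l2_smooth_scaleR[OF \<phi> T(2)] l2_mult_smooth_grad[OF T(1) \<phi>]])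
  have "has_weak_gradient \<Omega> (\<lambda>x. \<phi> x * \<theta> x) (\<lambda>x. \<phi> x *\<^sub>R grad \<Omega> \<theta> x + \<theta> x *\<^sub>R classical_grad \<phi> x)"
    unfolding has_weak_gradient_iff
  proof (intro ballI allI)
    fix \<eta> and i :: 2 assume t: "\<eta> \<in> test_functions \<Omega>"
    then have s: "smooth \<eta>" by (rule test_functions_smooth)
    have t': "(\<lambda>x. \<eta> x * \<phi> x) \<in> test_functions \<Omega>" by (rule test_functions_mult[OF t \<phi>])
    have pd: "partial_deriv i (\<lambda>x. \<eta> x * \<phi> x) x = \<eta> x * partial_deriv i \<phi> x + \<phi> x * partial_deriv i \<eta> x" for x
      using classical_grad_mult[OF smooth_differentiable[OF s] smooth_differentiable[OF \<phi>], of x]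
      by (simp add: vec_eq_iff)
    have i1: "integrable vol (\<lambda>x. \<theta> x * (\<phi> x * partial_deriv i \<eta> x))"
      by (intro l2_mult_integrable T smooth_l2 smooth_mult smooth_partial_deriv s \<phi>)
    have i2: "integrable vol (\<lambda>x. \<theta> x * (\<eta> x * partial_deriv i \<phi> x))"
      by (intro l2_mult_integrable T smooth_l2 smooth_mult smooth_partial_deriv s \<phi>)
    have i3: "integrable vol (\<lambda>x. grad \<Omega> \<theta> x $ i * (\<eta> x * \<phi> x))"
      by (intro l2_mult_integrable l2_nth T smooth_l2 smooth_mult s \<phi>)
    have "(\<integral>x. \<theta> x * (\<eta> x * partial_deriv i \<phi> x + \<phi> x * partial_deriv i \<eta> x) \<partial>vol)
        = - (\<integral>x. grad \<Omega> \<theta> x $ i * (\<eta> x * \<phi> x) \<partial>vol)"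
      using T(3) t' unfolding has_weak_gradient_iff by (metis (no_types, lifting) Bochner_Integration.integral_cong pd)
    then have "(\<integral>x. \<theta> x * (\<phi> x * partial_deriv i \<eta> x) \<partial>vol)
        = - ((\<integral>x. grad \<Omega> \<theta> x $ i * (\<eta> x * \<phi> x) \<partial>vol) + (\<integral>x. \<theta> x * (\<eta> x * partial_deriv i \<phi> x) \<partial>vol))"
      using i1 i2 by (simp add: distrib_left)
    also have "\<dots> = - (\<integral>x. grad \<Omega> \<theta> x $ i * (\<eta> x * \<phi> x) + \<theta> x * (\<eta> x * partial_deriv i \<phi> x) \<partial>vol)"
      using i2 i3 by simp
    finally show "(\<integral>x. \<phi> x * \<theta> x * partial_deriv i \<eta> x \<partial>vol)
        = - (\<integral>x. (\<phi> x *\<^sub>R grad \<Omega> \<theta> x + \<theta> x *\<^sub>R classical_grad \<phi> x) $ i * \<eta> x \<partial>vol)"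
      by (simp add: algebra_simps)
  qed
  from H1I[OF l l' this] show "(\<lambda>x. \<phi> x * \<theta> x) \<in> H1 \<Omega>"
    "AE x in vol. grad \<Omega> (\<lambda>x. \<phi> x * \<theta> x) x = \<phi> x *\<^sub>R grad \<Omega> \<theta> x + \<theta> x *\<^sub>R classical_grad \<phi> x" .
qed

section \<open>Convergence in \<open>H1\<close> and approximation by test functions\<close>

lemma H1_norm_eq: "H1_norm \<Omega> u = sqrt ((l2norm vol u)\<^sup>2 + (l2norm vol (grad \<Omega> u))\<^sup>2)"
  by (simp add: H1_norm_def L2_norm_eq)

lemma H1_norm_bounds:
  "l2norm vol u \<le> H1_norm \<Omega> u" "l2norm vol (grad \<Omega> u) \<le> H1_norm \<Omega> u"
  "H1_norm \<Omega> u \<le> l2norm vol u + l2norm vol (grad \<Omega> u)" "0 \<le> H1_norm \<Omega> u"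
  unfolding H1_norm_eq by (auto intro!: real_le_rsqrt sqrt_sum_squares_le_sum)

lemma H1_norm_tendsto_0_iff:
  "(\<lambda>n. H1_norm \<Omega> (F n)) \<longlonglongrightarrow> 0 \<longleftrightarrow> (\<lambda>n. l2norm vol (F n)) \<longlonglongrightarrow> 0 \<and> (\<lambda>n. l2norm vol (grad \<Omega> (F n))) \<longlonglongrightarrow> 0"
proof (intro iffI conjI)
  assume h: "(\<lambda>n. H1_norm \<Omega> (F n)) \<longlonglongrightarrow> 0"
  show "(\<lambda>n. l2norm vol (F n)) \<longlonglongrightarrow> 0"
    by (rule Lim_null_comparison[OF _ h]) (simp add: H1_norm_bounds)
  show "(\<lambda>n. l2norm vol (grad \<Omega> (F n))) \<longlonglongrightarrow> 0"
    by (rule Lim_null_comparison[OF _ h]) (simp add: H1_norm_bounds)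
next
  assume h: "(\<lambda>n. l2norm vol (F n)) \<longlonglongrightarrow> 0 \<and> (\<lambda>n. l2norm vol (grad \<Omega> (F n))) \<longlonglongrightarrow> 0"
  have "(\<lambda>n. l2norm vol (F n) + l2norm vol (grad \<Omega> (F n))) \<longlonglongrightarrow> 0"
    using h tendsto_add_zero by blast
  then show "(\<lambda>n. H1_norm \<Omega> (F n)) \<longlonglongrightarrow> 0"
    by (rule Lim_null_comparison[rotated]) (simp add: H1_norm_bounds)
qed

lemma l2norm_grad_smooth:
  assumes "smooth \<phi>"
  shows "l2norm vol (grad \<Omega> \<phi>) = l2norm vol (classical_grad \<phi>)"
  using assms smooth_H1 H1D smooth_l2 by (intro l2norm_cong_AE) (auto intro: l2_measurable)

lemma l2norm_grad_diff:
  assumes "\<phi> \<in> H1 \<Omega>" "u \<in> H1 \<Omega>"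
  shows "l2norm vol (grad \<Omega> (\<lambda>x. \<phi> x - u x)) = l2norm vol (\<lambda>x. grad \<Omega> \<phi> x - grad \<Omega> u x)"
proof -
  note H = H1_lincomb[OF assms, of "-1", simplified]
  show ?thesis
    by (rule l2norm_cong_AE[OF H(2)]) (intro l2_measurable l2_diff H1D assms H)+
qed

lemma l2norm_grad_diff_smooth:
  assumes "smooth \<phi>" "u \<in> H1 \<Omega>"
  shows "l2norm vol (grad \<Omega> (\<lambda>x. \<phi> x - u x)) = l2norm vol (\<lambda>x. classical_grad \<phi> x - grad \<Omega> u x)"
  unfolding l2norm_grad_diff[OF smooth_H1(1)[OF assms(1)] assms(2)]
proof (rule l2norm_cong_AE)
  show "AE x in vol. grad \<Omega> \<phi> x - grad \<Omega> u x = classical_grad \<phi> x - grad \<Omega> u x"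
    using smooth_H1(2)[OF assms(1)] by eventually_elim simp
qed (intro l2_measurable l2_diff H1D assms smooth_H1 smooth_l2)+

lemma H10_H1: "u \<in> H10 \<Omega> \<Longrightarrow> u \<in> H1 \<Omega>"
  by (simp add: H10_def)

text \<open>\<open>H1_norm\<close> of a difference involves a separate choice of gradient for every
  \<open>n\<close>. This form uses classical gradients and the single representative
  \<open>grad \<Omega> u\<close> instead.\<close>

lemma H10_iff:
  "u \<in> H10 \<Omega> \<longleftrightarrow> u \<in> H1 \<Omega> \<and> (\<exists>\<phi>. (\<forall>n::nat. \<phi> n \<in> test_functions \<Omega>) \<and>
     (\<lambda>n. l2norm vol (\<lambda>x. \<phi> n x - u x)) \<longlonglongrightarrow> 0 \<and>
     (\<lambda>n. l2norm vol (\<lambda>x. classical_grad (\<phi> n) x - grad \<Omega> u x)) \<longlonglongrightarrow> 0)"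
proof (cases "u \<in> H1 \<Omega>")
  case True
  have "(\<lambda>n. H1_norm \<Omega> (\<lambda>x. \<phi> n x - u x)) \<longlonglongrightarrow> 0 \<longleftrightarrow> (\<lambda>n. l2norm vol (\<lambda>x. \<phi> n x - u x)) \<longlonglongrightarrow> 0 \<and>
     (\<lambda>n. l2norm vol (\<lambda>x. classical_grad (\<phi> n) x - grad \<Omega> u x)) \<longlonglongrightarrow> 0"
    if "\<forall>n::nat. \<phi> n \<in> test_functions \<Omega>" for \<phi>
    using l2norm_grad_diff_smooth[OF test_functions_smooth[OF that[rule_format]] True]
    by (simp add: H1_norm_tendsto_0_iff)
  then show ?thesis using True unfolding H10_def by blast
qed (simp add: H10_def)

lemma test_H10: "\<phi> \<in> test_functions \<Omega> \<Longrightarrow> \<phi> \<in> H10 \<Omega>"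
proof -
  assume t: "\<phi> \<in> test_functions \<Omega>"
  note s = test_functions_smooth[OF t]
  have "l2norm vol (\<lambda>x. classical_grad \<phi> x - grad \<Omega> \<phi> x) = l2norm vol (\<lambda>x. 0::real^2)"
  proof (rule l2norm_cong_AE)
    show "AE x in vol. classical_grad \<phi> x - grad \<Omega> \<phi> x = 0"
      using smooth_H1(2)[OF s] by eventually_elim simp
  qed (intro l2_measurable l2_diff H1D smooth_H1 s smooth_l2 l2_zero)+
  then show ?thesis
    unfolding H10_iff using smooth_H1(1)[OF s] t by (auto intro!: exI[of _ "\<lambda>_. \<phi>"])
qed

text \<open>A subsequence adds convergence almost everywhere, which the truncation argument uses for
  composite functions such as \<open>cos (\<phi> n x / k)\<close>.\<close>

lemma H10_approx:
  assumes "u \<in> H10 \<Omega>"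
  obtains \<phi> :: "nat \<Rightarrow> real^2 \<Rightarrow> real" where "\<And>n. \<phi> n \<in> test_functions \<Omega>"
    "(\<lambda>n. l2norm vol (\<lambda>x. \<phi> n x - u x)) \<longlonglongrightarrow> 0"
    "(\<lambda>n. l2norm vol (\<lambda>x. classical_grad (\<phi> n) x - grad \<Omega> u x)) \<longlonglongrightarrow> 0"
    "AE x in vol. (\<lambda>n. \<phi> n x) \<longlonglongrightarrow> u x"
proof -
  obtain \<phi> where \<phi>: "\<And>n::nat. \<phi> n \<in> test_functions \<Omega>"
    "(\<lambda>n. l2norm vol (\<lambda>x. \<phi> n x - u x)) \<longlonglongrightarrow> 0"
    "(\<lambda>n. l2norm vol (\<lambda>x. classical_grad (\<phi> n) x - grad \<Omega> u x)) \<longlonglongrightarrow> 0"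
    using assms unfolding H10_iff by blast
  obtain r :: "nat \<Rightarrow> nat" where r: "strict_mono r" "AE x in vol. (\<lambda>n. \<phi> (r n) x) \<longlonglongrightarrow> u x"
    using vol.l2norm_tendsto_AE_subseq[OF _ H1D(1)[OF H10_H1[OF assms]] \<phi>(2)]
      smooth_l2(1)[OF test_functions_smooth[OF \<phi>(1)]] by blast
  show thesis
    by (rule that[of "\<lambda>n. \<phi> (r n)"])
       (use \<phi> r LIMSEQ_subseq_LIMSEQ[OF \<phi>(2) r(1)] LIMSEQ_subseq_LIMSEQ[OF \<phi>(3) r(1)] in \<open>auto simp: comp_def\<close>)
qed

lemma H10_lincomb:
  assumes u: "u \<in> H10 \<Omega>" and v: "v \<in> H10 \<Omega>"
  shows "(\<lambda>x. u x + c * v x) \<in> H10 \<Omega>"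
proof -
  note U = H1D[OF H10_H1[OF u]] and V = H1D[OF H10_H1[OF v]]
  obtain \<phi> where \<phi>: "\<And>n::nat. \<phi> n \<in> test_functions \<Omega>"
    "(\<lambda>n. l2norm vol (\<lambda>x. \<phi> n x - u x)) \<longlonglongrightarrow> 0"
    "(\<lambda>n. l2norm vol (\<lambda>x. classical_grad (\<phi> n) x - grad \<Omega> u x)) \<longlonglongrightarrow> 0"
    using u unfolding H10_iff by blast
  obtain \<eta> where \<eta>: "\<And>n::nat. \<eta> n \<in> test_functions \<Omega>"
    "(\<lambda>n. l2norm vol (\<lambda>x. \<eta> n x - v x)) \<longlonglongrightarrow> 0"
    "(\<lambda>n. l2norm vol (\<lambda>x. classical_grad (\<eta> n) x - grad \<Omega> v x)) \<longlonglongrightarrow> 0"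
    using v unfolding H10_iff by blast
  note s = test_functions_smooth[OF \<phi>(1)] and s' = test_functions_smooth[OF \<eta>(1)]
  define \<zeta> where "\<zeta> n x = \<phi> n x + c * \<eta> n x" for n x
  have \<zeta>: "\<zeta> n \<in> test_functions \<Omega>" for n
    unfolding \<zeta>_def by (intro test_functions_add test_functions_cmult \<phi> \<eta>)
  have cg: "classical_grad (\<zeta> n) x = classical_grad (\<phi> n) x + c *\<^sub>R classical_grad (\<eta> n) x" for n x
    unfolding \<zeta>_def
    using classical_grad_add[OF smooth_differentiable[OF s] smooth_differentiable[OF smooth_mult[OF smooth_const s']]]
    by (simp add: classical_grad_cmult[OF smooth_differentiable[OF s']])
  have 1: "(\<lambda>n. l2norm vol (\<lambda>x. \<zeta> n x - (u x + c * v x))) \<longlonglongrightarrow> 0"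
    using l2norm_tendsto_lincomb[OF _ U(1) _ V(1) \<phi>(2) \<eta>(2), of c] smooth_l2(1)[OF s] smooth_l2(1)[OF s']
    by (simp add: \<zeta>_def)
  note H = H1_lincomb[OF H10_H1[OF u] H10_H1[OF v], of c]
  have "l2norm vol (\<lambda>x. classical_grad (\<zeta> n) x - grad \<Omega> (\<lambda>x. u x + c * v x) x)
      = l2norm vol (\<lambda>x. (classical_grad (\<phi> n) x + c *\<^sub>R classical_grad (\<eta> n) x) - (grad \<Omega> u x + c *\<^sub>R grad \<Omega> v x))" for n
  proof (rule l2norm_cong_AE)
    show "AE x in vol. classical_grad (\<zeta> n) x - grad \<Omega> (\<lambda>x. u x + c * v x) x =
        (classical_grad (\<phi> n) x + c *\<^sub>R classical_grad (\<eta> n) x) - (grad \<Omega> u x + c *\<^sub>R grad \<Omega> v x)"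
      using H(2) by eventually_elim (simp add: cg)
  qed (intro l2_measurable l2_diff l2_add l2_scaleR smooth_l2 test_functions_smooth[OF \<zeta>] H1D H U V s s')+
  then have 2: "(\<lambda>n. l2norm vol (\<lambda>x. classical_grad (\<zeta> n) x - grad \<Omega> (\<lambda>x. u x + c * v x) x)) \<longlonglongrightarrow> 0"
    using l2norm_tendsto_lincomb[OF _ U(2) _ V(2) \<phi>(3) \<eta>(3), of c] smooth_l2(2)[OF s] smooth_l2(2)[OF s'] by simp
  show ?thesis unfolding H10_iff using H(1) \<zeta> 1 2 by blast
qed

lemma test_L_infinity:
  assumes "\<phi> \<in> test_functions \<Omega>" shows "\<phi> \<in> L_infinity \<Omega>"
proof -
  have "set_borel_measurable lborel \<Omega> \<phi>"
    using smooth_l2(1)[OF test_functions_smooth[OF assms]]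
    by (auto simp: set_borel_measurable_def l2_def borel_measurable_restrict_space_iff)
  moreover obtain L where "\<And>x. \<bar>\<phi> x\<bar> \<le> L" using test_functions_bounded(1)[OF assms] by blast
  ultimately show ?thesis by (auto simp: L_infinity_def)
qed

lemma dirichlet_energy_eq: "dirichlet_energy \<Omega> u = (l2norm vol (grad \<Omega> u))\<^sup>2"
  by (simp add: dirichlet_energy_def set_lint_eq l2norm_power2)

section \<open>Divergence-free fields with vanishing normal component\<close>

definition divfree :: "(real^2 \<Rightarrow> real^2) \<Rightarrow> bool" where
  "divfree u \<longleftrightarrow> u \<in> l2 vol \<and> (\<forall>\<phi>\<in>H1 \<Omega>. (\<integral>x. u x \<bullet> grad \<Omega> \<phi> x \<partial>vol) = 0)"

lemma divfree_l2: "divfree u \<Longrightarrow> u \<in> l2 vol"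
  by (simp add: divfree_def)

lemma divfree_smooth:
  assumes "divfree u" "smooth \<phi>"
  shows "(\<integral>x. u x \<bullet> classical_grad \<phi> x \<partial>vol) = 0"
proof -
  have "(\<integral>x. u x \<bullet> classical_grad \<phi> x \<partial>vol) = (\<integral>x. u x \<bullet> grad \<Omega> \<phi> x \<partial>vol)"
  proof (rule integral_cong_AE)
    show "AE x in vol. u x \<bullet> classical_grad \<phi> x = u x \<bullet> grad \<Omega> \<phi> x"
      using smooth_H1(2)[OF assms(2)] by eventually_elim simp
  qed (intro borel_measurable_inner l2_measurable divfree_l2 assms smooth_l2 H1D smooth_H1)+
  also have "\<dots> = 0" using assms smooth_H1(1) by (simp add: divfree_def)
  finally show ?thesis .
qed

lemma integrable_advection_smooth:
  assumes "u \<in> l2 vol" "smooth X" "w \<in> l2 vol"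
  shows "integrable vol (\<lambda>x. X x * (u x \<bullet> w x))"
  using l2_inner[OF assms(1) l2_smooth_scaleR[OF assms(2,3)]] by simp

text \<open>The product of \<open>X\<close> and \<theta> belongs to \<open>H1\<close>, so
  \<open>u\<close> is orthogonal to its gradient, and the product rule splits this orthogonality
  into the two sides. Smoothness of \<open>X\<close> keeps both integrands integrable.\<close>

lemma advection_antisymmetric:
  assumes u: "divfree u" and X: "smooth X" and \<theta>: "\<theta> \<in> H1 \<Omega>"
  shows "(\<integral>x. X x * (u x \<bullet> grad \<Omega> \<theta> x) \<partial>vol) = - (\<integral>x. \<theta> x * (u x \<bullet> classical_grad X x) \<partial>vol)"
proof -
  note T = H1D[OF \<theta>] and H = smooth_mult_H1[OF X \<theta>] and ul = divfree_l2[OF u]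
  have "0 = (\<integral>x. u x \<bullet> grad \<Omega> (\<lambda>x. X x * \<theta> x) x \<partial>vol)"
    using u H(1) by (simp add: divfree_def)
  also have "\<dots> = (\<integral>x. u x \<bullet> (X x *\<^sub>R grad \<Omega> \<theta> x) + u x \<bullet> (\<theta> x *\<^sub>R classical_grad X x) \<partial>vol)"
  proof (rule integral_cong_AE)
    show "AE x in vol. u x \<bullet> grad \<Omega> (\<lambda>x. X x * \<theta> x) x
        = u x \<bullet> (X x *\<^sub>R grad \<Omega> \<theta> x) + u x \<bullet> (\<theta> x *\<^sub>R classical_grad X x)"
      using H(2) by eventually_elim (simp add: inner_add_right)
  qed (intro borel_measurable_add borel_measurable_inner l2_measurable ul H1D H l2_smooth_scaleR X T l2_mult_smooth_grad)+
  also have "\<dots> = (\<integral>x. u x \<bullet> (X x *\<^sub>R grad \<Omega> \<theta> x) \<partial>vol) + (\<integral>x. u x \<bullet> (\<theta> x *\<^sub>R classical_grad X x) \<partial>vol)"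
    by (intro Bochner_Integration.integral_add l2_inner ul l2_smooth_scaleR X T l2_mult_smooth_grad)
  finally show ?thesis by simp
qed

end

section \<open>Skewness of advection\<close>

text \<open>An iterated limit: \<open>k\<close> is fixed first so that \<open>e k\<close> is small,
  and \<open>n\<close> is taken large afterwards.\<close>

lemma tendsto_0_double_bound:
  fixes a :: "nat \<Rightarrow> real"
  assumes "\<And>k n. \<bar>a n\<bar> \<le> b k n" "\<And>k. b k \<longlonglongrightarrow> e k" "e \<longlonglongrightarrow> 0"
  shows "a \<longlonglongrightarrow> 0"
proof (rule LIMSEQ_I)
  fix r :: real assume "r > 0"
  then have "\<forall>\<^sub>F k in sequentially. e k < r" using assms(3) by (rule order_tendstoD(2)[rotated])
  then obtain k where "e k < r" by (auto simp: eventually_sequentially)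
  then have "\<forall>\<^sub>F n in sequentially. b k n < r" using assms(2)[of k] by (rule order_tendstoD(2)[rotated])
  then obtain N where "\<And>n. n \<ge> N \<Longrightarrow> b k n < r" by (auto simp: eventually_sequentially)
  then have "norm (a n - 0) < r" if "n \<ge> N" for n
    using le_less_trans[OF assms(1)[of n k]] that by simp
  then show "\<exists>no. \<forall>n\<ge>no. norm (a n - 0) < r" by blast
qed

lemma abs_sin_diff_le: "\<bar>sin x - sin y\<bar> \<le> \<bar>x - y\<bar>" for x y :: real
  using field_differentiable_bound[of UNIV sin cos 1 x y]
  by (auto intro: DERIV_sin[THEN has_field_derivative_at_within])

lemma sin_scaled_tendsto: "(\<lambda>k. real (Suc k) * sin (s / real (Suc k))) \<longlonglongrightarrow> s" for s :: real
proof -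
  have "((\<lambda>x. sin (x * s)) has_real_derivative s) (at 0)"
    by (auto intro!: derivative_eq_intros)
  then have "((\<lambda>h. (sin ((0 + h) * s) - sin (0 * s)) / h) \<longlongrightarrow> s) (at 0)"
    unfolding DERIV_def .
  moreover have "filterlim (\<lambda>k. 1 / real (Suc k)) (at 0) sequentially"
    unfolding filterlim_at using LIMSEQ_inverse_real_of_nat by (simp add: inverse_eq_divide)
  ultimately have "(\<lambda>k. (sin ((0 + 1 / real (Suc k)) * s) - sin (0 * s)) / (1 / real (Suc k))) \<longlonglongrightarrow> s"
    by (rule filterlim_compose)
  then show ?thesis by (simp add: mult.commute)
qed

lemma cos_scaled_tendsto: "(\<lambda>k. cos (s / real (Suc k))) \<longlonglongrightarrow> 1" for s :: real
proof -
  have "(\<lambda>k. cos (s * inverse (real (Suc k)))) \<longlonglongrightarrow> cos (s * 0)"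
    by (intro tendsto_intros LIMSEQ_inverse_real_of_nat)
  then show ?thesis by (simp add: divide_inverse)
qed

context planar_domain
begin

text \<open>The advection operator is skew on its maximal domain. Truncating by the bounded functions
  \<open>k sin (s / k)\<close>, the primitive of which is \<open>k\<^sup>2 (1 - cos (s / k))\<close>, turns the advection of
  \<open>\<phi> n\<close> against itself into the advection of a gradient, which vanishes for divergence-free fields.\<close>

lemma advection_self_tendsto_0:
  assumes u: "divfree u" and \<theta>: "\<theta> \<in> H1 \<Omega>"
    and \<phi>: "\<And>n::nat. \<phi> n \<in> test_functions \<Omega>"
    and l1: "(\<lambda>n. l2norm vol (\<lambda>x. \<phi> n x - \<theta> x)) \<longlonglongrightarrow> 0"
    and l2: "(\<lambda>n. l2norm vol (\<lambda>x. classical_grad (\<phi> n) x - grad \<Omega> \<theta> x)) \<longlonglongrightarrow> 0"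
    and ae: "AE x in vol. (\<lambda>n. \<phi> n x) \<longlonglongrightarrow> \<theta> x"
    and C: "\<And>X. X \<in> test_functions \<Omega> \<Longrightarrow>
      \<bar>\<integral>x. X x * (u x \<bullet> grad \<Omega> \<theta> x) \<partial>vol\<bar> \<le> C * (l2norm vol X + l2norm vol (classical_grad X))"
  shows "(\<lambda>n. \<integral>x. \<phi> n x * (u x \<bullet> grad \<Omega> \<theta> x) \<partial>vol) \<longlonglongrightarrow> 0"
proof -
  note T = H1D[OF \<theta>] and s = test_functions_smooth[OF \<phi>] and ul = divfree_l2[OF u]
  have [measurable]: "\<theta> \<in> borel_measurable vol" "grad \<Omega> \<theta> \<in> borel_measurable vol" "u \<in> borel_measurable vol"
    using T ul by (auto intro: l2_measurable)
  have [measurable]: "\<phi> n \<in> borel_measurable vol" "classical_grad (\<phi> n) \<in> borel_measurable vol" for n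
    using smooth_l2[OF s] by (auto intro: l2_measurable)
  define \<kappa> where "\<kappa> k = real (Suc k)" for k
  have \<kappa>: "\<kappa> k > 0" for k by (simp add: \<kappa>_def)
  \<comment> \<open>\<open>G k\<close> is bounded by \<open>\<kappa> k\<close>, is 1-Lipschitz with
    derivative \<open>cos (s / \<kappa> k)\<close>, and tends to the identity as \<open>k\<close>
    grows. The index is shifted by one so that \<open>\<kappa> k\<close> is never 0.\<close>
  define G where "G k s = \<kappa> k * sin (s / \<kappa> k)" for k s
  define F where "F k s = (\<kappa> k)\<^sup>2 * (1 + (-1) * cos (s / \<kappa> k))" for k s
  have G1: "smooth1 (G k)" for k
    using smooth1_mult[OF smooth1_const smooth1_affine[OF smooth1_sin, of "1 / \<kappa> k" 0], of "\<kappa> k"]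
    by (simp add: G_def[abs_def])
  have F1: "smooth1 (F k)" for k
    using smooth1_mult[OF smooth1_const smooth1_add[OF smooth1_const smooth1_mult[OF smooth1_const
      smooth1_affine[OF smooth1_cos, of "1 / \<kappa> k" 0]]], of "(\<kappa> k)\<^sup>2" 1 "-1"]
    by (simp add: F_def[abs_def])
  have dG: "deriv (G k) t = cos (t / \<kappa> k)" for k t
    by (rule DERIV_imp_deriv) (use \<kappa>[of k] in \<open>auto simp: G_def[abs_def] intro!: derivative_eq_intros\<close>)
  have dF: "deriv (F k) t = G k t" for k t
    by (rule DERIV_imp_deriv)
       (use \<kappa>[of k] in \<open>auto simp: F_def[abs_def] G_def power2_eq_square intro!: derivative_eq_intros\<close>)
  have [measurable]: "G k \<in> borel_measurable borel" for k by (rule smooth1_measurable[OF G1])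
  have Gt: "(\<lambda>x. G k (\<phi> n x)) \<in> test_functions \<Omega>" for k n
    by (rule test_functions_smooth1[OF \<phi> G1]) (simp add: G_def)
  have Gb: "\<bar>G k t\<bar> \<le> \<kappa> k" for k t using \<kappa>[of k] by (simp add: G_def abs_mult)
  have GL: "\<bar>G k t - G k t'\<bar> \<le> \<bar>t - t'\<bar>" for k t t'
  proof -
    have "\<bar>G k t - G k t'\<bar> = \<kappa> k * \<bar>sin (t / \<kappa> k) - sin (t' / \<kappa> k)\<bar>"
      using \<kappa>[of k] by (simp add: G_def abs_mult flip: right_diff_distrib)
    also have "\<dots> \<le> \<kappa> k * \<bar>t / \<kappa> k - t' / \<kappa> k\<bar>"
      using \<kappa>[of k] by (intro mult_left_mono abs_sin_diff_le) auto
    also have "\<dots> = \<bar>t - t'\<bar>" using \<kappa>[of k] by (simp add: abs_divide flip: diff_divide_distrib)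
    finally show ?thesis .
  qed
  have G0: "G k 0 = 0" for k by (simp add: G_def)
  define lam where "lam X = (\<integral>x. X x * (u x \<bullet> grad \<Omega> \<theta> x) \<partial>vol)" for X
  \<comment> \<open>For fixed \<open>k\<close> the part of the integrand with the gradient of
    \<open>\<phi> n\<close> drops out, since \<open>G k (\<phi> n)\<close> times that gradient is
    the gradient of \<open>F k (\<phi> n)\<close>. What is left contains the vanishing difference of
    gradients, with a weight bounded by \<open>\<kappa> k\<close>.\<close>
  have lamG: "(\<lambda>n. lam (\<lambda>x. G k (\<phi> n x))) \<longlonglongrightarrow> 0" for k
  proof (rule Lim_null_comparison)
    show "(\<lambda>n. \<bar>\<kappa> k\<bar> * l2norm vol u * l2norm vol (\<lambda>x. classical_grad (\<phi> n) x - grad \<Omega> \<theta> x)) \<longlonglongrightarrow> 0"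
      by (intro tendsto_mult_right_zero l2)
    show "\<forall>\<^sub>F n in sequentially. norm (lam (\<lambda>x. G k (\<phi> n x)))
       \<le> \<bar>\<kappa> k\<bar> * l2norm vol u * l2norm vol (\<lambda>x. classical_grad (\<phi> n) x - grad \<Omega> \<theta> x)"
    proof (intro always_eventually allI)
      fix n
      have Gu: "(\<lambda>x. G k (\<phi> n x) *\<^sub>R u x) \<in> l2 vol" "l2norm vol (\<lambda>x. G k (\<phi> n x) *\<^sub>R u x) \<le> \<bar>\<kappa> k\<bar> * l2norm vol u"
        using Gb by (auto intro!: l2_scaleR_bounded ul)
      have "(\<integral>x. u x \<bullet> classical_grad (\<lambda>x. F k (\<phi> n x)) x \<partial>vol) = 0"
        by (rule divfree_smooth[OF u smooth_smooth1[OF s F1]])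
      then have z: "(\<integral>x. G k (\<phi> n x) *\<^sub>R u x \<bullet> classical_grad (\<phi> n) x \<partial>vol) = 0"
        by (simp add: classical_grad_smooth1[OF smooth_differentiable[OF s] F1] dF)
      have "(\<integral>x. G k (\<phi> n x) *\<^sub>R u x \<bullet> (classical_grad (\<phi> n) x - grad \<Omega> \<theta> x) \<partial>vol)
          = (\<integral>x. G k (\<phi> n x) *\<^sub>R u x \<bullet> classical_grad (\<phi> n) x \<partial>vol) - (\<integral>x. G k (\<phi> n x) *\<^sub>R u x \<bullet> grad \<Omega> \<theta> x \<partial>vol)"
        unfolding inner_diff_right
        by (intro Bochner_Integration.integral_diff l2_inner Gu T smooth_l2 s)
      then have "lam (\<lambda>x. G k (\<phi> n x)) = - (\<integral>x. G k (\<phi> n x) *\<^sub>R u x \<bullet> (classical_grad (\<phi> n) x - grad \<Omega> \<theta> x) \<partial>vol)"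
        using z by (simp add: lam_def)
      also have "norm \<dots> \<le> l2norm vol (\<lambda>x. G k (\<phi> n x) *\<^sub>R u x) * l2norm vol (\<lambda>x. classical_grad (\<phi> n) x - grad \<Omega> \<theta> x)"
        using l2norm_Cauchy_Schwarz[OF Gu(1) l2_diff[OF smooth_l2(2)[OF s] T(2)], of n] by simp
      also have "\<dots> \<le> \<bar>\<kappa> k\<bar> * l2norm vol u * l2norm vol (\<lambda>x. classical_grad (\<phi> n) x - grad \<Omega> \<theta> x)"
        by (intro mult_right_mono Gu) simp
      finally show "norm (lam (\<lambda>x. G k (\<phi> n x)))
         \<le> \<bar>\<kappa> k\<bar> * l2norm vol u * l2norm vol (\<lambda>x. classical_grad (\<phi> n) x - grad \<Omega> \<theta> x)" .
    qed
  qed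
  define d where "d n = l2norm vol (\<lambda>x. \<phi> n x - \<theta> x)" for n
  define d' where "d' n = l2norm vol (\<lambda>x. classical_grad (\<phi> n) x - grad \<Omega> \<theta> x)" for n
  define e1 where "e1 k = l2norm vol (\<lambda>x. \<theta> x - G k (\<theta> x))" for k
  define e2 where "e2 k = l2norm vol (\<lambda>x. (1 - cos (\<theta> x / \<kappa> k)) *\<^sub>R grad \<Omega> \<theta> x)" for k
  define c where "c k n = l2norm vol (\<lambda>x. (1 - cos (\<phi> n x / \<kappa> k)) *\<^sub>R grad \<Omega> \<theta> x)" for k n
  have abs1cos: "\<bar>1 - cos t\<bar> \<le> 2" for t :: real using cos_ge_minus_one[of t] cos_le_one[of t] by simp
  have cl: "(\<lambda>x. (1 - cos (f x / \<kappa> k)) *\<^sub>R w x) \<in> l2 vol"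
       "l2norm vol (\<lambda>x. (1 - cos (f x / \<kappa> k)) *\<^sub>R w x) \<le> 2 * l2norm vol w"
    if "f \<in> borel_measurable vol" "w \<in> l2 vol" for f k and w :: "real^2 \<Rightarrow> real^2"
  proof -
    note [measurable] = that(1)
    have m: "(\<lambda>x. 1 - cos (f x / \<kappa> k)) \<in> borel_measurable vol" by measurable
    have b: "AE x in vol. \<bar>1 - cos (f x / \<kappa> k)\<bar> \<le> 2" using abs1cos by simp
    show "(\<lambda>x. (1 - cos (f x / \<kappa> k)) *\<^sub>R w x) \<in> l2 vol"
       "l2norm vol (\<lambda>x. (1 - cos (f x / \<kappa> k)) *\<^sub>R w x) \<le> 2 * l2norm vol w"
      using l2_scaleR_bounded[OF that(2) m b] by auto
  qed
  have thG: "(\<lambda>x. \<theta> x - G k (\<theta> x)) \<in> l2 vol" for k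
  proof (rule l2_dominated(1)[OF l2_mult(1)[OF T(1), of 2]])
    have "\<bar>\<theta> x - G k (\<theta> x)\<bar> \<le> 2 * \<bar>\<theta> x\<bar>" for x using GL[of k "\<theta> x" 0] by (simp add: G0)
    then show "AE x in vol. norm (\<theta> x - G k (\<theta> x)) \<le> norm (2 * \<theta> x)" by (simp add: abs_mult)
  qed measurable
  \<comment> \<open>Bound for the split of \<open>\<phi> n\<close> into
    \<open>G k (\<phi> n)\<close> and a remainder \<open>X\<close>. The remainder is small in the
    \<open>H1\<close> norm up to errors that vanish as \<open>n\<close> grows (\<open>d\<close> and
    \<open>d'\<close>) and then as \<open>k\<close> grows (\<open>e1\<close> and
    \<open>e2\<close>).\<close>
  define b where "b k n = \<bar>lam (\<lambda>x. G k (\<phi> n x))\<bar> + \<bar>C\<bar> * ((2 * d n + e1 k) + (2 * d' n + c k n))" for k n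
  show ?thesis
  proof (rule tendsto_0_double_bound[where b=b and e="\<lambda>k. \<bar>0\<bar> + \<bar>C\<bar> * ((2 * 0 + e1 k) + (2 * 0 + e2 k))"])
    fix k n
    define X where "X x = \<phi> n x + (-1) * G k (\<phi> n x)" for x
    have X: "X \<in> test_functions \<Omega>" unfolding X_def by (intro test_functions_add test_functions_cmult \<phi> Gt)
    have gX: "classical_grad X x = (1 - cos (\<phi> n x / \<kappa> k)) *\<^sub>R classical_grad (\<phi> n) x" for x
    proof -
      note d = smooth_differentiable[OF smooth_smooth1[OF s[of n] G1[of k]], of x]
      have "classical_grad X x = classical_grad (\<phi> n) x + (-1) *\<^sub>R classical_grad (\<lambda>x. G k (\<phi> n x)) x"
        unfolding X_def
        by (simp only: classical_grad_add[OF smooth_differentiable[OF s]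
              smooth_differentiable[OF smooth_mult[OF smooth_const smooth_smooth1[OF s G1]]]]
            classical_grad_cmult[OF d])
      then show ?thesis
        by (simp add: classical_grad_smooth1[OF smooth_differentiable[OF s] G1] dG algebra_simps)
    qed
    have "lam (\<phi> n) = lam X + lam (\<lambda>x. G k (\<phi> n x))"
    proof -
      have "lam (\<phi> n) = (\<integral>x. X x * (u x \<bullet> grad \<Omega> \<theta> x) + G k (\<phi> n x) * (u x \<bullet> grad \<Omega> \<theta> x) \<partial>vol)"
        unfolding lam_def X_def by (intro Bochner_Integration.integral_cong) (auto simp: algebra_simps)
      then show ?thesis
        using integrable_advection_smooth[OF ul test_functions_smooth[OF X] T(2)]
          integrable_advection_smooth[OF ul smooth_smooth1[OF s G1] T(2), of k n]
        by (simp add: lam_def)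
    qed
    moreover have "\<bar>lam X\<bar> \<le> \<bar>C\<bar> * (l2norm vol X + l2norm vol (classical_grad X))"
      using C[OF X] unfolding lam_def
      by (rule order_trans) (intro mult_right_mono, auto)
    \<comment> \<open>The map taking \<open>t\<close> to \<open>t - G k t\<close> is 2-Lipschitz, so
      replacing \<open>\<phi> n\<close> by \<theta> in it costs at most
      \<open>2 * d n\<close>.\<close>
    moreover have "l2norm vol X \<le> 2 * d n + e1 k"
    proof -
      have m: "(\<lambda>x. X x - (\<theta> x - G k (\<theta> x))) \<in> borel_measurable vol" unfolding X_def by measurable
      have "\<bar>X x - (\<theta> x - G k (\<theta> x))\<bar> \<le> 2 * \<bar>\<phi> n x - \<theta> x\<bar>" for x
      proof -
        have "X x - (\<theta> x - G k (\<theta> x)) = (\<phi> n x - \<theta> x) - (G k (\<phi> n x) - G k (\<theta> x))"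
          by (simp add: X_def)
        then show ?thesis
          using order_trans[OF abs_triangle_ineq4[of "\<phi> n x - \<theta> x" "G k (\<phi> n x) - G k (\<theta> x)"]
              add_left_mono[OF GL[of k "\<phi> n x" "\<theta> x"], of "\<bar>\<phi> n x - \<theta> x\<bar>"]]
          by (simp only: mult_2)
      qed
      then have "AE x in vol. norm (X x - (\<theta> x - G k (\<theta> x))) \<le> norm (2 * (\<phi> n x - \<theta> x))"
        by (intro AE_I2) (simp only: real_norm_def abs_mult abs_numeral)
      from l2_dominated[OF l2_mult(1)[OF l2_diff[OF smooth_l2(1)[OF s] T(1)]] m this]
      have "(\<lambda>x. X x - (\<theta> x - G k (\<theta> x))) \<in> l2 vol" "l2norm vol (\<lambda>x. X x - (\<theta> x - G k (\<theta> x))) \<le> 2 * d n"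
        using l2_mult(2)[OF l2_diff[OF smooth_l2(1)[OF s] T(1)], of 2 n] by (auto simp: d_def)
      then show ?thesis using l2norm_triangle[OF _ thG, of "\<lambda>x. X x - (\<theta> x - G k (\<theta> x))" k]
        by (simp add: e1_def)
    qed
    moreover have "l2norm vol (classical_grad X) \<le> 2 * d' n + c k n"
    proof -
      have "l2norm vol (classical_grad X) = l2norm vol (\<lambda>x. (1 - cos (\<phi> n x / \<kappa> k)) *\<^sub>R (classical_grad (\<phi> n) x - grad \<Omega> \<theta> x)
           + (1 - cos (\<phi> n x / \<kappa> k)) *\<^sub>R grad \<Omega> \<theta> x)"
        by (simp add: gX[abs_def] algebra_simps)
      also have "\<dots> \<le> l2norm vol (\<lambda>x. (1 - cos (\<phi> n x / \<kappa> k)) *\<^sub>R (classical_grad (\<phi> n) x - grad \<Omega> \<theta> x))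
           + l2norm vol (\<lambda>x. (1 - cos (\<phi> n x / \<kappa> k)) *\<^sub>R grad \<Omega> \<theta> x)"
        by (intro l2norm_triangle cl l2_diff smooth_l2 s T) measurable
      also have "\<dots> \<le> 2 * d' n + c k n"
        unfolding d'_def c_def by (intro add_right_mono cl l2_diff smooth_l2 s T) measurable
      finally show ?thesis .
    qed
    ultimately have "\<bar>lam (\<phi> n)\<bar> \<le> b k n"
      unfolding b_def
      by (smt (verit) abs_ge_zero abs_triangle_ineq mult_left_mono)
    then show "\<bar>\<integral>x. \<phi> n x * (u x \<bullet> grad \<Omega> \<theta> x) \<partial>vol\<bar> \<le> b k n" by (simp add: lam_def)
  next
    fix k
    \<comment> \<open>Dominated convergence in \<open>n\<close> for fixed \<open>k\<close>; here the
      almost everywhere convergence of \<open>\<phi> n\<close> enters.\<close>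
    have "(\<lambda>n. l2norm vol (\<lambda>x. (1 - cos (\<phi> n x / \<kappa> k)) *\<^sub>R grad \<Omega> \<theta> x - (1 - cos (\<theta> x / \<kappa> k)) *\<^sub>R grad \<Omega> \<theta> x)) \<longlonglongrightarrow> 0"
    proof (rule l2norm_dominated_convergence)
      show "(\<lambda>x. 4 *\<^sub>R grad \<Omega> \<theta> x) \<in> l2 vol" by (intro l2_scaleR T)
      show "AE x in vol. norm ((1 - cos (\<phi> n x / \<kappa> k)) *\<^sub>R grad \<Omega> \<theta> x - (1 - cos (\<theta> x / \<kappa> k)) *\<^sub>R grad \<Omega> \<theta> x)
          \<le> norm (4 *\<^sub>R grad \<Omega> \<theta> x)" for n
      proof (rule AE_I2)
        fix x
        have "\<bar>(1 - cos (\<phi> n x / \<kappa> k)) - (1 - cos (\<theta> x / \<kappa> k))\<bar> \<le> 4"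
          using abs1cos[of "\<phi> n x / \<kappa> k"] abs1cos[of "\<theta> x / \<kappa> k"] by linarith
        then show "norm ((1 - cos (\<phi> n x / \<kappa> k)) *\<^sub>R grad \<Omega> \<theta> x - (1 - cos (\<theta> x / \<kappa> k)) *\<^sub>R grad \<Omega> \<theta> x)
          \<le> norm (4 *\<^sub>R grad \<Omega> \<theta> x)"
          unfolding scaleR_diff_left[symmetric] norm_scaleR by (intro mult_right_mono) auto
      qed
      show "AE x in vol. (\<lambda>n. (1 - cos (\<phi> n x / \<kappa> k)) *\<^sub>R grad \<Omega> \<theta> x - (1 - cos (\<theta> x / \<kappa> k)) *\<^sub>R grad \<Omega> \<theta> x) \<longlonglongrightarrow> 0"
        using ae
      proof eventually_elim
        case (elim x)
        have "(\<lambda>n. (1 - cos (\<phi> n x / \<kappa> k)) *\<^sub>R grad \<Omega> \<theta> x - (1 - cos (\<theta> x / \<kappa> k)) *\<^sub>R grad \<Omega> \<theta> x)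
           \<longlonglongrightarrow> (1 - cos (\<theta> x / \<kappa> k)) *\<^sub>R grad \<Omega> \<theta> x - (1 - cos (\<theta> x / \<kappa> k)) *\<^sub>R grad \<Omega> \<theta> x"
          using \<kappa>[of k] by (intro tendsto_intros elim) auto
        then show ?case by simp
      qed
    qed measurable
    then have "c k \<longlonglongrightarrow> e2 k"
      unfolding c_def[abs_def] e2_def by (rule tendsto_n2[rotated 2]) (intro cl T, measurable)+
    moreover have "d \<longlonglongrightarrow> 0" "d' \<longlonglongrightarrow> 0" using l1 l2 by (simp_all add: d_def[abs_def] d'_def[abs_def])
    ultimately show "b k \<longlonglongrightarrow> \<bar>0\<bar> + \<bar>C\<bar> * ((2 * 0 + e1 k) + (2 * 0 + e2 k))"
      unfolding b_def[abs_def] by (intro tendsto_intros lamG)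
  next
    have "e1 \<longlonglongrightarrow> 0" unfolding e1_def[abs_def]
    proof (rule l2norm_dominated_convergence[OF _ l2_mult(1)[OF T(1), of 2]])
      have "\<bar>\<theta> x - G k (\<theta> x)\<bar> \<le> 2 * \<bar>\<theta> x\<bar>" for x k using GL[of k "\<theta> x" 0] by (simp add: G0)
      then show "AE x in vol. norm (\<theta> x - G k (\<theta> x)) \<le> norm (2 * \<theta> x)" for k by (simp add: abs_mult)
      have "(\<lambda>k. \<theta> x - G k (\<theta> x)) \<longlonglongrightarrow> \<theta> x - \<theta> x" for x
        unfolding G_def \<kappa>_def by (intro tendsto_diff tendsto_const sin_scaled_tendsto)
      then show "AE x in vol. (\<lambda>k. \<theta> x - G k (\<theta> x)) \<longlonglongrightarrow> 0" by simp
    qed measurable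
    moreover have "e2 \<longlonglongrightarrow> 0" unfolding e2_def[abs_def]
    proof (rule l2norm_dominated_convergence[OF _ l2_scaleR(1)[OF T(2), of 2]])
      show "AE x in vol. norm ((1 - cos (\<theta> x / \<kappa> k)) *\<^sub>R grad \<Omega> \<theta> x) \<le> norm (2 *\<^sub>R grad \<Omega> \<theta> x)" for k
        using abs1cos by (auto simp: intro!: mult_right_mono)
      have "(\<lambda>k. (1 - cos (\<theta> x / \<kappa> k)) *\<^sub>R grad \<Omega> \<theta> x) \<longlonglongrightarrow> (1 - 1) *\<^sub>R grad \<Omega> \<theta> x" for x
        unfolding \<kappa>_def by (intro tendsto_intros cos_scaled_tendsto)
      then show "AE x in vol. (\<lambda>k. (1 - cos (\<theta> x / \<kappa> k)) *\<^sub>R grad \<Omega> \<theta> x) \<longlonglongrightarrow> 0" by simp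
    qed measurable
    ultimately have "(\<lambda>k. \<bar>0\<bar> + \<bar>C\<bar> * ((2 * 0 + e1 k) + (2 * 0 + e2 k))) \<longlonglongrightarrow> \<bar>0\<bar> + \<bar>C\<bar> * ((2 * 0 + 0) + (2 * 0 + 0))"
      by (intro tendsto_intros)
    then show "(\<lambda>k. \<bar>0\<bar> + \<bar>C\<bar> * ((2 * 0 + e1 k) + (2 * 0 + e2 k))) \<longlonglongrightarrow> 0" by simp
  qed
qed

end

section \<open>Smooth streamfunctions\<close>

definition perp :: "real^2 \<Rightarrow> real^2" where
  "perp v = vector [v $ 2, - (v $ 1)]"

lemma perp_nth [simp]: "perp v $ 1 = v $ 2" "perp v $ 2 = - (v $ 1)"
  by (simp_all add: perp_def)

lemma perp_add: "perp (v + w) = perp v + perp w"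
  and perp_scaleR: "perp (c *\<^sub>R v) = c *\<^sub>R perp v"
  by (simp_all add: vec_eq_iff forall_2)

lemma norm_perp [simp]: "norm (perp v) = norm v"
  by (simp add: norm_vec_def L2_set_def sum_2 add.commute)

lemma inner_vec2: "v \<bullet> w = v $ 1 * w $ 1 + v $ 2 * w $ 2" for v w :: "real^2"
  by (simp add: inner_vec_def sum_2)

lemma continuous_perp: "continuous_on A perp"
  by (rule linear_continuous_on)
     (auto intro!: bounded_linear_intro[where K=1] simp: perp_add perp_scaleR)

lemma perp_measurable [measurable]: "perp \<in> borel_measurable borel"
  by (intro borel_measurable_continuous_onI continuous_perp)

context planar_domain
begin

lemma l2_perp: "w \<in> l2 vol \<Longrightarrow> (\<lambda>x. perp (w x)) \<in> l2 vol" "l2norm vol (\<lambda>x. perp (w x)) = l2norm vol w"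
  by (auto simp: l2_def l2norm_def)

text \<open>Compact support in the plane fixes the value 0 far away, while a gradient supported
  inside \<Omega> leaves a free constant in every hole. The velocities of these streamfunctions
  vanish near the boundary.\<close>

definition stream_tests :: "(real^2 \<Rightarrow> real) set" where
  "stream_tests = {\<psi>. smooth \<psi> \<and> (\<exists>K. compact K \<and> (\<forall>x. x \<notin> K \<longrightarrow> \<psi> x = 0))
     \<and> (\<exists>K. compact K \<and> K \<subseteq> \<Omega> \<and> (\<forall>x. x \<notin> K \<longrightarrow> classical_grad \<psi> x = 0))}"

lemma stream_tests_smooth: "\<psi> \<in> stream_tests \<Longrightarrow> smooth \<psi>"
  by (simp add: stream_tests_def)

lemma test_stream_tests: "\<psi> \<in> test_functions \<Omega> \<Longrightarrow> \<psi> \<in> stream_tests"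
  by (rule test_functionsE[of \<psi> \<Omega>]) (auto simp: stream_tests_def)

lemma stream_tests_lincomb:
  assumes "\<psi> \<in> stream_tests" "\<psi>' \<in> stream_tests"
  shows "(\<lambda>x. \<psi> x + c * \<psi>' x) \<in> stream_tests"
    "classical_grad (\<lambda>x. \<psi> x + c * \<psi>' x) x = classical_grad \<psi> x + c *\<^sub>R classical_grad \<psi>' x"
proof -
  note s = stream_tests_smooth[OF assms(1)] and s' = stream_tests_smooth[OF assms(2)]
  have g: "classical_grad (\<lambda>x. \<psi> x + c * \<psi>' x) x = classical_grad \<psi> x + c *\<^sub>R classical_grad \<psi>' x" for x
    by (simp only: classical_grad_add[OF smooth_differentiable[OF s] smooth_differentiable[OF smooth_mult[OF smooth_const s']]]
        classical_grad_cmult[OF smooth_differentiable[OF s']])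
  show "classical_grad (\<lambda>x. \<psi> x + c * \<psi>' x) x = classical_grad \<psi> x + c *\<^sub>R classical_grad \<psi>' x" by (rule g)
  obtain K L where K: "compact K" "\<And>x. x \<notin> K \<Longrightarrow> \<psi> x = 0" "compact L" "L \<subseteq> \<Omega>" "\<And>x. x \<notin> L \<Longrightarrow> classical_grad \<psi> x = 0"
    using assms(1) by (auto simp: stream_tests_def)
  obtain K' L' where K': "compact K'" "\<And>x. x \<notin> K' \<Longrightarrow> \<psi>' x = 0" "compact L'" "L' \<subseteq> \<Omega>" "\<And>x. x \<notin> L' \<Longrightarrow> classical_grad \<psi>' x = 0"
    using assms(2) by (auto simp: stream_tests_def)
  have "compact (K \<union> K')" "\<forall>x. x \<notin> K \<union> K' \<longrightarrow> \<psi> x + c * \<psi>' x = 0" "compact (L \<union> L')" "L \<union> L' \<subseteq> \<Omega>"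
    "\<forall>x. x \<notin> L \<union> L' \<longrightarrow> classical_grad (\<lambda>x. \<psi> x + c * \<psi>' x) x = 0"
    using K K' by (auto simp: g)
  moreover have "smooth (\<lambda>x. \<psi> x + c * \<psi>' x)" by (intro smooth_add smooth_mult smooth_const s s')
  ultimately show "(\<lambda>x. \<psi> x + c * \<psi>' x) \<in> stream_tests"
    unfolding stream_tests_def by blast
qed

lemma stream_tests_zero: "(\<lambda>x. 0) \<in> stream_tests"
  by (rule test_stream_tests[OF test_functions_zero])

text \<open>Off the support of its gradient, which lies in \<Omega>, the function is locally
  constant. Passing to the component that contains \<open>S\<close> replaces \<open>S\<close> by an
  open connected set, to which the criterion by derivatives applies.\<close>

lemma stream_tests_constant_on:
  assumes \<psi>: "\<psi> \<in> stream_tests" and S: "connected S" "S \<inter> \<Omega> = {}" "x \<in> S" "y \<in> S"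
  shows "\<psi> x = \<psi> y"
proof -
  obtain L where L: "compact L" "L \<subseteq> \<Omega>" "\<And>x. x \<notin> L \<Longrightarrow> classical_grad \<psi> x = 0"
    using \<psi> by (auto simp: stream_tests_def)
  note s = stream_tests_smooth[OF \<psi>]
  define C where "C = connected_component_set (- L) x"
  have o: "open (- L)" using L(1) by (simp add: compact_imp_closed open_Compl)
  have C: "open C" "connected C" by (auto simp: C_def o open_connected_component)
  have SC: "S \<subseteq> C" unfolding C_def using S L(2) by (intro connected_component_maximal) auto
  have "\<psi> constant_on C"
  proof (rule has_derivative_zero_connected_constant_on[OF C(2,1), of "{}"])
    have "C \<subseteq> - L" unfolding C_def by (rule connected_component_subset)
    then have "(\<psi> has_derivative (\<lambda>h. 0)) (at x within C)" if "x \<in> C" for x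
      using has_derivative_at_withinI[OF has_derivative_classical_grad[OF smooth_differentiable[OF s]], of x C] L(3)[of x] that
      by auto
    then show "\<forall>x\<in>C - {}. (\<psi> has_derivative (\<lambda>h. 0)) (at x within C)" by simp
  qed (auto intro: smooth_continuous_on s)
  then show ?thesis using SC S(3,4) unfolding constant_on_def by (metis subsetD)
qed

text \<open>The function is its own trace, approximated by the constant sequence. It vanishes on the
  exterior boundary because the outside of the closure is connected and unbounded and so leaves the
  compact support; continuity carries the value 0 to the frontier.\<close>

lemma stream_tests_streamfunctions:
  assumes \<psi>: "\<psi> \<in> stream_tests"
  shows "\<psi> \<in> streamfunctions \<Omega>"
proof -
  note s = stream_tests_smooth[OF \<psi>]
  have fd: "frontier \<Omega> \<inter> \<Omega> = {}" using open_dom by (auto simp: frontier_def interior_open)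
  have "has_trace \<Omega> \<psi> \<psi>"
    unfolding has_trace_def
  proof (intro conjI exI[of _ "\<lambda>_. \<psi>"])
    \<comment> \<open>The sigma-algebra of \<open>measure_of\<close> is the generated one whatever
      the set function is, here that of the Borel sets.\<close>
    have h: "sets hausdorff1 = sets borel" "space hausdorff1 = UNIV"
      by (simp_all add: hausdorff1_def sets_measure_of_conv space_measure_of_conv sets.sigma_sets_eq[of borel, simplified])
    have "(\<lambda>x. indicator (frontier \<Omega>) x *\<^sub>R \<psi> x) \<in> borel_measurable borel"
      using smooth_borel[OF s] by (intro borel_measurable_scaleR borel_measurable_indicator) auto
    then show "set_borel_measurable hausdorff1 (frontier \<Omega>) \<psi>"
      unfolding set_borel_measurable_def by (simp cong: measurable_cong_sets add: h(1))
    have "l2norm vol (grad \<Omega> (\<lambda>x. 0)) = l2norm vol (classical_grad (\<lambda>x. 0))" by (rule l2norm_grad_smooth[OF smooth_const])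
    then have "H1_norm \<Omega> (\<lambda>x. 0) = 0" by (simp add: H1_norm_eq l2norm_def)
    then show "(\<lambda>n::nat. H1_norm \<Omega> (\<lambda>x. \<psi> x - \<psi> x)) \<longlonglongrightarrow> 0" by simp
  qed (use s in auto)
  moreover have "\<psi> x = 0" if x: "x \<in> exterior_boundary \<Omega>" for x
  proof -
    define E where "E = outside (closure \<Omega>)"
    have bc: "bounded (closure \<Omega>)" by (rule bounded_closure[OF bounded_dom])
    have E: "connected E" "\<not> bounded E"
      unfolding E_def using connected_outside[OF bc] unbounded_outside[OF bc] by auto
    have "E \<inter> closure \<Omega> = {}" unfolding E_def by (rule outside_no_overlap)
    then have E': "E \<inter> \<Omega> = {}" using closure_subset[of \<Omega>] by blast
    obtain K where K: "compact K" "\<And>x. x \<notin> K \<Longrightarrow> \<psi> x = 0" using \<psi> by (auto simp: stream_tests_def)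
    have "\<not> E \<subseteq> K" using E(2) K(1) compact_imp_bounded bounded_subset by blast
    then obtain y where y: "y \<in> E" "\<psi> y = 0" using K(2) by blast
    have "\<psi> z = 0" if "z \<in> E" for z
      using stream_tests_constant_on[OF \<psi> E(1) E' that y(1)] y(2) by simp
    moreover have "x \<in> closure E" using x by (simp add: exterior_boundary_def E_def frontier_def)
    moreover have "closed {z. \<psi> z = 0}"
      using continuous_closed_preimage_constant[OF smooth_continuous_on[OF s, of UNIV] closed_UNIV, of 0] by simp
    ultimately show ?thesis using closure_minimal[of E "{z. \<psi> z = 0}"] by auto
  qed
  moreover have "\<exists>c. \<forall>x\<in>\<Gamma>. \<psi> x = c" if "\<Gamma> \<in> components (frontier \<Omega>)" for \<Gamma>
  proof -
    have "connected \<Gamma>" "\<Gamma> \<inter> \<Omega> = {}" using that in_components_connected in_components_subset fd by blast+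
    then show ?thesis using stream_tests_constant_on[OF \<psi>] by blast
  qed
  ultimately show ?thesis using smooth_H1(1)[OF s] by (auto simp: streamfunctions_def)
qed

text \<open>With a test function \<theta> the inner product of \<open>w\<close> and the gradient is
  square integrable, so the term is continuous in \<xi> for the square norm. Hence the limit in the
  definite description exists, and the test functions approximating \<xi> show that it is
  unique.\<close>

lemma advection_smooth:
  assumes \<xi>: "\<xi> \<in> H10 \<Omega>" and w: "w \<in> l2 vol" and \<theta>: "\<theta> \<in> test_functions \<Omega>"
  shows "advection \<Omega> \<xi> w \<theta> = (\<integral>x. \<xi> x * (w x \<bullet> classical_grad \<theta> x) \<partial>vol)"
proof -
  note s = test_functions_smooth[OF \<theta>]
  obtain L where L: "\<And>x. norm (classical_grad \<theta> x) \<le> L" using test_functions_bounded(2)[OF \<theta>] by blast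
  have wl: "(\<lambda>x. w x \<bullet> classical_grad \<theta> x) \<in> l2 vol"
  proof (rule l2_dominated(1)[OF l2_scaleR(1)[OF w, of L]])
    show "(\<lambda>x. w x \<bullet> classical_grad \<theta> x) \<in> borel_measurable vol"
      by (intro borel_measurable_inner l2_measurable w smooth_l2 s)
    have "\<bar>w x \<bullet> classical_grad \<theta> x\<bar> \<le> \<bar>L\<bar> * norm (w x)" for x
    proof -
      have "\<bar>w x \<bullet> classical_grad \<theta> x\<bar> \<le> norm (w x) * norm (classical_grad \<theta> x)"
        by (rule Cauchy_Schwarz_ineq2)
      also have "\<dots> \<le> norm (w x) * \<bar>L\<bar>" using L[of x] by (intro mult_left_mono) auto
      finally show ?thesis by (simp add: mult.commute)
    qed
    then show "AE x in vol. norm (w x \<bullet> classical_grad \<theta> x) \<le> norm (L *\<^sub>R w x)" by simp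
  qed
  have b: "advection_bounded \<Omega> X w \<theta> = (\<integral>x. X x * (w x \<bullet> classical_grad \<theta> x) \<partial>vol)" if X: "X \<in> l2 vol" for X
    unfolding advection_bounded_def set_lint_eq
  proof (rule integral_cong_AE)
    show "AE x in vol. X x * (w x \<bullet> grad \<Omega> \<theta> x) = X x * (w x \<bullet> classical_grad \<theta> x)"
      using smooth_H1(2)[OF s] by eventually_elim simp
  qed (intro borel_measurable_times borel_measurable_inner l2_measurable X w smooth_l2 H1D smooth_H1 s)+
  have xl: "\<xi> \<in> l2 vol" by (rule H1D(1)[OF H10_H1[OF \<xi>]])
  have lim: "(\<lambda>n. advection_bounded \<Omega> (X n) w \<theta>) \<longlonglongrightarrow> (\<integral>x. \<xi> x * (w x \<bullet> classical_grad \<theta> x) \<partial>vol)"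
    if X: "\<forall>n. X n \<in> H10 \<Omega> \<inter> L_infinity \<Omega>" "(\<lambda>n. H1_norm \<Omega> (\<lambda>x. X n x - \<xi> x)) \<longlonglongrightarrow> 0" for X
  proof -
    have Xl: "X n \<in> l2 vol" for n using X(1) H1D(1) H10_H1 by blast
    show ?thesis
      using tendsto_integral_inner[OF Xl xl wl] X(2) unfolding b[OF Xl] H1_norm_tendsto_0_iff by simp
  qed
  show ?thesis
  proof (cases "\<xi> \<in> L_infinity \<Omega>")
    case True
    then show ?thesis by (simp add: advection_def b[OF xl])
  next
    case False
    obtain \<phi> where \<phi>: "\<forall>n. \<phi> n \<in> test_functions \<Omega>" "(\<lambda>n::nat. H1_norm \<Omega> (\<lambda>x. \<phi> n x - \<xi> x)) \<longlonglongrightarrow> 0"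
      using \<xi> unfolding H10_def by blast
    have \<phi>': "\<forall>n. \<phi> n \<in> H10 \<Omega> \<inter> L_infinity \<Omega>" using \<phi>(1) test_H10 test_L_infinity by blast
    have "(THE l. \<forall>X :: nat \<Rightarrow> real^2 \<Rightarrow> real.
              (\<forall>n. X n \<in> H10 \<Omega> \<inter> L_infinity \<Omega>) \<and> (\<lambda>n. H1_norm \<Omega> (\<lambda>x. X n x - \<xi> x)) \<longlonglongrightarrow> 0
              \<longrightarrow> (\<lambda>n. advection_bounded \<Omega> (X n) w \<theta>) \<longlonglongrightarrow> l) = (\<integral>x. \<xi> x * (w x \<bullet> classical_grad \<theta> x) \<partial>vol)"
    proof (rule the_equality)
      show "\<forall>X :: nat \<Rightarrow> real^2 \<Rightarrow> real.
              (\<forall>n. X n \<in> H10 \<Omega> \<inter> L_infinity \<Omega>) \<and> (\<lambda>n. H1_norm \<Omega> (\<lambda>x. X n x - \<xi> x)) \<longlonglongrightarrow> 0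
              \<longrightarrow> (\<lambda>n. advection_bounded \<Omega> (X n) w \<theta>) \<longlonglongrightarrow> (\<integral>x. \<xi> x * (w x \<bullet> classical_grad \<theta> x) \<partial>vol)"
        using lim by blast
    next
      fix l
      assume "\<forall>X :: nat \<Rightarrow> real^2 \<Rightarrow> real.
              (\<forall>n. X n \<in> H10 \<Omega> \<inter> L_infinity \<Omega>) \<and> (\<lambda>n. H1_norm \<Omega> (\<lambda>x. X n x - \<xi> x)) \<longlonglongrightarrow> 0
              \<longrightarrow> (\<lambda>n. advection_bounded \<Omega> (X n) w \<theta>) \<longlonglongrightarrow> l"
      then have "(\<lambda>n. advection_bounded \<Omega> (\<phi> n) w \<theta>) \<longlonglongrightarrow> l" using \<phi>(2) \<phi>' by blast
      then show "l = (\<integral>x. \<xi> x * (w x \<bullet> classical_grad \<theta> x) \<partial>vol)"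
        using lim[OF \<phi>' \<phi>(2)] LIMSEQ_unique by blast
    qed
    then show ?thesis using False by (simp add: advection_def)
  qed
qed

lemma quadratic_form_smooth:
  assumes \<xi>: "\<xi> \<in> H10 \<Omega>" and \<psi>: "smooth \<psi>" and \<theta>: "\<theta> \<in> test_functions \<Omega>"
  shows "quadratic_form \<Omega> Pe a \<xi> \<psi> \<theta> = a * (l2norm vol (classical_grad \<psi>))\<^sup>2 + (l2norm vol (classical_grad \<theta>))\<^sup>2
     - Pe * (\<integral>x. \<xi> x * (perp (classical_grad \<psi> x) \<bullet> classical_grad \<theta> x) \<partial>vol)"
proof -
  note s = test_functions_smooth[OF \<theta>]
  have gp: "grad_perp \<Omega> \<psi> = (\<lambda>x. perp (grad \<Omega> \<psi> x))" by (auto simp: grad_perp_def perp_def)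
  have w: "grad_perp \<Omega> \<psi> \<in> l2 vol" unfolding gp by (intro l2_perp H1D smooth_H1 \<psi>)
  have "advection \<Omega> \<xi> (grad_perp \<Omega> \<psi>) \<theta> = (\<integral>x. \<xi> x * (grad_perp \<Omega> \<psi> x \<bullet> classical_grad \<theta> x) \<partial>vol)"
    by (rule advection_smooth[OF \<xi> w \<theta>])
  also have "\<dots> = (\<integral>x. \<xi> x * (perp (classical_grad \<psi> x) \<bullet> classical_grad \<theta> x) \<partial>vol)"
  proof (rule integral_cong_AE)
    show "AE x in vol. \<xi> x * (grad_perp \<Omega> \<psi> x \<bullet> classical_grad \<theta> x) = \<xi> x * (perp (classical_grad \<psi> x) \<bullet> classical_grad \<theta> x)"
      using smooth_H1(2)[OF \<psi>] by eventually_elim (simp add: gp)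
  qed (intro borel_measurable_times borel_measurable_inner l2_measurable l2_perp w H1D[OF H10_H1[OF \<xi>]] smooth_l2 s \<psi>)+
  finally show ?thesis
    by (simp add: quadratic_form_def dirichlet_energy_eq l2norm_grad_smooth[OF \<psi>] l2norm_grad_smooth[OF s])
qed

text \<open>If all these gradients vanished, integrating \<open>x $ 1\<close> against their first
  components would give every test function the integral 0, and the fundamental lemma would make the
  constant 1 vanish almost everywhere on a nonempty open set.\<close>

lemma exists_test_energy:
  assumes "\<Omega> \<noteq> {}"
  shows "\<exists>\<psi>\<in>test_functions \<Omega>. l2norm vol (classical_grad \<psi>) \<noteq> 0"
proof (rule ccontr)
  assume neg: "\<not> (\<exists>\<psi>\<in>test_functions \<Omega>. l2norm vol (classical_grad \<psi>) \<noteq> 0)"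
  have "AE x in vol. (1::real) = 0"
  proof (rule fundamental_lemma)
    fix \<psi> assume t: "\<psi> \<in> test_functions \<Omega>"
    note s = test_functions_smooth[OF t]
    have "AE x in vol. classical_grad \<psi> x = 0"
      using neg t by (intro l2norm_eq_0_AE smooth_l2 s) auto
    then have z: "(\<integral>x. x $ 1 * partial_deriv 1 \<psi> x \<partial>vol) = (\<integral>x. 0 \<partial>vol)"
      by (intro integral_cong_AE)
         (auto simp: vec_eq_iff intro!: borel_vol smooth_borel smooth_mult smooth_coord smooth_partial_deriv s
           elim!: eventually_mono)
    have "has_weak_gradient \<Omega> (\<lambda>x. x $ 1) (classical_grad (\<lambda>x. x $ 1))"
      using smooth_coord smooth_differentiable[OF smooth_coord]
      by (intro weak_gradient_C1 has_derivative_classical_grad smooth_classical_grad_continuous) auto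
    then have "(\<integral>x. x $ 1 * partial_deriv 1 \<psi> x \<partial>vol) = - (\<integral>x. classical_grad (\<lambda>x. x $ 1) x $ 1 * \<psi> x \<partial>vol)"
      using t unfolding has_weak_gradient_iff by blast
    then show "(\<integral>x. 1 * \<psi> x \<partial>vol) = 0"
      using z unfolding classical_grad_coord by (simp add: axis_def)
  qed simp
  then have "AE x in lborel. x \<notin> \<Omega>"
    by (simp add: AE_vol_iff)
  then have "\<Omega> \<in> null_sets lborel" by (subst AE_iff_null_sets) auto
  then have "negligible \<Omega>"
    unfolding negligible_iff_null_sets by (rule null_sets_completionI)
  then show False using open_not_negligible[OF open_dom assms] by blast
qed

end

section \<open>Fields without divergence and curl\<close>

lemma partial_deriv_eq_0I: "classical_grad f x = 0 \<Longrightarrow> partial_deriv i f x = 0"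
  using classical_grad_nth[of f x i] by (simp del: classical_grad_nth)

section \<open>Symmetry of second derivatives\<close>

lemma second_difference_mean_value:
  fixes f :: "real^2 \<Rightarrow> real"
  assumes f: "smooth f" and h: "h > 0"
  shows "\<exists>p. norm (p - x) \<le> 2 * h \<and>
    f (x + h *\<^sub>R axis i 1 + h *\<^sub>R axis j 1) - f (x + h *\<^sub>R axis i 1) - f (x + h *\<^sub>R axis j 1) + f x
      = h\<^sup>2 * partial_deriv j (partial_deriv i f) p"
proof -
  have line: "((\<lambda>s. g (y + s *\<^sub>R axis k 1)) has_real_derivative partial_deriv k g (y + s *\<^sub>R axis k 1)) (at s)"
    if g: "smooth g" for g y s and k :: 2
  proof -
    have "((\<lambda>s. y + s *\<^sub>R axis k 1) has_derivative (\<lambda>h. h *\<^sub>R axis k (1::real))) (at s)"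
      by (auto intro!: derivative_eq_intros)
    from has_derivative_compose[OF this has_derivative_classical_grad[OF smooth_differentiable[OF g]]]
    show ?thesis by (rule has_derivative_imp_has_field_derivative) (simp add: inner_axis)
  qed
  have swap: "y + s *\<^sub>R axis i 1 + t *\<^sub>R axis j 1 = y + t *\<^sub>R axis j 1 + s *\<^sub>R axis i (1::real)" for y :: "real^2" and s t
    by simp
  \<comment> \<open>The mean value theorem is applied in direction \<open>i\<close> to the
    difference in direction \<open>j\<close>, and then in direction \<open>j\<close> to the partial
    derivative that results.\<close>
  define g where "g s = f (x + h *\<^sub>R axis j 1 + s *\<^sub>R axis i 1) - f (x + s *\<^sub>R axis i 1)" for s
  have "(g has_real_derivative partial_deriv i f (x + h *\<^sub>R axis j 1 + s *\<^sub>R axis i 1)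
      - partial_deriv i f (x + s *\<^sub>R axis i 1)) (at s)" for s
    unfolding g_def by (intro DERIV_diff line f)
  from MVT2[OF h this]
  obtain s where s: "0 < s" "s < h" "g h - g 0 = (h - 0) * (partial_deriv i f (x + h *\<^sub>R axis j 1 + s *\<^sub>R axis i 1)
      - partial_deriv i f (x + s *\<^sub>R axis i 1))"
    by blast
  define k where "k t = partial_deriv i f (x + s *\<^sub>R axis i 1 + t *\<^sub>R axis j 1)" for t
  have "(k has_real_derivative partial_deriv j (partial_deriv i f) (x + s *\<^sub>R axis i 1 + t *\<^sub>R axis j 1)) (at t)" for t
    unfolding k_def by (intro line smooth_partial_deriv f)
  from MVT2[OF h this]
  obtain t where t: "0 < t" "t < h"
      "k h - k 0 = (h - 0) * partial_deriv j (partial_deriv i f) (x + s *\<^sub>R axis i 1 + t *\<^sub>R axis j 1)"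
    by blast
  have "norm (s *\<^sub>R axis i 1 + t *\<^sub>R axis j (1::real)) \<le> norm (s *\<^sub>R axis i (1::real)) + norm (t *\<^sub>R axis j (1::real))"
    by (rule norm_triangle_ineq)
  also have "\<dots> \<le> 2 * h" using s t by simp
  finally have n: "norm (x + s *\<^sub>R axis i 1 + t *\<^sub>R axis j 1 - x) \<le> 2 * h" by (simp add: add.assoc)
  have "f (x + h *\<^sub>R axis i 1 + h *\<^sub>R axis j 1) - f (x + h *\<^sub>R axis i 1) - f (x + h *\<^sub>R axis j 1) + f x = g h - g 0"
    by (simp add: g_def swap)
  also have "\<dots> = h * (k h - k 0)" using s(3) by (simp add: k_def swap)
  also have "\<dots> = h\<^sup>2 * partial_deriv j (partial_deriv i f) (x + s *\<^sub>R axis i 1 + t *\<^sub>R axis j 1)"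
    using t(3) by (simp add: power2_eq_square)
  finally show ?thesis using n by blast
qed

text \<open>The second difference over a square of side \<open>h\<close> does not change when
  \<open>i\<close> and \<open>j\<close> are exchanged; divided by \<open>h\<^sup>2\<close> it tends
  to either mixed derivative.\<close>

lemma partial_deriv_commute:
  fixes f :: "real^2 \<Rightarrow> real"
  assumes f: "smooth f"
  shows "partial_deriv j (partial_deriv i f) x = partial_deriv i (partial_deriv j f) x"
proof -
  define h where "h n = inverse (real (Suc n))" for n
  have h: "h n > 0" for n by (simp add: h_def)
  have hl: "(\<lambda>n. 2 * h n) \<longlonglongrightarrow> 0"
    unfolding h_def using tendsto_mult_right_zero[OF LIMSEQ_inverse_real_of_nat, of 2] by simp
  have lim: "\<exists>p. (\<forall>n. f (x + h n *\<^sub>R axis i 1 + h n *\<^sub>R axis j 1) - f (x + h n *\<^sub>R axis i 1) - f (x + h n *\<^sub>R axis j 1) + f x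
      = (h n)\<^sup>2 * partial_deriv j (partial_deriv i f) (p n)) \<and>
      (\<lambda>n. partial_deriv j (partial_deriv i f) (p n)) \<longlonglongrightarrow> partial_deriv j (partial_deriv i f) x" for i j
  proof -
    obtain p where p: "\<And>n. norm (p n - x) \<le> 2 * h n"
      "\<And>n. f (x + h n *\<^sub>R axis i 1 + h n *\<^sub>R axis j 1) - f (x + h n *\<^sub>R axis i 1) - f (x + h n *\<^sub>R axis j 1) + f x
        = (h n)\<^sup>2 * partial_deriv j (partial_deriv i f) (p n)"
      using second_difference_mean_value[OF f h, of x _ i j] by metis
    have "(\<lambda>n. p n - x) \<longlonglongrightarrow> 0"
      by (rule Lim_null_comparison[OF _ hl]) (use p(1) in auto)
    then have "p \<longlonglongrightarrow> x" by (simp add: LIM_zero_iff)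
    moreover have "isCont (partial_deriv j (partial_deriv i f)) x"
      using smooth_continuous_on[OF smooth_partial_deriv[OF smooth_partial_deriv[OF f]], of UNIV]
      by (simp add: continuous_on_eq_continuous_at)
    ultimately show ?thesis using p(2) isCont_tendsto_compose by blast
  qed
  obtain p where p: "\<And>n. f (x + h n *\<^sub>R axis i 1 + h n *\<^sub>R axis j 1) - f (x + h n *\<^sub>R axis i 1) - f (x + h n *\<^sub>R axis j 1) + f x
      = (h n)\<^sup>2 * partial_deriv j (partial_deriv i f) (p n)"
      "(\<lambda>n. partial_deriv j (partial_deriv i f) (p n)) \<longlonglongrightarrow> partial_deriv j (partial_deriv i f) x"
    using lim[of i j] by blast
  obtain q where q: "\<And>n. f (x + h n *\<^sub>R axis j 1 + h n *\<^sub>R axis i 1) - f (x + h n *\<^sub>R axis j 1) - f (x + h n *\<^sub>R axis i 1) + f x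
      = (h n)\<^sup>2 * partial_deriv i (partial_deriv j f) (q n)"
      "(\<lambda>n. partial_deriv i (partial_deriv j f) (q n)) \<longlonglongrightarrow> partial_deriv i (partial_deriv j f) x"
    using lim[of j i] by blast
  have swap: "x + h n *\<^sub>R axis j 1 + h n *\<^sub>R axis i 1 = x + h n *\<^sub>R axis i 1 + h n *\<^sub>R axis j (1::real)" for n by simp
  have e: "(h n)\<^sup>2 * partial_deriv j (partial_deriv i f) (p n) = (h n)\<^sup>2 * partial_deriv i (partial_deriv j f) (q n)" for n
    using p(1)[of n] q(1)[of n] unfolding swap by linarith
  then have "partial_deriv j (partial_deriv i f) (p n) = partial_deriv i (partial_deriv j f) (q n)" for n
    using e[of n] h[of n] by simp
  then show ?thesis using p(2) q(2) LIMSEQ_unique by simp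
qed

text \<open>Boundedness of the kernel makes the product integrable on the product space. The lemma
  serves to exchange a mollification with an integral, once over \<Omega> twice and once over a
  segment and \<Omega>.\<close>

lemma Fubini_kernel:
  fixes f :: "'a \<Rightarrow> real" and g :: "'b \<Rightarrow> real" and k :: "'a \<Rightarrow> 'b \<Rightarrow> real"
  assumes "sigma_finite_measure M1" "sigma_finite_measure M2" and f: "integrable M1 f" and g: "integrable M2 g"
    and k [measurable]: "(\<lambda>(x, y). k x y) \<in> borel_measurable (M1 \<Otimes>\<^sub>M M2)"
    and K: "\<And>x y. x \<in> space M1 \<Longrightarrow> y \<in> space M2 \<Longrightarrow> \<bar>k x y\<bar> \<le> K"
  shows "(\<integral>x. f x * (\<integral>y. g y * k x y \<partial>M2) \<partial>M1) = (\<integral>y. g y * (\<integral>x. f x * k x y \<partial>M1) \<partial>M2)"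
proof -
  interpret M1: sigma_finite_measure M1 by fact
  interpret M2: sigma_finite_measure M2 by fact
  interpret P: pair_sigma_finite M1 M2 ..
  have [measurable]: "f \<in> borel_measurable M1" "g \<in> borel_measurable M2" using f g by auto
  have "integrable (M1 \<Otimes>\<^sub>M M2) (\<lambda>p. f (fst p) * (g (snd p) * K))"
  proof (rule P.Fubini_integrable)
    show "integrable M1 (\<lambda>x. \<integral>y. norm (f (fst (x, y)) * (g (snd (x, y)) * K)) \<partial>M2)"
      using f by (simp add: abs_mult)
    show "AE x in M1. integrable M2 (\<lambda>y. f (fst (x, y)) * (g (snd (x, y)) * K))"
      using g by simp
  qed measurable
  then have "integrable (M1 \<Otimes>\<^sub>M M2) (\<lambda>p. f (fst p) * (g (snd p) * (case p of (x, y) \<Rightarrow> k x y)))"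
  proof (rule Bochner_Integration.integrable_bound)
    show "AE p in M1 \<Otimes>\<^sub>M M2. norm (f (fst p) * (g (snd p) * (case p of (x, y) \<Rightarrow> k x y)))
        \<le> norm (f (fst p) * (g (snd p) * K))"
    proof (rule AE_I2)
      fix p assume "p \<in> space (M1 \<Otimes>\<^sub>M M2)"
      then have "\<bar>k (fst p) (snd p)\<bar> \<le> \<bar>K\<bar>" using K[of "fst p" "snd p"] by (auto simp: space_pair_measure)
      then show "norm (f (fst p) * (g (snd p) * (case p of (x, y) \<Rightarrow> k x y))) \<le> norm (f (fst p) * (g (snd p) * K))"
        by (simp add: abs_mult case_prod_unfold mult_left_mono)
    qed
  qed measurable
  moreover have "(\<lambda>p. f (fst p) * (g (snd p) * (case p of (x, y) \<Rightarrow> k x y))) = (\<lambda>(x, y). f x * (g y * k x y))"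
    by auto
  ultimately have "integrable (M1 \<Otimes>\<^sub>M M2) (\<lambda>(x, y). f x * (g y * k x y))" by simp
  from P.Fubini_integral[OF this] have "(\<integral>y. (\<integral>x. f x * (g y * k x y) \<partial>M1) \<partial>M2) = (\<integral>x. (\<integral>y. f x * (g y * k x y) \<partial>M2) \<partial>M1)" .
  moreover have "(\<integral>x. f x * (g y * k x y) \<partial>M1) = g y * (\<integral>x. f x * k x y \<partial>M1)" for y
  proof -
    have "(\<integral>x. f x * (g y * k x y) \<partial>M1) = (\<integral>x. g y * (f x * k x y) \<partial>M1)"
      by (intro Bochner_Integration.integral_cong) (auto simp: ac_simps)
    then show ?thesis by simp
  qed
  ultimately show ?thesis by simp
qed

section \<open>Radial kernels\<close>

definition bump :: "real \<Rightarrow> real" where "bump s = step ((-2) * s + 2)"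

lemma smooth1_bump: "smooth1 bump"
  unfolding bump_def[abs_def] by (intro smooth1_affine smooth1_step)

lemma bump_bounds: "0 \<le> bump s" "bump s \<le> 1" "s \<le> 1/2 \<Longrightarrow> bump s = 1" "s \<ge> 1 \<Longrightarrow> bump s = 0"
  by (auto simp: bump_def step_nonneg step_le_1 step_eq_0 step_eq_1)

lemma deriv_bump_eq_0:
  assumes "s > 1" shows "deriv bump s = 0"
proof -
  have "(bump has_real_derivative 0) (at s)"
    by (rule has_field_derivative_transform_within_open[where S="{1<..}" and f="\<lambda>x. 0"])
       (use assms in \<open>auto simp: bump_bounds\<close>)
  then show ?thesis by (rule DERIV_imp_deriv)
qed

text \<open>The derivative of \<open>bump\<close> vanishes beyond 1, and on \<open>{0..1}\<close>
  continuity suffices. This product appears when a radial kernel is differentiated with respect to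
  its dilation.\<close>

lemma deriv_bump_bounded: "\<exists>L. \<forall>s\<ge>0. \<bar>s * deriv bump s\<bar> \<le> L"
proof -
  have "compact {0..1::real}" by simp
  then have "bounded ((\<lambda>s. s * deriv bump s) ` {0..1})"
    by (intro compact_imp_bounded compact_continuous_image continuous_intros smooth1_continuous smooth1_deriv smooth1_bump)
  then obtain L where L: "L > 0" "\<forall>y\<in>(\<lambda>s. s * deriv bump s) ` {0..1}. norm y \<le> L" using bounded_pos by blast
  then have "\<bar>s * deriv bump s\<bar> \<le> L" if "s \<ge> 0" for s
    using that deriv_bump_eq_0[of s] by (cases "s \<le> 1") auto
  then show ?thesis by blast
qed

text \<open>The support lies in the ball of radius \<open>1 / sqrt l\<close>, and in the plane the
  factor \<open>l\<close> is the one that keeps the mass constant under dilation. The squared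
  distance as argument makes the kernel smooth at the origin.\<close>

definition radial_kernel :: "real \<Rightarrow> real^2 \<Rightarrow> real" where
  "radial_kernel l y = l * bump (l * (y \<bullet> y))"

definition radial_mass :: "real \<Rightarrow> real" where
  "radial_mass l = (\<integral>y. radial_kernel l y \<partial>lborel)"

lemma smooth_sqdist: "smooth (\<lambda>z. (z - x) \<bullet> (z - x))"
proof -
  have "smooth (\<lambda>z. (z $ 1 + (- x $ 1)) * (z $ 1 + (- x $ 1)) + (z $ 2 + (- x $ 2)) * (z $ 2 + (- x $ 2)))"
    by (intro smooth_add smooth_mult smooth_coord smooth_const)
  then show ?thesis by (simp add: inner_vec2)
qed

lemma smooth_bump_sqdist: "smooth (\<lambda>z. bump (l * ((z - x) \<bullet> (z - x))))"
  by (intro smooth_smooth1[OF _ smooth1_bump] smooth_mult smooth_const smooth_sqdist)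

lemma classical_grad_bump_sqdist:
  "classical_grad (\<lambda>z. bump (l * ((z - x) \<bullet> (z - x)))) z = (2 * l * deriv bump (l * ((z - x) \<bullet> (z - x)))) *\<^sub>R (z - x)"
proof (rule classical_grad_eqI)
  have "((\<lambda>z. l * ((z - x) \<bullet> (z - x))) has_derivative (\<lambda>h. l * (2 * ((z - x) \<bullet> h)))) (at z)"
    by (auto intro!: derivative_eq_intros simp: inner_commute algebra_simps)
  from has_derivative_compose[OF this smooth1_DERIV[OF smooth1_bump, unfolded has_field_derivative_def]]
  show "((\<lambda>z. bump (l * ((z - x) \<bullet> (z - x)))) has_derivative (\<bullet>) ((2 * l * deriv bump (l * ((z - x) \<bullet> (z - x)))) *\<^sub>R (z - x))) (at z)"
    by (rule has_derivative_eq_rhs) (simp add: fun_eq_iff ac_simps)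
qed

lemma smooth_radial_kernel: "smooth (\<lambda>z. radial_kernel l (z - x))"
  unfolding radial_kernel_def by (intro smooth_mult smooth_const smooth_bump_sqdist)

lemma radial_kernel_nonneg: "l \<ge> 0 \<Longrightarrow> 0 \<le> radial_kernel l y"
  and radial_kernel_le: "l \<ge> 0 \<Longrightarrow> radial_kernel l y \<le> l"
  by (simp_all add: radial_kernel_def bump_bounds mult_left_le)

lemma radial_kernel_eq_0:
  assumes "r > 0" "l \<ge> 1 / r\<^sup>2" "norm y \<ge> r"
  shows "bump (l * (y \<bullet> y)) = 0" "radial_kernel l y = 0"
proof -
  have "1 / r\<^sup>2 * r\<^sup>2 \<le> l * (norm y)\<^sup>2"
    using assms by (intro mult_mono power_mono) (auto intro: order_trans[OF _ assms(2)])
  then have "1 \<le> l * (y \<bullet> y)" using assms(1) by (simp add: power2_norm_eq_inner)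
  then show "bump (l * (y \<bullet> y)) = 0" "radial_kernel l y = 0" by (simp_all add: radial_kernel_def bump_bounds)
qed

lemma radial_kernel_borel [measurable]: "radial_kernel l \<in> borel_measurable borel"
  using smooth_borel[OF smooth_radial_kernel[of l 0]] by simp

lemma radial_kernel_integrable:
  assumes "l > 0" shows "integrable lborel (radial_kernel l)"
proof (rule integrable_continuous_compact_support[of _ "cball 0 (1 / sqrt l)"])
  show "continuous_on UNIV (radial_kernel l)"
    using smooth_continuous_on[OF smooth_radial_kernel[of l 0]] by simp
  fix x :: "real^2" assume "x \<notin> cball 0 (1 / sqrt l)"
  then show "radial_kernel l x = 0"
    using assms by (intro radial_kernel_eq_0[of "1 / sqrt l"]) (auto simp: power_divide)
qed simp

lemma radial_mass_pos:
  assumes "l > 0" shows "radial_mass l > 0"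
proof -
  \<comment> \<open>Within this radius \<open>l * (y \<bullet> y)\<close> is at most 1/2, where
    \<open>bump\<close> is 1.\<close>
  define r where "r = 1 / sqrt (2 * l)"
  have r: "r > 0" using assms by (simp add: r_def)
  have "0 < l * measure lborel (ball (0::real^2) r)"
    using assms content_ball_pos[OF r, of "0::real^2"] by simp
  also have "l * measure lborel (ball (0::real^2) r) = (\<integral>y. l * indicator (ball 0 r) y \<partial>(lborel :: (real^2) measure))"
    by simp
  also have "\<dots> \<le> radial_mass l"
    unfolding radial_mass_def
  proof (rule integral_mono[OF _ radial_kernel_integrable[OF assms]])
    have "emeasure lborel (ball (0::real^2) r) < \<infinity>" by (rule emeasure_bounded_finite) simp
    then show "integrable lborel (\<lambda>y::real^2. l * indicator (ball 0 r) y)" by simp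
    fix y :: "real^2"
    show "l * indicator (ball 0 r) y \<le> radial_kernel l y"
    proof (cases "y \<in> ball 0 r")
      case True
      then have "(norm y)\<^sup>2 \<le> r\<^sup>2" by (intro power_mono) auto
      also have "r\<^sup>2 = 1 / (2 * l)" using assms by (simp add: r_def power_divide)
      finally have "l * (y \<bullet> y) \<le> 1/2" using assms by (simp add: power2_norm_eq_inner field_simps)
      then show ?thesis using True by (simp add: radial_kernel_def bump_bounds)
    qed (use assms in \<open>simp add: radial_kernel_nonneg\<close>)
  qed
  finally show ?thesis .
qed

context planar_domain
begin

text \<open>Weyl's lemma for the pair of equations \<open>div v = 0\<close>, \<open>curl v = 0\<close>: the derivative in \<open>l\<close> of the
  radial kernel times a constant vector is \<open>\<nabla>\<alpha> + \<nabla>\<^sup>\<bottom>\<beta>\<close> with \<open>\<alpha>\<close>, \<open>\<beta>\<close> compactly supported, so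
  radial averages do not depend on the radius.\<close>

definition radial_average :: "(real^2 \<Rightarrow> real^2) \<Rightarrow> 2 \<Rightarrow> real \<Rightarrow> real^2 \<Rightarrow> real" where
  "radial_average v i l x = (\<integral>z. v z $ i * radial_kernel l (z - x) \<partial>vol)"

definition harmonic_field :: "(real^2 \<Rightarrow> real^2) \<Rightarrow> bool" where
  "harmonic_field v \<longleftrightarrow> v \<in> l2 vol \<and> (\<forall>\<alpha>\<in>test_functions \<Omega>.
     (\<integral>z. v z \<bullet> classical_grad \<alpha> z \<partial>vol) = 0 \<and> (\<integral>z. v z \<bullet> perp (classical_grad \<alpha> z) \<partial>vol) = 0)"

text \<open>The condition on \<open>l\<close> puts the support of the kernel into
  \<open>cball x r\<close>, so the auxiliary functions \<open>\<alpha> j\<close> are test functions,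
  and both weak equations can be applied to them.\<close>

lemma radial_average_DERIV:
  assumes v: "harmonic_field v" and r: "r > 0" "cball x r \<subseteq> \<Omega>" and l: "l > 1 / r\<^sup>2"
  shows "((\<lambda>l. radial_average v i l x) has_real_derivative 0) (at l)"
proof -
  have vl: "v \<in> l2 vol" using v by (simp add: harmonic_field_def)
  define s where "s z = (z - x) \<bullet> (z - x)" for z
  have s0: "s z \<ge> 0" for z by (simp add: s_def)
  define N where "N z = bump (l * s z)" for z
  define \<alpha> where "\<alpha> j z = (z $ j + (- x $ j)) * N z" for j z
  have Ns: "smooth N" unfolding N_def s_def by (rule smooth_bump_sqdist)
  have cs: "smooth (\<lambda>z. z $ j + (- x $ j))" for j by (intro smooth_add smooth_coord smooth_const)
  have \<alpha>s: "smooth (\<alpha> j)" for j unfolding \<alpha>_def by (intro smooth_mult cs Ns)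
  have \<alpha>t: "\<alpha> j \<in> test_functions \<Omega>" for j
  proof (rule test_functionsI[OF \<alpha>s _ r(2)])
    fix z assume "z \<notin> cball x r"
    then have "norm (z - x) \<ge> r" by (simp add: dist_norm norm_minus_commute)
    then show "\<alpha> j z = 0"
      using radial_kernel_eq_0(1)[OF r(1), of l "z - x"] l by (simp add: \<alpha>_def N_def s_def)
  qed simp
  define d where "d z = 2 * l * deriv bump (l * s z)" for z
  have gN: "classical_grad N z = d z *\<^sub>R (z - x)" for z
    unfolding N_def s_def d_def by (rule classical_grad_bump_sqdist)
  have g\<alpha>: "classical_grad (\<alpha> j) z = (z $ j - x $ j) *\<^sub>R (d z *\<^sub>R (z - x)) + N z *\<^sub>R axis j 1" for j z
  proof -
    have "classical_grad (\<lambda>z. z $ j + (- x $ j)) z = axis j 1"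
      by (simp only: classical_grad_add[OF smooth_differentiable[OF smooth_coord] smooth_differentiable[OF smooth_const]]
          classical_grad_coord classical_grad_const add_0_right)
    then show ?thesis
      unfolding \<alpha>_def using classical_grad_mult[OF smooth_differentiable[OF cs] smooth_differentiable[OF Ns], of j z]
      by (simp add: gN)
  qed
  \<comment> \<open>\<open>w\<close> is the derivative of \<open>l * bump (l * s z)\<close> in
    \<open>l\<close>. The gradient of \<open>\<alpha> 1\<close> plus the rotated gradient of
    \<open>\<alpha> 2\<close> is \<open>2 * w z\<close> times the first unit vector, because the
    terms with mixed coordinates cancel; exchanging the roles with a minus sign gives the second
    unit vector.\<close>
  define w where "w z = N z + l * s z * deriv bump (l * s z)" for z
  have sz: "s z = (z $ 1 - x $ 1) * (z $ 1 - x $ 1) + (z $ 2 - x $ 2) * (z $ 2 - x $ 2)" for z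
    by (simp add: s_def inner_vec2)
  have id1: "v z \<bullet> classical_grad (\<alpha> 1) z + v z \<bullet> perp (classical_grad (\<alpha> 2) z) = 2 * (v z $ 1 * w z)" for z
    by (simp add: inner_vec2 g\<alpha> w_def d_def sz axis_def) (simp add: algebra_simps)
  have id2: "v z \<bullet> classical_grad (\<alpha> 2) z - v z \<bullet> perp (classical_grad (\<alpha> 1) z) = 2 * (v z $ 2 * w z)" for z
    by (simp add: inner_vec2 g\<alpha> w_def d_def sz axis_def) (simp add: algebra_simps)
  have i: "integrable vol (\<lambda>z. v z \<bullet> classical_grad (\<alpha> j) z)" "integrable vol (\<lambda>z. v z \<bullet> perp (classical_grad (\<alpha> j) z))" for j
    by (intro l2_inner vl l2_perp smooth_l2 \<alpha>s)+
  have z: "(\<integral>z. v z \<bullet> classical_grad (\<alpha> j) z \<partial>vol) = 0" "(\<integral>z. v z \<bullet> perp (classical_grad (\<alpha> j) z) \<partial>vol) = 0" for j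
    using v \<alpha>t[of j] by (auto simp: harmonic_field_def)
  have "(\<integral>z. 2 * (v z $ 1 * w z) \<partial>vol) = 0" unfolding id1[symmetric] using i z by simp
  moreover have "(\<integral>z. 2 * (v z $ 2 * w z) \<partial>vol) = 0" unfolding id2[symmetric] using i z by simp
  ultimately have int0: "(\<integral>z. v z $ i * w z \<partial>vol) = 0"
    using exhaust_2[of i] by auto
  obtain L where L: "\<And>s. s \<ge> 0 \<Longrightarrow> \<bar>s * deriv bump s\<bar> \<le> L" using deriv_bump_bounded by blast
  have m: "(\<lambda>z. bump (c * s z) + c * s z * deriv bump (c * s z)) \<in> borel_measurable borel" for c
    using smooth_bump_sqdist[of c x]
    by (intro smooth_borel smooth_add smooth_mult smooth_const smooth_smooth1[OF _ smooth1_deriv[OF smooth1_bump]])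
       (auto simp: s_def intro!: smooth_sqdist smooth_mult smooth_const)
  have "((\<lambda>l. \<integral>z. v z $ i * radial_kernel l (z - x) \<partial>vol) has_real_derivative (\<integral>z. v z $ i * w z \<partial>vol)) (at l)"
    unfolding w_def N_def
  \<comment> \<open>The upper end of the interval provides the bound for the kernel.\<close>
  proof (rule DERIV_integral_param[where S="{0<..<2*l}" and K="1 + L" and L="2 * l"
        and F'="\<lambda>l z. bump (l * s z) + l * s z * deriv bump (l * s z)"])
    show "integrable vol (\<lambda>z. v z $ i)" by (intro vol.l2_integrable l2_nth vl)
    have "l > 0" using l r(1) by (meson divide_pos_pos less_trans zero_less_one zero_less_power)
    then show "l \<in> {0<..<2*l}" by simp
    fix t z assume t: "t \<in> {0<..<2*l}"
    show "((\<lambda>l. radial_kernel l (z - x)) has_real_derivative bump (t * s z) + t * s z * deriv bump (t * s z)) (at t)"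
    proof -
      have "((\<lambda>l. bump (l * s z)) has_real_derivative deriv bump (t * s z) * s z) (at t)"
        by (rule DERIV_chain2[OF smooth1_DERIV[OF smooth1_bump]]) (auto intro!: derivative_eq_intros)
      from DERIV_mult[OF DERIV_ident this] show ?thesis
        unfolding radial_kernel_def s_def[symmetric] by (simp add: algebra_simps)
    qed
    have "\<bar>bump (t * s z)\<bar> \<le> 1" using bump_bounds(1,2) by (simp add: abs_le_iff)
    then show "\<bar>bump (t * s z) + t * s z * deriv bump (t * s z)\<bar> \<le> 1 + L"
      using L[of "t * s z"] t s0[of z] abs_triangle_ineq[of "bump (t * s z)" "t * s z * deriv bump (t * s z)"] by simp
    show "\<bar>radial_kernel t (z - x)\<bar> \<le> 2 * l"
      using radial_kernel_nonneg[of t "z - x"] radial_kernel_le[of t "z - x"] t by simp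
  qed (auto intro!: borel_vol m smooth_borel smooth_radial_kernel)
  then show ?thesis unfolding radial_average_def int0 .
qed

lemma radial_average_const:
  assumes v: "harmonic_field v" and r: "r > 0" "cball x r \<subseteq> \<Omega>" and l: "l > 1 / r\<^sup>2" "m > 1 / r\<^sup>2"
  shows "radial_average v i l x = radial_average v i m x"
proof -
  have "\<exists>c. \<forall>l\<in>{1 / r\<^sup>2<..}. radial_average v i l x = c"
  proof (rule has_field_derivative_zero_constant)
    show "((\<lambda>l. radial_average v i l x) has_real_derivative 0) (at l within {1 / r\<^sup>2<..})" if "l \<in> {1 / r\<^sup>2<..}" for l
      using radial_average_DERIV[OF v r, of l i] that by (auto intro: has_field_derivative_at_within)
  qed simp
  then show ?thesis using l by auto
qed

lemma harmonic_field_const: "harmonic_field (\<lambda>z. axis 1 1)"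
  unfolding harmonic_field_def
proof (intro conjI ballI)
  show "(\<lambda>z. axis 1 1) \<in> l2 vol" by (intro continuous_l2 continuous_intros)
  fix \<alpha> assume t: "\<alpha> \<in> test_functions \<Omega>"
  obtain K where K: "smooth \<alpha>" "compact K" "K \<subseteq> \<Omega>" "\<And>x. x \<notin> K \<Longrightarrow> \<alpha> x = 0"
    "\<And>x. x \<notin> K \<Longrightarrow> classical_grad \<alpha> x = 0"
    using t by (rule test_functionsE) blast
  have z: "(\<integral>z. partial_deriv j \<alpha> z \<partial>vol) = 0" for j
  proof -
    have "partial_deriv j \<alpha> x = 0" if "x \<notin> \<Omega>" for x
      using K(3) that by (intro partial_deriv_eq_0I K(5)) auto
    then have "(\<integral>z. partial_deriv j \<alpha> z \<partial>vol) = (\<integral>z. partial_deriv j \<alpha> z \<partial>lborel)" by (rule vol_integral_eq)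
    also have "\<dots> = 0"
      by (rule integral_partial_deriv_eq_0[OF smooth_differentiable[OF K(1)] smooth_continuous_on[OF smooth_partial_deriv[OF K(1)]] K(2,4)])
    finally show ?thesis .
  qed
  show "(\<integral>z. axis 1 1 \<bullet> classical_grad \<alpha> z \<partial>vol) = 0" using z[of 1] by (simp add: inner_axis')
  show "(\<integral>z. axis 1 1 \<bullet> perp (classical_grad \<alpha> z) \<partial>vol) = 0" using z[of 2] by (simp add: inner_axis')
qed

lemma radial_average_axis:
  assumes r: "r > 0" "cball x r \<subseteq> \<Omega>" and l: "l > 1 / r\<^sup>2"
  shows "radial_average (\<lambda>z. axis 1 1) 1 l x = radial_mass l"
proof -
  have "radial_average (\<lambda>z. axis 1 1) 1 l x = (\<integral>z. radial_kernel l (z - x) \<partial>vol)"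
    by (simp add: radial_average_def axis_def)
  also have "\<dots> = (\<integral>z. radial_kernel l (z - x) \<partial>lborel)"
  proof (rule vol_integral_eq)
    fix z assume "z \<notin> \<Omega>"
    then have "z \<notin> cball x r" using r by auto
    then have "norm (z - x) \<ge> r" by (simp add: dist_norm norm_minus_commute)
    then show "radial_kernel l (z - x) = 0" using radial_kernel_eq_0(2)[OF r(1)] l by simp
  qed
  also have "\<dots> = (\<integral>z. radial_kernel l (- x + z) \<partial>lborel)" by (simp add: add.commute)
  also have "\<dots> = radial_mass l" unfolding radial_mass_def by (rule lborel_integral_translation) measurable
  finally show ?thesis .
qed

lemma radial_mean_const:
  assumes v: "harmonic_field v" and r: "r > 0" "cball x r \<subseteq> \<Omega>" and l: "l > 1 / r\<^sup>2"
    and r': "r' > 0" "cball x r' \<subseteq> \<Omega>" and l': "l' > 1 / r'\<^sup>2"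
  shows "radial_average v i l x / radial_mass l = radial_average v i l' x / radial_mass l'"
proof -
  define m where "m = max l l'"
  have m: "m > 1 / r\<^sup>2" "m > 1 / r'\<^sup>2" using l l' by (auto simp: m_def)
  have "radial_mass l = radial_mass m" "radial_mass l' = radial_mass m"
    using radial_average_const[OF harmonic_field_const r l m(1), of 1]
      radial_average_const[OF harmonic_field_const r' l' m(2), of 1]
    by (simp_all add: radial_average_axis[OF r l] radial_average_axis[OF r m(1)]
        radial_average_axis[OF r' l'] radial_average_axis[OF r' m(2)])
  then show ?thesis
    using radial_average_const[OF v r l m(1), of i] radial_average_const[OF v r' l' m(2), of i] by simp
qed

end

section \<open>Continuity of fields without divergence and curl\<close>

lemma radial_kernel_support:
  assumes "l > 0" "radial_kernel l y \<noteq> 0"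
  shows "norm y < 1 / sqrt l"
proof (rule ccontr)
  assume "\<not> norm y < 1 / sqrt l"
  then have "radial_kernel l y = 0"
    using assms(1) by (intro radial_kernel_eq_0(2)[of "1 / sqrt l"]) (auto simp: power_divide)
  then show False using assms(2) by simp
qed

text \<open>The closed \<open>d\<close>-neighbourhood of a compact set is its Minkowski sum with a
  closed ball, hence compact.\<close>

lemma compact_in_open_margin:
  fixes K :: "'a::euclidean_space set"
  assumes "compact K" "open U" "K \<subseteq> U"
  obtains d K' where "d > 0" "compact K'" "K' \<subseteq> U" "\<And>x y. x \<in> K \<Longrightarrow> dist x y \<le> d \<Longrightarrow> y \<in> K'"
proof -
  obtain d where d: "d > 0" "(\<Union>x\<in>K. cball x d) \<subseteq> U"
    using compact_subset_open_imp_cball_epsilon_subset[OF assms] by blast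
  have "(\<Union>x\<in>K. cball x d) = {x + y | x y. x \<in> K \<and> y \<in> cball 0 d}"
  proof safe
    fix x y assume "x \<in> K" "y \<in> cball x d"
    then show "\<exists>x' y'. y = x' + y' \<and> x' \<in> K \<and> y' \<in> cball 0 d"
      by (intro exI[of _ x] exI[of _ "y - x"]) (auto simp: dist_norm norm_minus_commute)
  next
    fix x y :: 'a assume "x \<in> K" "y \<in> cball 0 d"
    then show "x + y \<in> (\<Union>x\<in>K. cball x d)" by (intro UN_I[of x]) (auto simp: dist_norm)
  qed
  then have "compact (\<Union>x\<in>K. cball x d)" using compact_sums[OF assms(1) compact_cball[of 0 d]] by (simp only:)
  then show thesis using d by (intro that[of d "\<Union>x\<in>K. cball x d"]) auto
qed

context planar_domain
begin

lemma isCont_radial_average: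
  assumes v: "v \<in> l2 vol" and l: "l > 0"
  shows "isCont (radial_average v i l) x"
  unfolding continuous_at_sequentially comp_def
proof (intro allI impI)
  fix X :: "nat \<Rightarrow> real^2" assume X: "X \<longlonglongrightarrow> x"
  show "(\<lambda>n. radial_average v i l (X n)) \<longlonglongrightarrow> radial_average v i l x"
    unfolding radial_average_def
  proof (rule integral_dominated_convergence[where w="\<lambda>z. norm (v z $ i) * l"])
    have vi: "integrable vol (\<lambda>z. v z $ i)" by (intro vol.l2_integrable l2_nth v)
    then show "integrable vol (\<lambda>z. norm (v z $ i) * l)" by simp
    show "(\<lambda>z. v z $ i * radial_kernel l (z - x)) \<in> borel_measurable vol" for x
      by (intro borel_measurable_times borel_measurable_integrable[OF vi] borel_vol smooth_borel smooth_radial_kernel)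
    then show "(\<lambda>z. v z $ i * radial_kernel l (z - X n)) \<in> borel_measurable vol" for n .
    show "AE z in vol. norm (v z $ i * radial_kernel l (z - X n)) \<le> norm (v z $ i) * l" for n
      using radial_kernel_nonneg[of l] radial_kernel_le[of l] l by (auto simp: abs_mult intro!: mult_left_mono)
    have c: "isCont (radial_kernel l) y" for y
      using smooth_continuous_on[OF smooth_radial_kernel[of l 0], of UNIV] by (simp add: continuous_on_eq_continuous_at)
    have "(\<lambda>n. radial_kernel l (z - X n)) \<longlonglongrightarrow> radial_kernel l (z - x)" for z
      by (rule isCont_tendsto_compose[OF c]) (intro tendsto_intros X)
    then show "AE z in vol. (\<lambda>n. v z $ i * radial_kernel l (z - X n)) \<longlonglongrightarrow> v z $ i * radial_kernel l (z - x)"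
      by (auto intro!: tendsto_intros)
  qed
qed

lemma test_function_lipschitz:
  assumes "\<phi> \<in> test_functions \<Omega>"
  obtains L where "L > 0" "\<And>x y. \<bar>\<phi> x - \<phi> y\<bar> \<le> L * norm (x - y)"
proof -
  obtain L where L: "L > 0" "\<And>x. norm (classical_grad \<phi> x) \<le> L"
    using test_functions_bounded(2)[OF assms] by blast
  have "norm (\<phi> x - \<phi> y) \<le> L * norm (x - y)" for x y
  proof (rule differentiable_bound[OF convex_UNIV])
    show "(\<phi> has_derivative (\<lambda>h. classical_grad \<phi> x \<bullet> h)) (at x within UNIV)" for x
      using has_derivative_classical_grad[OF smooth_differentiable[OF test_functions_smooth[OF assms]]] by simp
    show "onorm (\<lambda>h. classical_grad \<phi> x \<bullet> h) \<le> L" for x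
    proof (rule onorm_le)
      fix h
      have "norm (classical_grad \<phi> x \<bullet> h) \<le> norm (classical_grad \<phi> x) * norm h"
        by (simp add: Cauchy_Schwarz_ineq2)
      also have "\<dots> \<le> L * norm h" using L(2) by (intro mult_right_mono) auto
      finally show "norm (classical_grad \<phi> x \<bullet> h) \<le> L * norm h" .
    qed
  qed auto
  then show thesis using that L(1) by simp
qed

text \<open>The kernel is even, nonnegative and supported within distance \<open>1 / sqrt l\<close>,
  so the error is at most the oscillation of \<phi> on that scale.\<close>

lemma radial_mollification_error:
  assumes L: "\<And>x y. \<bar>\<phi> x - \<phi> y\<bar> \<le> L * norm (x - y)" "L > 0" and \<phi>: "\<phi> \<in> test_functions \<Omega>" and l: "l > 0"
  shows "\<bar>(\<integral>x. \<phi> x * radial_kernel l (z - x) \<partial>vol) / radial_mass l - \<phi> z\<bar> \<le> L / sqrt l"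
proof -
  obtain K where K: "smooth \<phi>" "compact K" "K \<subseteq> \<Omega>" "\<And>x. x \<notin> K \<Longrightarrow> \<phi> x = 0"
    using \<phi> by (rule test_functionsE) blast
  have sym: "radial_kernel l (z - x) = radial_kernel l (x - z)" for x
    by (simp add: radial_kernel_def inner_diff inner_commute algebra_simps)
  have ki: "integrable lborel (\<lambda>x. radial_kernel l (x - z))"
  proof (rule integrable_continuous_compact_support[of _ "cball z (1 / sqrt l)"])
    show "continuous_on UNIV (\<lambda>x. radial_kernel l (x - z))" by (rule smooth_continuous_on[OF smooth_radial_kernel])
    show "radial_kernel l (x - z) = 0" if "x \<notin> cball z (1 / sqrt l)" for x
      using radial_kernel_support[OF l, of "x - z"] that by (auto simp: dist_norm norm_minus_commute)
  qed simp
  have mass: "(\<integral>x. radial_kernel l (x - z) \<partial>lborel) = radial_mass l"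
    using lborel_integral_translation[of "radial_kernel l" "- z"] by (simp add: radial_mass_def add.commute)
  have \<phi>i: "integrable lborel (\<lambda>x. \<phi> x * radial_kernel l (x - z))"
    by (rule integrable_continuous_compact_support[OF smooth_continuous_on[OF smooth_mult[OF K(1) smooth_radial_kernel]] K(2)])
       (use K(4) in auto)
  have "(\<integral>x. \<phi> x * radial_kernel l (z - x) \<partial>vol) = (\<integral>x. \<phi> x * radial_kernel l (x - z) \<partial>lborel)"
    unfolding sym using K(3,4) by (intro vol_integral_eq) auto
  also have "\<dots> = (\<integral>x. (\<phi> x - \<phi> z) * radial_kernel l (x - z) \<partial>lborel) + \<phi> z * radial_mass l"
    using \<phi>i ki by (simp add: left_diff_distrib mass)
  finally have eq: "(\<integral>x. \<phi> x * radial_kernel l (z - x) \<partial>vol) - \<phi> z * radial_mass l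
      = (\<integral>x. (\<phi> x - \<phi> z) * radial_kernel l (x - z) \<partial>lborel)" by simp
  have "\<bar>\<integral>x. (\<phi> x - \<phi> z) * radial_kernel l (x - z) \<partial>lborel\<bar> \<le> (\<integral>x. L / sqrt l * radial_kernel l (x - z) \<partial>lborel)"
  proof (rule integral_abs_bound_integral)
    show "integrable lborel (\<lambda>x. (\<phi> x - \<phi> z) * radial_kernel l (x - z))"
      using \<phi>i ki by (simp add: left_diff_distrib)
    show "integrable lborel (\<lambda>x. L / sqrt l * radial_kernel l (x - z))" using ki by simp
    fix x
    show "\<bar>(\<phi> x - \<phi> z) * radial_kernel l (x - z)\<bar> \<le> L / sqrt l * radial_kernel l (x - z)"
    proof (cases "radial_kernel l (x - z) = 0")
      case False
      have "\<bar>\<phi> x - \<phi> z\<bar> \<le> L * norm (x - z)" by (rule L)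
      also have "\<dots> \<le> L * (1 / sqrt l)" using radial_kernel_support[OF l False] L(2) by (intro mult_left_mono) auto
      finally have "\<bar>\<phi> x - \<phi> z\<bar> * radial_kernel l (x - z) \<le> L * (1 / sqrt l) * radial_kernel l (x - z)"
        using radial_kernel_nonneg[of l "x - z"] l by (intro mult_right_mono) auto
      then show ?thesis
        using radial_kernel_nonneg[of l "x - z"] l by (simp add: abs_mult)
    qed simp
  qed
  also have "\<dots> = L / sqrt l * radial_mass l" by (simp add: mass)
  finally have "\<bar>(\<integral>x. \<phi> x * radial_kernel l (z - x) \<partial>vol) - \<phi> z * radial_mass l\<bar> \<le> L / sqrt l * radial_mass l"
    by (simp only: eq)
  moreover have "(\<integral>x. \<phi> x * radial_kernel l (z - x) \<partial>vol) / radial_mass l - \<phi> z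
     = ((\<integral>x. \<phi> x * radial_kernel l (z - x) \<partial>vol) - \<phi> z * radial_mass l) / radial_mass l"
    using radial_mass_pos[OF l] by (simp add: field_simps)
  ultimately show ?thesis using radial_mass_pos[OF l] by (simp add: abs_divide pos_divide_le_eq)
qed

text \<open>The common value \<open>W\<close> of the normalised radial averages is continuous, since
  one kernel serves a whole neighbourhood. It equals \<open>v\<close> almost everywhere: when it is
  tested with \<phi>, Fubini moves the kernel to \<phi>, and the mollified \<phi> tends uniformly to
  \<phi> while the tested value does not depend on \<open>l\<close>.\<close>

lemma harmonic_field_continuous:
  assumes v: "harmonic_field v"
  obtains V where "continuous_on \<Omega> V" "AE x in vol. V x = v x"
proof -
  have vl: "v \<in> l2 vol" using v by (simp add: harmonic_field_def)
  have vi: "integrable vol (\<lambda>z. v z $ i)" for i by (intro vol.l2_integrable l2_nth vl)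
  define \<rho> where "\<rho> x = (SOME r. r > 0 \<and> cball x r \<subseteq> \<Omega>)" for x
  have \<rho>: "\<rho> x > 0" "cball x (\<rho> x) \<subseteq> \<Omega>" if "x \<in> \<Omega>" for x
  proof -
    have "\<exists>r. r > 0 \<and> cball x r \<subseteq> \<Omega>" using open_dom that open_contains_cball by blast
    from someI_ex[OF this] show "\<rho> x > 0" "cball x (\<rho> x) \<subseteq> \<Omega>" by (auto simp: \<rho>_def)
  qed
  \<comment> \<open>The numerator 2 puts the parameter strictly above
    \<open>1 / (\<rho> x)\<^sup>2\<close>. Independence of the radius makes the arbitrary choice of
    \<open>\<rho>\<close> harmless.\<close>
  define W where "W i x = radial_average v i (2 / (\<rho> x)\<^sup>2) x / radial_mass (2 / (\<rho> x)\<^sup>2)" for i x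
  have W: "W i x = radial_average v i l x / radial_mass l"
    if r: "r > 0" "cball x r \<subseteq> \<Omega>" "l > 1 / r\<^sup>2" for i x r l
  proof -
    have x: "x \<in> \<Omega>" using r by auto
    show ?thesis unfolding W_def
      by (rule radial_mean_const[OF v \<rho>[OF x] _ r]) (use \<rho>[OF x] in \<open>simp add: divide_strict_right_mono\<close>)
  qed
  have Wc: "continuous_on \<Omega> (W i)" for i
  proof (intro continuous_at_imp_continuous_on ballI)
    fix x0 assume "x0 \<in> \<Omega>"
    then obtain e where e: "e > 0" "cball x0 e \<subseteq> \<Omega>" using open_dom open_contains_cball by blast
    \<comment> \<open>Half the radius, so that the balls of radius \<open>r\<close> around all
      points of \<open>ball x0 r\<close> stay in \<Omega>.\<close>
    define r where "r = e / 2"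
    have r: "r > 0" using e by (simp add: r_def)
    have sub: "cball x r \<subseteq> \<Omega>" if "x \<in> ball x0 r" for x
    proof
      fix y assume "y \<in> cball x r"
      then have "dist x0 y \<le> e" using dist_triangle[of x0 y x] that by (simp add: r_def)
      then show "y \<in> \<Omega>" using e by auto
    qed
    have l: "2 / r\<^sup>2 > 1 / r\<^sup>2" "2 / r\<^sup>2 > 0" using r by (auto simp: divide_strict_right_mono)
    have "isCont (\<lambda>x. radial_average v i (2 / r\<^sup>2) x / radial_mass (2 / r\<^sup>2)) x0"
      using isCont_radial_average[OF vl l(2)] radial_mass_pos[OF l(2)] by (intro continuous_intros) auto
    moreover have "\<forall>\<^sub>F x in nhds x0. W i x = radial_average v i (2 / r\<^sup>2) x / radial_mass (2 / r\<^sup>2)"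
      using W[OF r sub l(1)] r by (intro eventually_nhds_in_open[of "ball x0 r", THEN eventually_mono]) auto
    ultimately show "isCont (W i) x0" using isCont_cong by fastforce
  qed
  have Wm: "W i \<in> borel_measurable vol" for i by (rule continuous_on_vol[OF Wc])
  have "AE x in vol. W i x - v x $ i = 0" for i
  proof (rule fundamental_lemma_local)
    show "(\<lambda>x. W i x - v x $ i) \<in> borel_measurable vol"
      by (intro borel_measurable_diff Wm borel_measurable_integrable[OF vi])
    have Wint: "integrable vol (\<lambda>x. W i x * indicator K x)" if "compact K" "K \<subseteq> \<Omega>" for K
    proof -
      have "integrable lborel (\<lambda>x. indicator K x *\<^sub>R W i x)"
        using that by (intro borel_integrable_compact continuous_on_subset[OF Wc])
      moreover have "(\<lambda>x. indicator \<Omega> x *\<^sub>R (W i x * indicator K x)) = (\<lambda>x. indicator K x *\<^sub>R W i x)"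
        using that(2) by (auto simp: indicator_def fun_eq_iff)
      ultimately show ?thesis by (simp add: integrable_restrict_space)
    qed
    show "integrable vol (\<lambda>x. (W i x - v x $ i) * indicator (cbox a b) x)" if "cbox a b \<subseteq> \<Omega>" for a b
    proof -
      have "cbox a b \<in> sets vol" using that by (auto simp: sets_restrict_space_iff)
      then have "integrable vol (\<lambda>x. v x $ i * indicator (cbox a b) x)" using vi by (rule integrable_real_mult_indicator)
      then show ?thesis using Wint[OF compact_cbox that] by (simp add: left_diff_distrib)
    qed
    fix \<phi> assume t: "\<phi> \<in> test_functions \<Omega>"
    obtain K where K: "smooth \<phi>" "compact K" "K \<subseteq> \<Omega>" "\<And>x. x \<notin> K \<Longrightarrow> \<phi> x = 0"
      using t by (rule test_functionsE) blast
    obtain L where L: "L > 0" "\<And>x y. \<bar>\<phi> x - \<phi> y\<bar> \<le> L * norm (x - y)" using test_function_lipschitz[OF t] by blast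
    obtain d K' where d: "d > 0" "compact K'" "K' \<subseteq> \<Omega>" "\<And>x y. x \<in> K \<Longrightarrow> dist x y \<le> d \<Longrightarrow> y \<in> K'"
      using compact_in_open_margin[OF K(2) open_dom K(3)] by blast
    obtain B where B: "\<And>x. \<bar>\<phi> x\<bar> \<le> B" using test_functions_bounded(1)[OF t] by blast
    have \<phi>l: "\<phi> \<in> l2 vol" by (rule smooth_l2[OF K(1)])
    define J where "J = (\<integral>x. W i x * \<phi> x \<partial>vol) - (\<integral>x. v x $ i * \<phi> x \<partial>vol)"
    \<comment> \<open>\<open>J\<close> is free of \<open>l\<close>, so a bound that tends to 0 as
      \<open>l\<close> grows makes it vanish.\<close>
    have bound: "\<bar>J\<bar> \<le> (\<integral>z. \<bar>v z $ i\<bar> \<partial>vol) * (L / sqrt l)" if l: "l > 1 / d\<^sup>2" for l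
    proof -
      have l0: "l > 0" using l d(1) by (meson divide_pos_pos less_trans zero_less_one zero_less_power)
      define \<phi>l where "\<phi>l z = (\<integral>x. \<phi> x * radial_kernel l (z - x) \<partial>vol) / radial_mass l" for z
      have \<phi>lb: "\<bar>\<phi>l z - \<phi> z\<bar> \<le> L / sqrt l" for z
        unfolding \<phi>l_def by (rule radial_mollification_error[OF L(2,1) t l0])
      have "(\<integral>x. W i x * \<phi> x \<partial>vol) = (\<integral>x. \<phi> x * (\<integral>z. v z $ i * radial_kernel l (z - x) \<partial>vol) / radial_mass l \<partial>vol)"
      proof (intro Bochner_Integration.integral_cong refl)
        fix x
        show "W i x * \<phi> x = \<phi> x * (\<integral>z. v z $ i * radial_kernel l (z - x) \<partial>vol) / radial_mass l"
        \<comment> \<open>Only points of the support of \<phi> count, and all of these admit the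
          same radius \<open>d\<close>.\<close>
        proof (cases "x \<in> K")
          case True
          then have "cball x d \<subseteq> \<Omega>" using d(3,4) by auto
          from W[OF d(1) this l, of i] show ?thesis by (simp add: radial_average_def)
        qed (simp add: K(4))
      qed
      also have "\<dots> = (\<integral>x. \<phi> x * (\<integral>z. v z $ i * radial_kernel l (z - x) \<partial>vol) \<partial>vol) / radial_mass l"
        by simp
      also have "(\<integral>x. \<phi> x * (\<integral>z. v z $ i * radial_kernel l (z - x) \<partial>vol) \<partial>vol)
          = (\<integral>z. v z $ i * (\<integral>x. \<phi> x * radial_kernel l (z - x) \<partial>vol) \<partial>vol)"
      proof (rule Fubini_kernel[where K=l])
        show "sigma_finite_measure vol" "sigma_finite_measure vol" by unfold_locales
        have [measurable]: "(\<lambda>x. x) \<in> vol \<rightarrow>\<^sub>M borel" by (rule borel_vol) simp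
        show "(\<lambda>(x, y). radial_kernel l (y - x)) \<in> borel_measurable (vol \<Otimes>\<^sub>M vol)"
        proof -
          have "fst \<in> vol \<Otimes>\<^sub>M vol \<rightarrow>\<^sub>M borel" "snd \<in> vol \<Otimes>\<^sub>M vol \<rightarrow>\<^sub>M borel"
            by (rule measurable_compose[OF measurable_fst borel_vol], simp)
               (rule measurable_compose[OF measurable_snd borel_vol], simp)
          then have "(\<lambda>p. snd p - fst p) \<in> vol \<Otimes>\<^sub>M vol \<rightarrow>\<^sub>M borel" by (intro borel_measurable_diff)
          from measurable_compose[OF this radial_kernel_borel] show ?thesis by (simp add: case_prod_unfold)
        qed
        show "\<bar>radial_kernel l (y - x)\<bar> \<le> l" for x y
          using radial_kernel_nonneg[of l "y - x"] radial_kernel_le[of l "y - x"] l0 by simp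
      qed (use vol.l2_integrable[OF \<phi>l] vi in auto)
      also have "\<dots> / radial_mass l = (\<integral>z. v z $ i * \<phi>l z \<partial>vol)" by (simp add: \<phi>l_def)
      finally have eq: "(\<integral>x. W i x * \<phi> x \<partial>vol) = (\<integral>z. v z $ i * \<phi>l z \<partial>vol)" .
      show ?thesis
      \<comment> \<open>Splitting the integral requires integrability, which holds because the
        mollified function is bounded; the other case is contradictory.\<close>
      proof (cases "integrable vol (\<lambda>z. v z $ i * \<phi>l z)")
        case True
        have i1: "integrable vol (\<lambda>z. v z $ i * \<phi> z)" by (intro l2_mult_integrable l2_nth vl \<phi>l)
        have "J = (\<integral>z. v z $ i * (\<phi>l z - \<phi> z) \<partial>vol)"
          unfolding J_def eq using True i1 by (simp add: right_diff_distrib)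
        also have "\<bar>\<dots>\<bar> \<le> (\<integral>z. \<bar>v z $ i\<bar> * (L / sqrt l) \<partial>vol)"
        proof (rule integral_abs_bound_integral)
          show "integrable vol (\<lambda>z. v z $ i * (\<phi>l z - \<phi> z))" using True i1 by (simp add: right_diff_distrib)
          show "integrable vol (\<lambda>z. \<bar>v z $ i\<bar> * (L / sqrt l))" using vi[of i] by simp
          show "\<bar>v z $ i * (\<phi>l z - \<phi> z)\<bar> \<le> \<bar>v z $ i\<bar> * (L / sqrt l)" for z
            unfolding abs_mult by (intro mult_left_mono \<phi>lb) simp
        qed
        finally show ?thesis by simp
      next
        case False
        have "\<phi>l \<in> borel_measurable vol"
        proof -
          have "(\<lambda>(z, x). \<phi> x * radial_kernel l (z - x)) \<in> borel_measurable (vol \<Otimes>\<^sub>M vol)"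
          proof -
            have fs: "fst \<in> vol \<Otimes>\<^sub>M vol \<rightarrow>\<^sub>M borel" "snd \<in> vol \<Otimes>\<^sub>M vol \<rightarrow>\<^sub>M borel"
              by (rule measurable_compose[OF measurable_fst borel_vol], simp)
                 (rule measurable_compose[OF measurable_snd borel_vol], simp)
            then have "(\<lambda>p. fst p - snd p) \<in> vol \<Otimes>\<^sub>M vol \<rightarrow>\<^sub>M borel" by (intro borel_measurable_diff)
            from borel_measurable_times[OF measurable_compose[OF fs(2) smooth_borel[OF K(1)]] measurable_compose[OF this radial_kernel_borel]]
            show ?thesis by (simp add: case_prod_unfold)
          qed
          from vol.borel_measurable_lebesgue_integral[OF this] show ?thesis
            unfolding \<phi>l_def by (intro borel_measurable_divide) auto
        qed
        then have "\<phi>l \<in> l2 vol"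
        proof (rule vol.l2_bounded[where K="B + L / sqrt l"])
          show "AE x in vol. norm (\<phi>l x) \<le> B + L / sqrt l"
          proof (rule AE_I2)
            fix x
            show "norm (\<phi>l x) \<le> B + L / sqrt l" using \<phi>lb[of x] B[of x] by (simp add: abs_le_iff; linarith)
          qed
        qed
        then have "integrable vol (\<lambda>z. v z $ i * \<phi>l z)" by (intro l2_mult_integrable l2_nth vl)
        with False show ?thesis by contradiction
      qed
    qed
    have "(\<lambda>n. (\<integral>z. \<bar>v z $ i\<bar> \<partial>vol) * (L / sqrt (real n))) \<longlonglongrightarrow> (\<integral>z. \<bar>v z $ i\<bar> \<partial>vol) * 0"
      by (intro tendsto_mult tendsto_const real_tendsto_divide_at_top[OF tendsto_const]
          filterlim_compose[OF sqrt_at_top filterlim_real_sequentially])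
    moreover have "\<forall>\<^sub>F n in sequentially. \<bar>J\<bar> \<le> (\<integral>z. \<bar>v z $ i\<bar> \<partial>vol) * (L / sqrt (real n))"
      using filterlim_real_sequentially[unfolded filterlim_at_top_dense, rule_format, of "1 / d\<^sup>2"]
      by (rule eventually_mono) (rule bound)
    ultimately have "\<bar>J\<bar> \<le> (\<integral>z. \<bar>v z $ i\<bar> \<partial>vol) * 0"
      by (intro tendsto_lowerbound) auto
    then have "J = 0" by simp
    moreover have "(\<integral>x. (W i x - v x $ i) * \<phi> x \<partial>vol) = J"
    proof -
      have "integrable vol (\<lambda>x. (W i x * indicator K x) * \<phi> x)"
      proof (rule Bochner_Integration.integrable_bound)
        show "integrable vol (\<lambda>x. B * (W i x * indicator K x))" using Wint[OF K(2,3)] by simp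
        show "(\<lambda>x. (W i x * indicator K x) * \<phi> x) \<in> borel_measurable vol"
          by (intro borel_measurable_times[OF borel_measurable_integrable[OF Wint[OF K(2,3)]]] l2_measurable \<phi>l)
        show "AE x in vol. norm (W i x * indicator K x * \<phi> x) \<le> norm (B * (W i x * indicator K x))"
        proof (rule AE_I2)
          fix x
          have "\<bar>\<phi> x\<bar> \<le> \<bar>B\<bar>" using B[of x] by simp
          then show "norm (W i x * indicator K x * \<phi> x) \<le> norm (B * (W i x * indicator K x))"
            unfolding real_norm_def abs_mult by (subst (3) mult.commute) (intro mult_left_mono, auto)
        qed
      qed
      moreover have "(\<lambda>x. (W i x * indicator K x) * \<phi> x) = (\<lambda>x. W i x * \<phi> x)"
        using K(4) by (auto simp: indicator_def fun_eq_iff)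
      ultimately have "integrable vol (\<lambda>x. W i x * \<phi> x)" by simp
      moreover have "integrable vol (\<lambda>z. v z $ i * \<phi> z)" by (intro l2_mult_integrable l2_nth vl \<phi>l)
      ultimately show ?thesis by (simp add: J_def left_diff_distrib)
    qed
    ultimately show "(\<integral>x. (W i x - v x $ i) * \<phi> x \<partial>vol) = 0" by simp
  qed
  note ae = this
  define V where "V x = (vector [W 1 x, W 2 x] :: real^2)" for x
  have "V x = (\<chi> i. W i x)" for x by (simp add: V_def vec_eq_iff forall_2)
  then have "continuous_on \<Omega> V" using Wc by (simp add: V_def[abs_def] continuous_on_vec_lambda cong: continuous_on_cong)
  moreover have "AE x in vol. V x = v x"
    using ae[of 1] ae[of 2] by eventually_elim (simp add: V_def vec_eq_iff forall_2)
  ultimately show thesis by (rule that)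
qed

end

section \<open>Circulation along axis-parallel paths\<close>

abbreviation unit_interval :: "real measure" where
  "unit_interval \<equiv> restrict_space lborel {0..1}"

lemma finite_measure_unit_interval: "finite_measure unit_interval"
  by (rule finite_measureI) (simp add: emeasure_restrict_space space_restrict_space)

lemma unit_interval_FTC:
  fixes F f :: "real \<Rightarrow> real"
  assumes "\<And>t. (F has_real_derivative f t) (at t)" "continuous_on UNIV f"
  shows "(\<integral>t. f t \<partial>unit_interval) = F 1 - F 0"
proof -
  have "(\<integral>t. indicator {0..1} t *\<^sub>R f t \<partial>lborel) = F 1 - F 0"
    using assms
    by (intro integral_FTC_atLeastAtMost)
       (auto simp: has_real_derivative_iff_has_vector_derivative intro: has_vector_derivative_at_within continuous_on_subset)
  then show ?thesis by (simp add: integral_restrict_space)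
qed

section \<open>Smoothed segments as differences of quadrants\<close>

lemma step_rescaled_DERIV:
  "((\<lambda>t. step ((t - s) / e)) has_real_derivative deriv step ((t - s) / e) / e) (at t)"
proof -
  have "((\<lambda>t. (t - s) / e) has_real_derivative 1 / e) (at t)"
    using DERIV_cdivide[OF DERIV_diff[OF DERIV_ident DERIV_const], of s e t] by simp
  from DERIV_chain2[OF smooth1_DERIV[OF smooth1_step] this] show ?thesis by simp
qed

lemma smooth_step_coord: "smooth (\<lambda>z. step ((z $ j - s) / e))"
proof -
  have "smooth (\<lambda>z. step ((1 / e) * z $ j + (- s / e)))"
    by (intro smooth_smooth1[OF smooth_coord smooth1_affine[OF smooth1_step]])
  then show ?thesis by (simp add: diff_divide_distrib)
qed

text \<open>A smoothed indicator of the quadrant above and to the right of \<open>a\<close>. The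
  difference for the two ends of an axis-parallel segment is, up to sign, a smoothed half-strip that
  starts at this segment.\<close>

definition quadrant :: "real \<Rightarrow> real^2 \<Rightarrow> real^2 \<Rightarrow> real" where
  "quadrant e a z = step ((z $ 1 - a $ 1) / e) * step ((z $ 2 - a $ 2) / e)"

lemma smooth_quadrant: "smooth (quadrant e a)"
  unfolding quadrant_def[abs_def] by (intro smooth_mult smooth_step_coord)

lemma partial_deriv_quadrant:
  "partial_deriv 1 (quadrant e a) z = deriv step ((z $ 1 - a $ 1) / e) / e * step ((z $ 2 - a $ 2) / e)"
  "partial_deriv 2 (quadrant e a) z = step ((z $ 1 - a $ 1) / e) * (deriv step ((z $ 2 - a $ 2) / e) / e)"
proof -
  have "((\<lambda>z. step ((z $ j - s) / e)) has_derivative (\<lambda>h. deriv step ((z $ j - s) / e) / e * h $ j)) (at z)" for j :: 2 and s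
    using has_derivative_compose[OF bounded_linear_imp_has_derivative[OF bounded_linear_vec_nth]
        step_rescaled_DERIV[unfolded has_field_derivative_def]] .
  note D = has_derivative_mult[OF this[of 1 "a $ 1"] this[of 2 "a $ 2"], folded quadrant_def]
  show "partial_deriv 1 (quadrant e a) z = deriv step ((z $ 1 - a $ 1) / e) / e * step ((z $ 2 - a $ 2) / e)"
    "partial_deriv 2 (quadrant e a) z = step ((z $ 1 - a $ 1) / e) * (deriv step ((z $ 2 - a $ 2) / e) / e)"
    using partial_deriv_eq[OF D, of 1] partial_deriv_eq[OF D, of 2] by (simp_all add: axis_def)
qed

lemma partial_deriv_add:
  "smooth f \<Longrightarrow> smooth g \<Longrightarrow> partial_deriv i (\<lambda>z. f z + g z) z = partial_deriv i f z + partial_deriv i g z"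
  using classical_grad_add[OF smooth_differentiable smooth_differentiable, of f g z] by (simp add: vec_eq_iff)

lemma partial_deriv_diff:
  assumes "smooth f" "smooth g"
  shows "partial_deriv i (\<lambda>z. f z - g z) z = partial_deriv i f z - partial_deriv i g z"
  using partial_deriv_add[OF smooth_diff[OF assms] assms(2), of i z] by simp

lemma partial_deriv_const: "partial_deriv i (\<lambda>z. c) z = 0"
  by (rule partial_deriv_eq_0I) simp

text \<open>The difference of the quadrants of a segment goes into one of two sums according to the
  direction of the segment; the derivative across the segment is then concentrated on it. A
  degenerate segment counts as horizontal and contributes 0.\<close>

definition horizontal_part :: "real \<Rightarrow> real^2 \<Rightarrow> real^2 \<Rightarrow> real^2 \<Rightarrow> real" where
  "horizontal_part e a b z = (if a $ 2 = b $ 2 then quadrant e a z - quadrant e b z else 0)"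

definition vertical_part :: "real \<Rightarrow> real^2 \<Rightarrow> real^2 \<Rightarrow> real^2 \<Rightarrow> real" where
  "vertical_part e a b z = (if a $ 2 = b $ 2 then 0 else quadrant e a z - quadrant e b z)"

text \<open>The mixed second derivative of \<open>quadrant e 0\<close>, a nonnegative mollifier
  supported in a square of side \<open>e\<close>. It is normalised by division by
  \<open>cell_mass\<close>.\<close>

definition cell_kernel :: "real \<Rightarrow> real^2 \<Rightarrow> real" where
  "cell_kernel e y = (deriv step (y $ 1 / e) / e) * (deriv step (y $ 2 / e) / e)"

definition cell_mass :: "real \<Rightarrow> real" where
  "cell_mass e = (\<integral>y. cell_kernel e y \<partial>lborel)"

lemma smooth_parts: "smooth (horizontal_part e a b)" "smooth (vertical_part e a b)"
proof -
  have "smooth (\<lambda>z. quadrant e a z - quadrant e b z)" by (intro smooth_diff smooth_quadrant)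
  then show "smooth (horizontal_part e a b)" "smooth (vertical_part e a b)"
    by (cases "a $ 2 = b $ 2"; simp add: horizontal_part_def[abs_def] vertical_part_def[abs_def] smooth_const)+
qed

lemma cell_kernel_continuous: "continuous_on UNIV (cell_kernel e)"
proof -
  have c: "continuous_on UNIV (deriv step)" by (intro smooth1_continuous smooth1_deriv smooth1_step)
  have "continuous_on UNIV (\<lambda>y :: real^2. deriv step ((1 / e) * y $ j))" for j
  proof (rule continuous_on_compose2[OF c])
    show "continuous_on UNIV (\<lambda>y :: real^2. (1 / e) * y $ j)"
      by (intro continuous_on_mult continuous_on_const continuous_on_component continuous_on_id)
  qed simp
  then have "continuous_on UNIV (\<lambda>y :: real^2. (deriv step ((1 / e) * y $ 1) * (1 / e)) * (deriv step ((1 / e) * y $ 2) * (1 / e)))"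
    by (intro continuous_on_mult continuous_on_const)
  then show ?thesis by (simp add: cell_kernel_def[abs_def])
qed

lemma cell_kernel_borel [measurable]: "cell_kernel e \<in> borel_measurable borel"
  by (rule borel_measurable_continuous_onI[OF cell_kernel_continuous])

lemma cell_kernel_nonneg: "e > 0 \<Longrightarrow> 0 \<le> cell_kernel e y"
  by (simp add: cell_kernel_def deriv_step_nonneg)

lemma cell_kernel_support:
  assumes "e > 0" "cell_kernel e y \<noteq> 0"
  shows "norm y \<le> 2 * e"
proof -
  have "deriv step (y $ j / e) \<noteq> 0" for j
    using assms(2) exhaust_2[of j] by (auto simp: cell_kernel_def)
  then have "0 \<le> y $ j / e \<and> y $ j / e \<le> 1" for j
    using deriv_step_eq_0[of "y $ j / e"] by (metis not_le)
  then have "\<bar>y $ j\<bar> \<le> e" for j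
    using assms(1) by (simp add: zero_le_divide_iff pos_divide_le_eq)
  then have "norm y \<le> (\<Sum>j\<in>(UNIV :: 2 set). e)"
    using norm_le_l1_cart[of y] by (meson order_trans sum_mono)
  then show ?thesis by simp
qed

lemma cell_kernel_integrable:
  assumes "e > 0" shows "integrable lborel (cell_kernel e)"
  by (rule integrable_continuous_compact_support[OF cell_kernel_continuous compact_cball[of 0 "2 * e"]])
     (use cell_kernel_support[OF assms] in auto)

lemma cell_kernel_bounded:
  assumes "e > 0" shows "\<exists>C>0. \<forall>y. \<bar>cell_kernel e y\<bar> \<le> C"
  using continuous_compact_support_bounded[OF cell_kernel_continuous compact_cball[of 0 "2 * e"], of e]
    cell_kernel_support[OF assms] by fastforce

text \<open>A kernel of mass 0 would vanish almost everywhere and, being continuous, everywhere; but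
  \<open>step\<close> rises from 0 to 1, so its derivative is nonzero at some point.\<close>

lemma cell_mass_pos:
  assumes "e > 0" shows "cell_mass e > 0"
proof (rule ccontr)
  assume "\<not> cell_mass e > 0"
  moreover have "cell_mass e \<ge> 0"
    unfolding cell_mass_def using cell_kernel_nonneg[OF assms] by (intro Bochner_Integration.integral_nonneg) auto
  ultimately have "(\<integral>y. cell_kernel e y \<partial>lborel) = 0" by (simp add: cell_mass_def)
  then have ae: "AE y in lborel. cell_kernel e y = 0"
    using integral_nonneg_eq_0_iff_AE[OF cell_kernel_integrable[OF assms]] cell_kernel_nonneg[OF assms] by simp
  define U where "U = {y. cell_kernel e y \<noteq> 0}"
  have U: "open U"
    unfolding U_def by (intro open_Collect_neq cell_kernel_continuous continuous_on_const)
  have "AE y in lborel. y \<notin> U" using ae by eventually_elim (simp add: U_def)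
  then have "U \<in> null_sets lborel" using U by (subst AE_iff_null_sets) auto
  then have "negligible U" unfolding negligible_iff_null_sets by (rule null_sets_completionI)
  then have "U = {}" using open_not_negligible[OF U] by blast
  moreover obtain t where "0 < t" "t < 1" "step 1 - step 0 = (1 - 0) * deriv step t"
    using MVT2[of 0 1 step "deriv step"] smooth1_DERIV[OF smooth1_step] by auto
  then have "deriv step t \<noteq> 0" by (simp add: step_eq_0 step_eq_1)
  then have "vector [t * e, t * e] \<in> U" using assms by (simp add: U_def cell_kernel_def)
  ultimately show False by blast
qed

text \<open>Both sides are a mollification of the tangent of the segment from \<open>a\<close> to \<open>b\<close>.\<close>

lemma partial_deriv_parts:
  assumes e: "e > 0" and ab: "a $ 1 = b $ 1 \<or> a $ 2 = b $ 2"
  shows "partial_deriv 2 (horizontal_part e a b) z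
      = (b $ 1 - a $ 1) * (\<integral>t. cell_kernel e (z - (a + t *\<^sub>R (b - a))) \<partial>unit_interval)"
    "partial_deriv 1 (vertical_part e a b) z
      = (b $ 2 - a $ 2) * (\<integral>t. cell_kernel e (z - (a + t *\<^sub>R (b - a))) \<partial>unit_interval)"
proof -
  have cont: "continuous_on UNIV (\<lambda>t. cell_kernel e (z - (a + t *\<^sub>R (b - a))))"
    by (rule continuous_on_compose2[OF cell_kernel_continuous]) (auto intro!: continuous_intros)
  \<comment> \<open>An antiderivative in \<open>t\<close> of the kernel along a segment;
    \<open>D\<close> stands for the factor of the coordinate that is constant on the
    segment.\<close>
  have FTC: "((\<lambda>t. - (step ((s - (p + t * (q - p))) / e) * D)) has_real_derivative
      (q - p) * (deriv step ((s - (p + t * (q - p))) / e) / e * D)) (at t)" for s p q D t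
  proof -
    have "((\<lambda>t. s - (p + t * (q - p))) has_real_derivative - (q - p)) (at t)"
      by (auto intro!: derivative_eq_intros)
    from DERIV_chain2[OF step_rescaled_DERIV[of 0 e] this]
    have "((\<lambda>t. step ((s - (p + t * (q - p))) / e)) has_real_derivative
        deriv step ((s - (p + t * (q - p))) / e) / e * (- (q - p))) (at t)" by simp
    from DERIV_minus[OF DERIV_cmult_right[OF this, of D]] show ?thesis
      by (rule DERIV_cong) (simp only: mult_minus_right mult_minus_left minus_minus ac_simps)
  qed
  show "partial_deriv 2 (horizontal_part e a b) z
      = (b $ 1 - a $ 1) * (\<integral>t. cell_kernel e (z - (a + t *\<^sub>R (b - a))) \<partial>unit_interval)"
  proof (cases "a $ 2 = b $ 2")
    case True
    define D where "D = deriv step ((z $ 2 - a $ 2) / e) / e"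
    have "(b $ 1 - a $ 1) * (\<integral>t. cell_kernel e (z - (a + t *\<^sub>R (b - a))) \<partial>unit_interval)
        = (\<integral>t. (b $ 1 - a $ 1) * cell_kernel e (z - (a + t *\<^sub>R (b - a))) \<partial>unit_interval)" by simp
    also have "\<dots> = - (step ((z $ 1 - (a $ 1 + 1 * (b $ 1 - a $ 1))) / e) * D)
        - (- (step ((z $ 1 - (a $ 1 + 0 * (b $ 1 - a $ 1))) / e) * D))"
    proof (rule unit_interval_FTC[where F="\<lambda>t. - (step ((z $ 1 - (a $ 1 + t * (b $ 1 - a $ 1))) / e) * D)"])
      show "((\<lambda>t. - (step ((z $ 1 - (a $ 1 + t * (b $ 1 - a $ 1))) / e) * D)) has_real_derivative
        (b $ 1 - a $ 1) * cell_kernel e (z - (a + t *\<^sub>R (b - a)))) (at t)" for t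
        using FTC[of "z $ 1" "a $ 1" "b $ 1" D t] True by (simp add: cell_kernel_def D_def)
      show "continuous_on UNIV (\<lambda>t. (b $ 1 - a $ 1) * cell_kernel e (z - (a + t *\<^sub>R (b - a))))"
        by (intro continuous_on_mult continuous_on_const cont)
    qed
    also have "\<dots> = partial_deriv 2 (horizontal_part e a b) z"
      using True unfolding horizontal_part_def[abs_def]
      by (simp add: partial_deriv_diff[OF smooth_quadrant smooth_quadrant] partial_deriv_quadrant D_def algebra_simps)
    finally show ?thesis by simp
  next
    case False
    then show ?thesis using ab by (simp add: horizontal_part_def[abs_def] partial_deriv_const)
  qed
  show "partial_deriv 1 (vertical_part e a b) z
      = (b $ 2 - a $ 2) * (\<integral>t. cell_kernel e (z - (a + t *\<^sub>R (b - a))) \<partial>unit_interval)"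
  proof (cases "a $ 2 = b $ 2")
    case True
    then show ?thesis by (simp add: vertical_part_def[abs_def] partial_deriv_const)
  next
    case False
    then have ab1: "a $ 1 = b $ 1" using ab by simp
    define D where "D = deriv step ((z $ 1 - a $ 1) / e) / e"
    have "(b $ 2 - a $ 2) * (\<integral>t. cell_kernel e (z - (a + t *\<^sub>R (b - a))) \<partial>unit_interval)
        = (\<integral>t. (b $ 2 - a $ 2) * cell_kernel e (z - (a + t *\<^sub>R (b - a))) \<partial>unit_interval)" by simp
    also have "\<dots> = - (step ((z $ 2 - (a $ 2 + 1 * (b $ 2 - a $ 2))) / e) * D)
        - (- (step ((z $ 2 - (a $ 2 + 0 * (b $ 2 - a $ 2))) / e) * D))"
    proof (rule unit_interval_FTC[where F="\<lambda>t. - (step ((z $ 2 - (a $ 2 + t * (b $ 2 - a $ 2))) / e) * D)"])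
      show "((\<lambda>t. - (step ((z $ 2 - (a $ 2 + t * (b $ 2 - a $ 2))) / e) * D)) has_real_derivative
        (b $ 2 - a $ 2) * cell_kernel e (z - (a + t *\<^sub>R (b - a)))) (at t)" for t
        using FTC[of "z $ 2" "a $ 2" "b $ 2" D t] ab1 by (simp add: cell_kernel_def D_def mult.commute)
      show "continuous_on UNIV (\<lambda>t. (b $ 2 - a $ 2) * cell_kernel e (z - (a + t *\<^sub>R (b - a))))"
        by (intro continuous_on_mult continuous_on_const cont)
    qed
    also have "\<dots> = partial_deriv 1 (vertical_part e a b) z"
      using False ab1 unfolding vertical_part_def[abs_def]
      by (simp add: partial_deriv_diff[OF smooth_quadrant smooth_quadrant] partial_deriv_quadrant D_def algebra_simps)
    finally show ?thesis by simp
  qed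
qed

text \<open>Beyond either end of a horizontal segment the two quadrants agree, and below it both
  vanish, but above it the half-strip extends to infinity. The half-strip of a vertical segment
  extends to the right, and beyond the ends the quadrants agree again. The margin 1 covers the
  smoothing width \<open>e\<close>.\<close>

lemma parts_support:
  fixes a b z :: "real^2"
  assumes e: "0 < e" "e \<le> 1" and ab: "a $ 1 = b $ 1 \<or> a $ 2 = b $ 2"
    and R: "norm a \<le> R" "norm b \<le> R"
  shows "\<bar>z $ 1\<bar> > R + 1 \<or> z $ 2 < - R - 1 \<Longrightarrow> horizontal_part e a b z = 0"
    "\<bar>z $ 2\<bar> > R + 1 \<Longrightarrow> vertical_part e a b z = 0"
proof -
  have c: "\<bar>a $ j\<bar> \<le> R" "\<bar>b $ j\<bar> \<le> R" for j
    using component_le_norm_cart[of a j] component_le_norm_cart[of b j] R by auto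
  have s: "step ((z $ j - p $ j) / e) = (if z $ j > R + 1 then 1 else 0)"
    if "\<bar>z $ j\<bar> > R + 1 \<or> z $ j < - R - 1" "p = a \<or> p = b" for j p
  proof -
    have p: "\<bar>p $ j\<bar> \<le> R" using c that(2) by auto
    show ?thesis
    proof (cases "z $ j > R + 1")
      case True
      then have "1 \<le> z $ j - p $ j" using p by linarith
      then have "1 \<le> (z $ j - p $ j) / e" using e by (simp add: pos_le_divide_eq)
      then show ?thesis using True by (simp add: step_eq_1)
    next
      case False
      then have "z $ j - p $ j \<le> 0" using that(1) p by linarith
      then have "(z $ j - p $ j) / e \<le> 0" using e by (simp add: divide_nonpos_pos)
      then show ?thesis using False by (simp add: step_eq_0)
    qed
  qed
  have R0: "R \<ge> 0" using R(1) norm_ge_zero[of a] by linarith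
  show "\<bar>z $ 1\<bar> > R + 1 \<or> z $ 2 < - R - 1 \<Longrightarrow> horizontal_part e a b z = 0"
    using s[of 1 a] s[of 1 b] s[of 2 a] s[of 2 b] R0 by (auto simp: horizontal_part_def quadrant_def)
  show "\<bar>z $ 2\<bar> > R + 1 \<Longrightarrow> vertical_part e a b z = 0"
    using s[of 2 a] s[of 2 b] ab by (auto simp: vertical_part_def quadrant_def)
qed

section \<open>Limits of smoothed circulations and independence of the path\<close>

context planar_domain
begin

definition segment_integral :: "(real^2 \<Rightarrow> real^2) \<Rightarrow> real^2 \<Rightarrow> real^2 \<Rightarrow> real" where
  "segment_integral V a b = (\<integral>t. V (a + t *\<^sub>R (b - a)) \<bullet> (b - a) \<partial>unit_interval)"

text \<open>The kernel is nonnegative and its support around \<open>p\<close> lies in \<Omega>, so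
  this is a genuine weighted mean of values within \<eta> of \<open>c\<close>.\<close>

lemma cell_average_close:
  fixes g :: "real^2 \<Rightarrow> real"
  assumes e: "e > 0" and g: "g \<in> l2 vol"
    and close: "\<And>z. norm (z - p) \<le> 2 * e \<Longrightarrow> z \<in> \<Omega> \<and> \<bar>g z - c\<bar> \<le> \<eta>"
  shows "\<bar>(\<integral>z. g z * cell_kernel e (z - p) \<partial>vol) / cell_mass e - c\<bar> \<le> \<eta>"
proof -
  have km: "(\<lambda>z. cell_kernel e (z - p)) \<in> borel_measurable borel" by measurable
  obtain C where C: "\<And>y. \<bar>cell_kernel e y\<bar> \<le> C" using cell_kernel_bounded[OF e] by blast
  have kl: "(\<lambda>z. cell_kernel e (z - p)) \<in> l2 vol"
    by (rule vol.l2_bounded[OF borel_vol[OF km], of C]) (use C in auto)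
  have ki: "integrable vol (\<lambda>z. cell_kernel e (z - p))" by (rule vol.l2_integrable[OF kl])
  have gi: "integrable vol (\<lambda>z. g z * cell_kernel e (z - p))" by (intro l2_mult_integrable g kl)
  have mass: "(\<integral>z. cell_kernel e (z - p) \<partial>vol) = cell_mass e"
  proof -
    have "(\<integral>z. cell_kernel e (z - p) \<partial>vol) = (\<integral>z. cell_kernel e (z - p) \<partial>lborel)"
      by (rule vol_integral_eq) (use close cell_kernel_support[OF e] in blast)
    also have "\<dots> = cell_mass e"
      using lborel_integral_translation[of "cell_kernel e" "- p"] by (simp add: cell_mass_def add.commute)
    finally show ?thesis .
  qed
  have m: "cell_mass e > 0" by (rule cell_mass_pos[OF e])
  have "(\<integral>z. g z * cell_kernel e (z - p) \<partial>vol) - c * cell_mass e = (\<integral>z. (g z - c) * cell_kernel e (z - p) \<partial>vol)"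
    using gi ki by (simp add: left_diff_distrib mass)
  also have "\<bar>\<dots>\<bar> \<le> (\<integral>z. \<eta> * cell_kernel e (z - p) \<partial>vol)"
  proof (rule integral_abs_bound_integral)
    show "integrable vol (\<lambda>z. (g z - c) * cell_kernel e (z - p))" using gi ki by (simp add: left_diff_distrib)
    show "integrable vol (\<lambda>z. \<eta> * cell_kernel e (z - p))" using ki by simp
    fix z
    show "\<bar>(g z - c) * cell_kernel e (z - p)\<bar> \<le> \<eta> * cell_kernel e (z - p)"
    proof (cases "cell_kernel e (z - p) = 0")
      case False
      then have "\<bar>g z - c\<bar> \<le> \<eta>" using close cell_kernel_support[OF e] by blast
      then show ?thesis using cell_kernel_nonneg[OF e, of "z - p"] by (simp add: abs_mult mult_right_mono)
    qed simp
  qed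
  also have "\<dots> = \<eta> * cell_mass e" by (simp add: mass)
  finally have "\<bar>(\<integral>z. g z * cell_kernel e (z - p) \<partial>vol) - c * cell_mass e\<bar> \<le> \<eta> * cell_mass e" .
  moreover have "(\<integral>z. g z * cell_kernel e (z - p) \<partial>vol) / cell_mass e - c
      = ((\<integral>z. g z * cell_kernel e (z - p) \<partial>vol) - c * cell_mass e) / cell_mass e"
    using m by (simp add: field_simps)
  ultimately show ?thesis using m by (simp add: abs_divide pos_divide_le_eq)
qed

text \<open>After Fubini the expression is the mean over the segment of local averages of
  \<open>V z \<bullet> (b - a)\<close>. They converge pointwise by continuity, and they are bounded
  because eventually all of them are taken in one compact neighbourhood of the segment.\<close>

lemma mollified_segment_limit:
  assumes v: "v \<in> l2 vol" and V: "continuous_on \<Omega> V" "AE x in vol. V x = v x"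
    and seg: "closed_segment a b \<subseteq> \<Omega>"
  shows "(\<lambda>n. (\<integral>z. (v z \<bullet> (b - a)) * (\<integral>t. cell_kernel (1 / Suc n) (z - (a + t *\<^sub>R (b - a))) \<partial>unit_interval) \<partial>vol)
      / cell_mass (1 / Suc n)) \<longlonglongrightarrow> segment_integral V a b"
proof -
  interpret U: finite_measure unit_interval by (rule finite_measure_unit_interval)
  define p where "p t = a + t *\<^sub>R (b - a)" for t
  define e where "e n = 1 / real (Suc n)" for n
  have e: "e n > 0" for n by (simp add: e_def)
  have pseg: "p t \<in> closed_segment a b" if "t \<in> {0..1}" for t
    using that unfolding p_def closed_segment_def by (auto simp: algebra_simps intro!: exI[of _ t])
  define g where "g z = V z \<bullet> (b - a)" for z
  have Vm: "V \<in> borel_measurable vol" by (rule continuous_on_vol[OF V(1)])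
  have Vl: "V \<in> l2 vol"
    by (rule l2_dominated(1)[OF v Vm]) (use V(2) in \<open>auto elim!: eventually_mono\<close>)
  have gm: "g \<in> borel_measurable vol" unfolding g_def by (intro borel_measurable_inner Vm) simp
  have gl: "g \<in> l2 vol"
  proof (rule l2_dominated(1)[OF l2_scaleR(1)[OF Vl, of "norm (b - a)"] gm])
    show "AE x in vol. norm (g x) \<le> norm (norm (b - a) *\<^sub>R V x)"
      using Cauchy_Schwarz_ineq2 by (auto simp: g_def mult.commute)
  qed
  have gc: "continuous_on \<Omega> g" unfolding g_def by (intro continuous_intros V)
  obtain d K where d: "d > 0" "compact K" "K \<subseteq> \<Omega>" "\<And>x y. x \<in> closed_segment a b \<Longrightarrow> dist x y \<le> d \<Longrightarrow> y \<in> K"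
    using compact_in_open_margin[OF compact_segment open_dom seg] by blast
  have "bounded (g ` K)"
    by (intro compact_imp_bounded compact_continuous_image continuous_on_subset[OF gc] d)
  then obtain B where B: "B > 0" "\<And>z. z \<in> K \<Longrightarrow> \<bar>g z\<bar> \<le> B" using bounded_pos[of "g ` K"] by auto
  have eK: "\<forall>\<^sub>F n in sequentially. 2 * e n < r" if "r > 0" for r
  proof -
    have "(\<lambda>n. 2 * e n) \<longlonglongrightarrow> 0"
      using tendsto_mult_right_zero[OF LIMSEQ_inverse_real_of_nat, of 2] by (simp add: e_def inverse_eq_divide)
    then show ?thesis using that by (rule order_tendstoD(2))
  qed
  define A where "A n t = (\<integral>z. g z * cell_kernel (e n) (z - p t) \<partial>vol) / cell_mass (e n)" for n t
  have pm: "p \<in> unit_interval \<rightarrow>\<^sub>M borel"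
    unfolding p_def by (rule measurable_restrict_space1) measurable
  have idm: "(\<lambda>z. z) \<in> vol \<rightarrow>\<^sub>M borel" by (rule borel_vol) simp
  have km: "(\<lambda>(t, z). cell_kernel (e n) (z - p t)) \<in> borel_measurable (unit_interval \<Otimes>\<^sub>M vol)" for n
  proof -
    have "(\<lambda>q. snd q - p (fst q)) \<in> unit_interval \<Otimes>\<^sub>M vol \<rightarrow>\<^sub>M borel"
      by (intro borel_measurable_diff measurable_compose[OF measurable_snd idm] measurable_compose[OF measurable_fst pm])
    from measurable_compose[OF this cell_kernel_borel] show ?thesis by (simp add: case_prod_unfold)
  qed
  have Am: "A n \<in> borel_measurable unit_interval" for n
  proof -
    have "(\<lambda>(t, z). g z * cell_kernel (e n) (z - p t)) \<in> borel_measurable (unit_interval \<Otimes>\<^sub>M vol)"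
      using borel_measurable_times[OF measurable_compose[OF measurable_snd gm] km[of n]]
      by (simp add: case_prod_unfold)
    from vol.borel_measurable_lebesgue_integral[OF this] show ?thesis
      unfolding A_def by (intro borel_measurable_divide) auto
  qed
  have eq: "(\<integral>z. (v z \<bullet> (b - a)) * (\<integral>t. cell_kernel (e n) (z - p t) \<partial>unit_interval) \<partial>vol) / cell_mass (e n)
      = (\<integral>t. A n t \<partial>unit_interval)" for n
  proof -
    obtain C where C: "\<And>y. \<bar>cell_kernel (e n) y\<bar> \<le> C" using cell_kernel_bounded[OF e] by blast
    have "(\<lambda>z. \<integral>t. cell_kernel (e n) (z - p t) \<partial>unit_interval) \<in> borel_measurable vol"
    proof -
      have "(\<lambda>(z, t). cell_kernel (e n) (z - p t)) \<in> borel_measurable (vol \<Otimes>\<^sub>M unit_interval)"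
        using km[of n] by (subst measurable_pair_swap_iff) (simp add: case_prod_unfold)
      from U.borel_measurable_lebesgue_integral[OF this] show ?thesis .
    qed
    then have "(\<integral>z. (v z \<bullet> (b - a)) * (\<integral>t. cell_kernel (e n) (z - p t) \<partial>unit_interval) \<partial>vol)
        = (\<integral>z. g z * (\<integral>t. 1 * cell_kernel (e n) (z - p t) \<partial>unit_interval) \<partial>vol)"
    proof (intro integral_cong_AE borel_measurable_times borel_measurable_inner)
      show "AE z in vol. (v z \<bullet> (b - a)) * (\<integral>t. cell_kernel (e n) (z - p t) \<partial>unit_interval)
          = g z * (\<integral>t. 1 * cell_kernel (e n) (z - p t) \<partial>unit_interval)"
        using V(2) by eventually_elim (simp add: g_def)
    qed (use v gm in \<open>auto simp: l2_def\<close>)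
    also have "\<dots> = (\<integral>t. 1 * (\<integral>z. g z * cell_kernel (e n) (z - p t) \<partial>vol) \<partial>unit_interval)"
      by (rule Fubini_kernel[symmetric, where K=C])
         (use vol.l2_integrable[OF gl] C km[of n] in \<open>auto intro: U.sigma_finite_measure_axioms vol.sigma_finite_measure_axioms\<close>)
    finally show ?thesis by (simp add: A_def)
  qed
  \<comment> \<open>From \<open>N\<close> on the cells around points of the segment stay within the
    compact neighbourhood \<open>K\<close>; the finitely many earlier terms are skipped.\<close>
  obtain N where N: "\<And>n. n \<ge> N \<Longrightarrow> 2 * e n < d" using eK[OF d(1)] by (auto simp: eventually_sequentially)
  have "(\<lambda>n. \<integral>t. A (n + N) t \<partial>unit_interval) \<longlonglongrightarrow> (\<integral>t. g (p t) \<partial>unit_interval)"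
  proof (rule integral_dominated_convergence[where w="\<lambda>_. B"])
    have "continuous_on {0..1} (\<lambda>t. g (p t))"
      by (rule continuous_on_compose2[OF gc]) (use pseg seg in \<open>auto simp: p_def intro!: continuous_intros\<close>)
    then show "(\<lambda>t. g (p t)) \<in> borel_measurable unit_interval"
      using borel_measurable_continuous_on_restrict[of "{0..1}"] by (simp cong: measurable_cong_sets sets_restrict_space_cong)
    show "A (n + N) \<in> borel_measurable unit_interval" for n by (rule Am)
    show "AE t in unit_interval. norm (A (n + N) t) \<le> B" for n
    proof (rule AE_I2)
      fix t assume "t \<in> space unit_interval"
      then have t: "t \<in> {0..1}" by (simp add: space_restrict_space)
      have "z \<in> \<Omega> \<and> \<bar>g z - 0\<bar> \<le> B" if "norm (z - p t) \<le> 2 * e (n + N)" for z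
      proof -
        have "dist (p t) z \<le> d" using N[of "n + N"] that by (simp add: dist_norm norm_minus_commute)
        then have "z \<in> K" using d(4)[OF pseg[OF t]] by blast
        then show ?thesis using d(3) B(2) by auto
      qed
      from cell_average_close[OF e gl this] show "norm (A (n + N) t) \<le> B" by (simp add: A_def)
    qed
    show "AE t in unit_interval. (\<lambda>n. A (n + N) t) \<longlonglongrightarrow> g (p t)"
    proof (rule AE_I2)
      fix t assume "t \<in> space unit_interval"
      then have t: "t \<in> {0..1}" by (simp add: space_restrict_space)
      have pt: "p t \<in> \<Omega>" using pseg[OF t] seg by blast
      have "(\<lambda>n. A n t) \<longlonglongrightarrow> g (p t)"
      proof (rule LIMSEQ_I)
        fix r :: real assume r: "r > 0"
        have "continuous (at (p t)) g" using gc open_dom pt continuous_on_eq_continuous_at by blast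
        then obtain s where s: "s > 0" "\<And>z. dist z (p t) < s \<Longrightarrow> dist (g z) (g (p t)) < r / 2"
          using r unfolding continuous_at_eps_delta by (metis half_gt_zero dist_norm)
        have "min s d > 0" using s(1) d(1) by simp
        then obtain M where M: "\<And>n. n \<ge> M \<Longrightarrow> 2 * e n < min s d"
          using eK[OF \<open>min s d > 0\<close>] unfolding eventually_sequentially by blast
        have "norm (A n t - g (p t)) < r" if "n \<ge> M" for n
        proof -
          have cl: "z \<in> \<Omega> \<and> \<bar>g z - g (p t)\<bar> \<le> r / 2" if z: "norm (z - p t) \<le> 2 * e n" for z
          proof
            have "dist (p t) z \<le> d" using M[OF \<open>n \<ge> M\<close>] z by (simp add: dist_norm norm_minus_commute)
            then show "z \<in> \<Omega>" using d(3,4) pseg[OF t] by blast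
            have "dist z (p t) < s" using M[OF \<open>n \<ge> M\<close>] z by (simp add: dist_norm)
            from s(2)[OF this] show "\<bar>g z - g (p t)\<bar> \<le> r / 2" by (simp add: dist_real_def)
          qed
          have "\<bar>A n t - g (p t)\<bar> \<le> r / 2"
            unfolding A_def by (rule cell_average_close[OF e gl cl])
          then show ?thesis using r by simp
        qed
        then show "\<exists>no. \<forall>n\<ge>no. norm (A n t - g (p t)) < r" by blast
      qed
      then show "(\<lambda>n. A (n + N) t) \<longlonglongrightarrow> g (p t)" by (rule LIMSEQ_ignore_initial_segment)
    qed
  qed simp
  then have "(\<lambda>n. \<integral>t. A n t \<partial>unit_interval) \<longlonglongrightarrow> (\<integral>t. g (p t) \<partial>unit_interval)"
    by (rule LIMSEQ_offset)
  then show ?thesis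
    unfolding eq[symmetric] by (simp add: segment_integral_def g_def p_def e_def)
qed

text \<open>The pairing of \<open>v\<close> with the smoothed tangent of a path, whose two
  components come from two different functions. For a closed path \<open>g\<close> is
  \<open>- h\<close>, and the pairing is the one with \<open>perp\<close> of the gradient of
  \<open>h\<close>.\<close>

definition flux :: "(real^2 \<Rightarrow> real^2) \<Rightarrow> (real^2 \<Rightarrow> real) \<Rightarrow> (real^2 \<Rightarrow> real) \<Rightarrow> real" where
  "flux v h g = (\<integral>z. v z $ 1 * partial_deriv 2 h z + v z $ 2 * partial_deriv 1 g z \<partial>vol)"

lemma flux_add:
  assumes "v \<in> l2 vol" "smooth h" "smooth h'" "smooth g" "smooth g'"
  shows "flux v (\<lambda>z. h z + h' z) (\<lambda>z. g z + g' z) = flux v h g + flux v h' g'"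
proof -
  have i: "integrable vol (\<lambda>z. v z $ j * partial_deriv k f z)" if "smooth f" for j k f
    by (intro l2_mult_integrable l2_nth assms smooth_partial_l2 that)
  show ?thesis
    unfolding flux_def partial_deriv_add[OF assms(2,3)] partial_deriv_add[OF assms(4,5)]
    using i[OF assms(2), of 1 2] i[OF assms(3), of 1 2] i[OF assms(4), of 2 1] i[OF assms(5), of 2 1]
    by (simp add: distrib_left)
qed

text \<open>The last argument is the circulation gathered so far. A relation is used because this
  value depends on the path until circulations along closed paths are known to vanish.\<close>

inductive axis_path :: "(real^2 \<Rightarrow> real^2) \<Rightarrow> real^2 \<Rightarrow> real^2 \<Rightarrow> real \<Rightarrow> bool" for V x0 where
  start: "axis_path V x0 x0 0"
| step: "axis_path V x0 a c \<Longrightarrow> closed_segment a b \<subseteq> \<Omega> \<Longrightarrow> a $ 1 = b $ 1 \<or> a $ 2 = b $ 2 \<Longrightarrow>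
    axis_path V x0 b (c + segment_integral V a b)"

text \<open>Along a path, the parts of the telescoping sum of quadrant functions that come from the horizontal
  and from the vertical segments; for a closed path they cancel, and either of them is the
  streamfunction of the mollified tangent of the path.\<close>

definition path_parts :: "real^2 \<Rightarrow> real^2 \<Rightarrow> (nat \<Rightarrow> real^2 \<Rightarrow> real) \<Rightarrow> (nat \<Rightarrow> real^2 \<Rightarrow> real) \<Rightarrow> bool" where
  "path_parts x0 x H G \<longleftrightarrow> (\<forall>n. smooth (H n) \<and> smooth (G n)) \<and>
     (\<forall>n z. H n z + G n z = quadrant (1 / Suc n) x0 z - quadrant (1 / Suc n) x z) \<and>
     (\<exists>R. \<forall>n z. (\<bar>z $ 1\<bar> > R \<or> z $ 2 < - R \<longrightarrow> H n z = 0) \<and> (\<bar>z $ 2\<bar> > R \<longrightarrow> G n z = 0)) \<and>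
     (\<exists>K. compact K \<and> K \<subseteq> \<Omega> \<and> (\<forall>\<^sub>F n in sequentially. \<forall>z. z \<notin> K \<longrightarrow>
        partial_deriv 2 (H n) z = 0 \<and> partial_deriv 1 (G n) z = 0))"

lemma segment_parts:
  assumes seg: "closed_segment a b \<subseteq> \<Omega>" and ab: "a $ 1 = b $ 1 \<or> a $ 2 = b $ 2"
  shows "path_parts a b (\<lambda>n. horizontal_part (1 / Suc n) a b) (\<lambda>n. vertical_part (1 / Suc n) a b)"
  unfolding path_parts_def
proof (intro conjI allI)
  show "smooth (horizontal_part (1 / Suc n) a b)" "smooth (vertical_part (1 / Suc n) a b)" for n
    by (rule smooth_parts)+
  show "horizontal_part (1 / Suc n) a b z + vertical_part (1 / Suc n) a b z
      = quadrant (1 / Suc n) a z - quadrant (1 / Suc n) b z" for n z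
    by (simp add: horizontal_part_def vertical_part_def)
  define R where "R = max (norm a) (norm b)"
  have R: "norm a \<le> R" "norm b \<le> R" by (auto simp: R_def)
  show "\<exists>R. \<forall>n z. (\<bar>z $ 1\<bar> > R \<or> z $ 2 < - R \<longrightarrow> horizontal_part (1 / Suc n) a b z = 0)
      \<and> (\<bar>z $ 2\<bar> > R \<longrightarrow> vertical_part (1 / Suc n) a b z = 0)"
    using parts_support[OF _ _ ab R] by (intro exI[of _ "R + 1"]) auto
  obtain d K where d: "d > 0" "compact K" "K \<subseteq> \<Omega>" "\<And>x y. x \<in> closed_segment a b \<Longrightarrow> dist x y \<le> d \<Longrightarrow> y \<in> K"
    using compact_in_open_margin[OF compact_segment open_dom seg] by blast
  \<comment> \<open>The smoothing reaches as far as \<open>2 / Suc n\<close>; once this is below the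
    margin \<open>d\<close>, the derivatives are supported in \<open>K\<close>.\<close>
  have "(\<lambda>n. 2 * inverse (real (Suc n))) \<longlonglongrightarrow> 0"
    using tendsto_mult_right_zero[OF LIMSEQ_inverse_real_of_nat, of 2] .
  then have "\<forall>\<^sub>F n in sequentially. 2 * inverse (real (Suc n)) < d" using d(1) by (rule order_tendstoD(2))
  then have "\<forall>\<^sub>F n in sequentially. \<forall>z. z \<notin> K \<longrightarrow>
        partial_deriv 2 (horizontal_part (1 / Suc n) a b) z = 0 \<and> partial_deriv 1 (vertical_part (1 / Suc n) a b) z = 0"
  proof eventually_elim
    case (elim n)
    have e: "1 / real (Suc n) > 0" by simp
    show ?case
    proof (intro allI impI)
      fix z assume z: "z \<notin> K"
      have "cell_kernel (1 / real (Suc n)) (z - (a + t *\<^sub>R (b - a))) = 0" if t: "t \<in> {0..1}" for t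
      proof (rule ccontr)
        assume "cell_kernel (1 / real (Suc n)) (z - (a + t *\<^sub>R (b - a))) \<noteq> 0"
        from cell_kernel_support[OF e this] have "norm (z - (a + t *\<^sub>R (b - a))) \<le> d"
          using elim by (simp add: inverse_eq_divide)
        then have "dist (a + t *\<^sub>R (b - a)) z \<le> d" by (simp add: dist_norm norm_minus_commute)
        moreover have "a + t *\<^sub>R (b - a) \<in> closed_segment a b"
          using t unfolding closed_segment_def by (auto simp: algebra_simps intro!: exI[of _ t])
        ultimately show False using d(4) z by blast
      qed
      then have "(\<integral>t. cell_kernel (1 / real (Suc n)) (z - (a + t *\<^sub>R (b - a))) \<partial>unit_interval) = (\<integral>t. 0 \<partial>unit_interval)"
        by (intro Bochner_Integration.integral_cong) (auto simp: space_restrict_space)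
      then show "partial_deriv 2 (horizontal_part (1 / Suc n) a b) z = 0 \<and> partial_deriv 1 (vertical_part (1 / Suc n) a b) z = 0"
        unfolding partial_deriv_parts[OF e ab] by simp
    qed
  qed
  then show "\<exists>K. compact K \<and> K \<subseteq> \<Omega> \<and> (\<forall>\<^sub>F n in sequentially. \<forall>z. z \<notin> K \<longrightarrow>
        partial_deriv 2 (horizontal_part (1 / Suc n) a b) z = 0 \<and> partial_deriv 1 (vertical_part (1 / Suc n) a b) z = 0)"
    using d by blast
qed

lemma path_parts_append:
  assumes "path_parts x0 a H G" "path_parts a b H' G'"
  shows "path_parts x0 b (\<lambda>n z. H n z + H' n z) (\<lambda>n z. G n z + G' n z)"
proof -
  have s: "smooth (H n)" "smooth (G n)" "smooth (H' n)" "smooth (G' n)" for n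
    using assms by (auto simp: path_parts_def)
  obtain R where R: "\<And>n z. (\<bar>z $ 1\<bar> > R \<or> z $ 2 < - R \<longrightarrow> H n z = 0) \<and> (\<bar>z $ 2\<bar> > R \<longrightarrow> G n z = 0)"
    using assms(1) unfolding path_parts_def by blast
  obtain R' where R': "\<And>n z. (\<bar>z $ 1\<bar> > R' \<or> z $ 2 < - R' \<longrightarrow> H' n z = 0) \<and> (\<bar>z $ 2\<bar> > R' \<longrightarrow> G' n z = 0)"
    using assms(2) unfolding path_parts_def by blast
  obtain K where K: "compact K" "K \<subseteq> \<Omega>" "\<forall>\<^sub>F n in sequentially. \<forall>z. z \<notin> K \<longrightarrow>
        partial_deriv 2 (H n) z = 0 \<and> partial_deriv 1 (G n) z = 0"
    using assms(1) unfolding path_parts_def by blast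
  obtain K' where K': "compact K'" "K' \<subseteq> \<Omega>" "\<forall>\<^sub>F n in sequentially. \<forall>z. z \<notin> K' \<longrightarrow>
        partial_deriv 2 (H' n) z = 0 \<and> partial_deriv 1 (G' n) z = 0"
    using assms(2) unfolding path_parts_def by blast
  show ?thesis
    unfolding path_parts_def
  proof (intro conjI allI)
    show "smooth (\<lambda>z. H n z + H' n z)" "smooth (\<lambda>z. G n z + G' n z)" for n by (intro smooth_add s)+
    show "H n z + H' n z + (G n z + G' n z) = quadrant (1 / Suc n) x0 z - quadrant (1 / Suc n) b z" for n z
    proof -
      have "H n z + G n z = quadrant (1 / Suc n) x0 z - quadrant (1 / Suc n) a z"
        "H' n z + G' n z = quadrant (1 / Suc n) a z - quadrant (1 / Suc n) b z"
        using assms unfolding path_parts_def by blast+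
      then show ?thesis by linarith
    qed
    have "\<forall>n z. (\<bar>z $ 1\<bar> > max R R' \<or> z $ 2 < - max R R' \<longrightarrow> H n z + H' n z = 0)
        \<and> (\<bar>z $ 2\<bar> > max R R' \<longrightarrow> G n z + G' n z = 0)"
      using R R' by (simp add: max_def)
    then show "\<exists>R. \<forall>n z. (\<bar>z $ 1\<bar> > R \<or> z $ 2 < - R \<longrightarrow> H n z + H' n z = 0) \<and> (\<bar>z $ 2\<bar> > R \<longrightarrow> G n z + G' n z = 0)"
      by blast
    have "\<forall>\<^sub>F n in sequentially. \<forall>z. z \<notin> K \<union> K' \<longrightarrow>
        partial_deriv 2 (\<lambda>z. H n z + H' n z) z = 0 \<and> partial_deriv 1 (\<lambda>z. G n z + G' n z) z = 0"
      using K(3) K'(3) by eventually_elim (simp add: partial_deriv_add s)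
    then show "\<exists>K. compact K \<and> K \<subseteq> \<Omega> \<and> (\<forall>\<^sub>F n in sequentially. \<forall>z. z \<notin> K \<longrightarrow>
        partial_deriv 2 (\<lambda>z. H n z + H' n z) z = 0 \<and> partial_deriv 1 (\<lambda>z. G n z + G' n z) z = 0)"
      using K(1,2) K'(1,2) by (intro exI[of _ "K \<union> K'"]) auto
  qed
qed

lemma axis_path_parts:
  assumes v: "v \<in> l2 vol" and V: "continuous_on \<Omega> V" "AE x in vol. V x = v x"
    and path: "axis_path V x0 x c"
  shows "\<exists>H G. path_parts x0 x H G \<and> (\<lambda>n. flux v (H n) (G n) / cell_mass (1 / Suc n)) \<longlonglongrightarrow> c"
  using path
proof induction
  case start
  have "path_parts x0 x0 (\<lambda>n z. 0) (\<lambda>n z. 0)"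
    unfolding path_parts_def by (auto simp: smooth_const partial_deriv_const intro!: exI[of _ "{}"])
  moreover have "flux v (\<lambda>z. 0) (\<lambda>z. 0) = 0" by (simp add: flux_def partial_deriv_const)
  ultimately show ?case by (intro exI[of _ "\<lambda>n z. 0"]) auto
next
  case (step a c b)
  then obtain H G where HG: "path_parts x0 a H G" "(\<lambda>n. flux v (H n) (G n) / cell_mass (1 / Suc n)) \<longlonglongrightarrow> c"
    by blast
  define H' where "H' n = horizontal_part (1 / Suc n) a b" for n :: nat
  define G' where "G' n = vertical_part (1 / Suc n) a b" for n :: nat
  have p: "path_parts a b H' G'" unfolding H'_def G'_def by (rule segment_parts[OF step(2,3)])
  have s: "smooth (H n)" "smooth (G n)" "smooth (H' n)" "smooth (G' n)" for n
    using HG(1) p by (auto simp: path_parts_def)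
  have "flux v (H' n) (G' n) = (\<integral>z. (v z \<bullet> (b - a)) * (\<integral>t. cell_kernel (1 / Suc n) (z - (a + t *\<^sub>R (b - a))) \<partial>unit_interval) \<partial>vol)" for n
  proof -
    have e: "1 / real (Suc n) > 0" by simp
    show ?thesis
      unfolding flux_def H'_def G'_def partial_deriv_parts[OF e step(3)]
      by (intro Bochner_Integration.integral_cong refl) (simp add: inner_vec2 algebra_simps)
  qed
  then have "(\<lambda>n. flux v (H' n) (G' n) / cell_mass (1 / Suc n)) \<longlonglongrightarrow> segment_integral V a b"
    using mollified_segment_limit[OF v V step(2)] by simp
  from tendsto_add[OF HG(2) this]
  have "(\<lambda>n. flux v (\<lambda>z. H n z + H' n z) (\<lambda>z. G n z + G' n z) / cell_mass (1 / Suc n)) \<longlonglongrightarrow> c + segment_integral V a b"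
    unfolding flux_add[OF v s(1,3,2,4)] add_divide_distrib .
  then show ?case using path_parts_append[OF HG(1) p] by blast
qed

text \<open>The difference of the two families is the streamfunction of the closed path that runs
  along one path and back along the other. Written as \<open>H - H'\<close> it vanishes for large
  first coordinates, written as \<open>G' - G\<close> for large second ones, so its support is
  compact. It is a smoothed winding number and may take nonzero constants in the holes.\<close>

lemma flux_path_independent:
  assumes v: "v \<in> l2 vol" and curl: "\<And>\<psi>. \<psi> \<in> stream_tests \<Longrightarrow> (\<integral>z. v z \<bullet> perp (classical_grad \<psi> z) \<partial>vol) = 0"
    and p: "path_parts x0 x H G" "path_parts x0 x H' G'"
  shows "\<forall>\<^sub>F n in sequentially. flux v (H n) (G n) = flux v (H' n) (G' n)"
proof -
  have s: "smooth (H n)" "smooth (G n)" "smooth (H' n)" "smooth (G' n)" for n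
    using p by (auto simp: path_parts_def)
  obtain R where R: "\<And>n z. (\<bar>z $ 1\<bar> > R \<or> z $ 2 < - R \<longrightarrow> H n z = 0) \<and> (\<bar>z $ 2\<bar> > R \<longrightarrow> G n z = 0)"
    using p(1) unfolding path_parts_def by blast
  obtain R' where R': "\<And>n z. (\<bar>z $ 1\<bar> > R' \<or> z $ 2 < - R' \<longrightarrow> H' n z = 0) \<and> (\<bar>z $ 2\<bar> > R' \<longrightarrow> G' n z = 0)"
    using p(2) unfolding path_parts_def by blast
  obtain K where K: "compact K" "K \<subseteq> \<Omega>" "\<forall>\<^sub>F n in sequentially. \<forall>z. z \<notin> K \<longrightarrow>
        partial_deriv 2 (H n) z = 0 \<and> partial_deriv 1 (G n) z = 0"
    using p(1) unfolding path_parts_def by blast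
  obtain K' where K': "compact K'" "K' \<subseteq> \<Omega>" "\<forall>\<^sub>F n in sequentially. \<forall>z. z \<notin> K' \<longrightarrow>
        partial_deriv 2 (H' n) z = 0 \<and> partial_deriv 1 (G' n) z = 0"
    using p(2) unfolding path_parts_def by blast
  show ?thesis
    using K(3) K'(3)
  proof eventually_elim
    case (elim n)
    define \<psi> where "\<psi> z = H n z - H' n z" for z
    have \<psi>2: "\<psi> z = G' n z - G n z" for z
    proof -
      have "H n z + G n z = H' n z + G' n z" using p unfolding path_parts_def by simp
      then show ?thesis by (simp add: \<psi>_def)
    qed
    have d2: "partial_deriv 2 \<psi> z = partial_deriv 2 (H n) z - partial_deriv 2 (H' n) z" for z
      unfolding \<psi>_def by (rule partial_deriv_diff[OF s(1,3)])
    have d1: "partial_deriv 1 \<psi> z = partial_deriv 1 (G' n) z - partial_deriv 1 (G n) z" for z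
      using partial_deriv_diff[OF s(4,2), of 1 n n z] unfolding \<psi>2[symmetric] .
    have sm: "smooth \<psi>" unfolding \<psi>_def by (intro smooth_diff s)
    have "classical_grad \<psi> z = 0" if "z \<notin> K \<union> K'" for z
      using elim that by (simp add: vec_eq_iff forall_2 d1 d2)
    moreover have "\<psi> z = 0" if "z \<notin> cbox (vector [- max R R', - max R R']) (vector [max R R', max R R'])" for z
    proof -
      have "\<bar>z $ 1\<bar> > max R R' \<or> \<bar>z $ 2\<bar> > max R R'"
        using that by (auto simp: mem_box_cart forall_2 not_le abs_if)
      then show ?thesis
      proof
        assume "\<bar>z $ 1\<bar> > max R R'" then show ?thesis using R[of z n] R'[of z n] by (simp add: \<psi>_def)
      next
        assume "\<bar>z $ 2\<bar> > max R R'" then show ?thesis using R[of z n] R'[of z n] by (simp add: \<psi>2)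
      qed
    qed
    ultimately have "\<psi> \<in> stream_tests"
      unfolding stream_tests_def using sm K(1,2) K'(1,2)
      by (intro CollectI conjI exI[of _ "K \<union> K'"] exI[of _ "cbox (vector [- max R R', - max R R']) (vector [max R R', max R R'] :: real^2)"]) auto
    then have "(\<integral>z. v z \<bullet> perp (classical_grad \<psi> z) \<partial>vol) = 0" by (rule curl)
    moreover have "v z \<bullet> perp (classical_grad \<psi> z)
        = (v z $ 1 * partial_deriv 2 (H n) z + v z $ 2 * partial_deriv 1 (G n) z)
          - (v z $ 1 * partial_deriv 2 (H' n) z + v z $ 2 * partial_deriv 1 (G' n) z)" for z
      by (simp add: inner_vec2 d1 d2 algebra_simps)
    moreover have i: "integrable vol (\<lambda>z. v z $ j * partial_deriv k f z)" if "smooth f" for j k f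
      by (intro l2_mult_integrable l2_nth v smooth_partial_l2 that)
    ultimately show ?case
      using i[OF s(1), of 1 2 n] i[OF s(3), of 1 2 n] i[OF s(2), of 2 1 n] i[OF s(4), of 2 1 n]
      by (simp add: flux_def)
  qed
qed

text \<open>The smoothed circulations of two paths with the same ends eventually coincide, and the
  two values are their limits.\<close>

lemma axis_path_unique:
  assumes "v \<in> l2 vol" "continuous_on \<Omega> V" "AE x in vol. V x = v x"
    and curl: "\<And>\<psi>. \<psi> \<in> stream_tests \<Longrightarrow> (\<integral>z. v z \<bullet> perp (classical_grad \<psi> z) \<partial>vol) = 0"
    and "axis_path V x0 x c" "axis_path V x0 x c'"
  shows "c = c'"
proof -
  obtain H G where 1: "path_parts x0 x H G" "(\<lambda>n. flux v (H n) (G n) / cell_mass (1 / Suc n)) \<longlonglongrightarrow> c"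
    using axis_path_parts[OF assms(1-3,5)] by blast
  obtain H' G' where 2: "path_parts x0 x H' G'" "(\<lambda>n. flux v (H' n) (G' n) / cell_mass (1 / Suc n)) \<longlonglongrightarrow> c'"
    using axis_path_parts[OF assms(1-3,6)] by blast
  have "(\<lambda>n. flux v (H' n) (G' n) / cell_mass (1 / Suc n)) \<longlonglongrightarrow> c"
    by (rule Lim_transform_eventually[OF 1(2)])
       (use flux_path_independent[OF assms(1) curl 1(1) 2(1)] in \<open>auto elim!: eventually_mono\<close>)
  then show ?thesis using 2(2) LIMSEQ_unique by blast
qed

section \<open>The potential of a field without circulation\<close>

lemma axis_path_corner:
  assumes p: "axis_path V x0 x c" and r: "ball x r \<subseteq> \<Omega>" "y \<in> ball x r"
  defines "q \<equiv> (vector [y $ 1, x $ 2] :: real^2)"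
  shows "axis_path V x0 y (c + segment_integral V x q + segment_integral V q y)" "norm (q - x) \<le> norm (y - x)"
    "q - x + (y - q) = y - x" "norm (y - q) \<le> norm (y - x)"
proof -
  have qx: "norm (q - x) = \<bar>y $ 1 - x $ 1\<bar>" "norm (y - q) = \<bar>y $ 2 - x $ 2\<bar>"
    by (simp_all add: q_def norm_vec_def L2_set_def sum_2)
  show n: "norm (q - x) \<le> norm (y - x)" "norm (y - q) \<le> norm (y - x)"
    unfolding qx using component_le_norm_cart[of "y - x" 1] component_le_norm_cart[of "y - x" 2] by simp_all
  show "q - x + (y - q) = y - x" by simp
  \<comment> \<open>The corner is no farther from \<open>x\<close> than \<open>y\<close> is, so
    convexity of the ball keeps both legs inside.\<close>
  have "q \<in> ball x r" using n(1) r(2) by (simp add: dist_norm norm_minus_commute)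
  moreover have "x \<in> ball x r" using r(2) by (auto intro: le_less_trans[OF zero_le_dist])
  ultimately have seg: "closed_segment x q \<subseteq> \<Omega>" "closed_segment q y \<subseteq> \<Omega>"
    using r closed_segment_subset[OF _ _ convex_ball] by blast+
  have "axis_path V x0 q (c + segment_integral V x q)"
    by (rule axis_path.step[OF p seg(1)]) (simp add: q_def)
  then show "axis_path V x0 y (c + segment_integral V x q + segment_integral V q y)"
    by (rule axis_path.step[OF _ seg(2)]) (simp add: q_def)
qed

text \<open>From a reachable point every point of a surrounding ball is reached by one corner. The
  same step, taken from a nearby reachable point, shows that the unreachable points form an open set
  too, and connectedness does the rest.\<close>

lemma axis_path_exists:
  assumes conn: "connected \<Omega>" and x: "x0 \<in> \<Omega>" "x \<in> \<Omega>"
  shows "\<exists>c. axis_path V x0 x c"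
proof -
  define S where "S = {x \<in> \<Omega>. \<exists>c. axis_path V x0 x c}"
  have near: "y \<in> S" if "x \<in> S" "ball x r \<subseteq> \<Omega>" "y \<in> ball x r" for x y r
    using that axis_path_corner(1) unfolding S_def by blast
  have "open S"
    unfolding open_contains_ball
  proof
    fix x assume x: "x \<in> S"
    then obtain r where "r > 0" "ball x r \<subseteq> \<Omega>" using open_dom open_contains_ball unfolding S_def by blast
    then show "\<exists>e>0. ball x e \<subseteq> S" using near[OF x] by blast
  qed
  moreover have "open (\<Omega> - S)"
    unfolding open_contains_ball
  proof
    fix x assume x: "x \<in> \<Omega> - S"
    then obtain r where r: "r > 0" "ball x r \<subseteq> \<Omega>" using open_dom open_contains_ball by blast
    \<comment> \<open>Half the radius leaves room for a ball of that size around \<open>y\<close>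
      that lies in \<Omega> and contains \<open>x\<close>.\<close>
    have "y \<notin> S" if y: "y \<in> ball x (r / 2)" for y
    proof
      assume "y \<in> S"
      moreover have "ball y (r / 2) \<subseteq> \<Omega>"
      proof
        fix z assume "z \<in> ball y (r / 2)"
        then have "dist x z < r" using dist_triangle[of x z y] y by simp
        then show "z \<in> \<Omega>" using r(2) by auto
      qed
      moreover have "x \<in> ball y (r / 2)" using y by (simp add: dist_commute)
      ultimately have "x \<in> S" by (rule near)
      then show False using x by blast
    qed
    moreover have "ball x (r / 2) \<subseteq> \<Omega>" using r by (auto intro: subset_trans[OF subset_ball])
    ultimately show "\<exists>e>0. ball x e \<subseteq> \<Omega> - S" using r(1) by (intro exI[of _ "r / 2"]) auto
  qed
  moreover have "x0 \<in> S" using x(1) axis_path.start by (auto simp: S_def)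
  ultimately have "\<Omega> - S = {}"
    using connectedD[OF conn, of S "\<Omega> - S"] by (auto simp: S_def)
  then show ?thesis using x(2) by (auto simp: S_def)
qed

lemma segment_integral_close:
  assumes V: "continuous_on \<Omega> V" and seg: "closed_segment a b \<subseteq> \<Omega>"
    and close: "\<And>z. z \<in> closed_segment a b \<Longrightarrow> norm (V z - w) \<le> \<eta>"
  shows "\<bar>segment_integral V a b - w \<bullet> (b - a)\<bar> \<le> \<eta> * norm (b - a)"
proof -
  interpret U: finite_measure unit_interval by (rule finite_measure_unit_interval)
  have m1: "measure unit_interval (space unit_interval) = 1"
    by (simp add: measure_def emeasure_restrict_space space_restrict_space)
  have pseg: "a + t *\<^sub>R (b - a) \<in> closed_segment a b" if "t \<in> {0..1}" for t
    using that unfolding closed_segment_def by (auto simp: algebra_simps intro!: exI[of _ t])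
  have "continuous_on {0..1} (\<lambda>t. V (a + t *\<^sub>R (b - a)))"
    by (rule continuous_on_compose2[OF V]) (use pseg seg in \<open>auto intro!: continuous_intros\<close>)
  then have c: "continuous_on {0..1} (\<lambda>t. V (a + t *\<^sub>R (b - a)) \<bullet> (b - a))" by (intro continuous_intros)
  have i: "integrable unit_interval (\<lambda>t. V (a + t *\<^sub>R (b - a)) \<bullet> (b - a))"
    using borel_integrable_compact[OF compact_Icc c] by (simp add: integrable_restrict_space)
  have "segment_integral V a b - w \<bullet> (b - a) = (\<integral>t. (V (a + t *\<^sub>R (b - a)) - w) \<bullet> (b - a) \<partial>unit_interval)"
    using i m1 by (simp add: segment_integral_def inner_diff_left)
  also have "\<bar>\<dots>\<bar> \<le> (\<integral>t. \<eta> * norm (b - a) \<partial>unit_interval)"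
  proof (rule integral_abs_bound_integral)
    show "integrable unit_interval (\<lambda>t. (V (a + t *\<^sub>R (b - a)) - w) \<bullet> (b - a))"
      using i by (simp add: inner_diff_left)
    fix t assume "t \<in> space unit_interval"
    then have "norm (V (a + t *\<^sub>R (b - a)) - w) \<le> \<eta>" using close pseg by (simp add: space_restrict_space)
    then show "\<bar>(V (a + t *\<^sub>R (b - a)) - w) \<bullet> (b - a)\<bar> \<le> \<eta> * norm (b - a)"
      by (intro order_trans[OF Cauchy_Schwarz_ineq2] mult_right_mono) auto
  qed simp
  finally show ?thesis using m1 by simp
qed

text \<open>The potential is the circulation from a base point. Its increment from \<open>x\<close>
  to a nearby \<open>y\<close> is computed along a path with one corner; each of the two legs is at
  most as long as \<open>y - x\<close>, whence the tolerance \<open>e / 2\<close> for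
  \<open>V\<close>.\<close>

lemma potential_exists:
  assumes conn: "connected \<Omega>" and ne: "\<Omega> \<noteq> {}" and v: "v \<in> l2 vol"
    and V: "continuous_on \<Omega> V" "AE x in vol. V x = v x"
    and curl: "\<And>\<psi>. \<psi> \<in> stream_tests \<Longrightarrow> (\<integral>z. v z \<bullet> perp (classical_grad \<psi> z) \<partial>vol) = 0"
  obtains p where "\<And>x. x \<in> \<Omega> \<Longrightarrow> (p has_derivative (\<lambda>h. V x \<bullet> h)) (at x)"
proof -
  obtain x0 where x0: "x0 \<in> \<Omega>" using ne by blast
  define p where "p x = (THE c. axis_path V x0 x c)" for x
  have p: "p x = c" if "axis_path V x0 x c" for x c
    unfolding p_def using that axis_path_unique[OF v V curl] by blast
  have "(p has_derivative (\<lambda>h. V x \<bullet> h)) (at x)" if x: "x \<in> \<Omega>" for x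
    unfolding has_derivative_at_alt
  proof (intro conjI allI impI)
    show "bounded_linear (\<lambda>h. V x \<bullet> h)" by (rule bounded_linear_inner_right)
    fix e :: real assume e: "e > 0"
    obtain r where r: "r > 0" "ball x r \<subseteq> \<Omega>" using open_dom x open_contains_ball by blast
    have "continuous (at x) V" using V(1) open_dom x continuous_on_eq_continuous_at by blast
    then obtain s where s: "s > 0" "\<And>z. dist z x < s \<Longrightarrow> dist (V z) (V x) < e / 2"
      using e unfolding continuous_at_eps_delta by (metis half_gt_zero dist_norm)
    define d where "d = min r s"
    have "norm (p y - p x - V x \<bullet> (y - x)) \<le> e * norm (y - x)" if y: "norm (y - x) < d" for y
    proof -
      define q where "q = (vector [y $ 1, x $ 2] :: real^2)"
      obtain c where c: "axis_path V x0 x c" using axis_path_exists[OF conn x0 x] by blast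
      have yb: "y \<in> ball x d" using y by (simp add: dist_norm norm_minus_commute)
      have db: "ball x d \<subseteq> \<Omega>" using r(2) by (auto simp: d_def)
      note C = axis_path_corner[OF c db yb, folded q_def]
      have qb: "q \<in> ball x d" using C(2) y by (simp add: dist_norm norm_minus_commute)
      have xb: "x \<in> ball x d" using r(1) s(1) by (simp add: d_def)
      have seg: "closed_segment x q \<subseteq> ball x d" "closed_segment q y \<subseteq> ball x d"
        using closed_segment_subset[OF _ _ convex_ball] xb qb yb by blast+
      have cl: "norm (V z - V x) \<le> e / 2" if "z \<in> ball x d" for z
        using s(2)[of z] that by (simp add: d_def dist_norm norm_minus_commute)
      have 1: "\<bar>segment_integral V x q - V x \<bullet> (q - x)\<bar> \<le> e / 2 * norm (q - x)"
        by (rule segment_integral_close[OF V(1)]) (use seg db cl in auto)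
      have 2: "\<bar>segment_integral V q y - V x \<bullet> (y - q)\<bar> \<le> e / 2 * norm (y - q)"
        by (rule segment_integral_close[OF V(1)]) (use seg db cl in auto)
      have "p y - p x = segment_integral V x q + segment_integral V q y"
        using p[OF C(1)] p[OF c] by simp
      moreover have "V x \<bullet> (y - x) = V x \<bullet> (q - x) + V x \<bullet> (y - q)"
        unfolding inner_add_right[symmetric] C(3) ..
      ultimately have "\<bar>p y - p x - V x \<bullet> (y - x)\<bar> \<le> e / 2 * norm (q - x) + e / 2 * norm (y - q)"
        using 1 2 by linarith
      also have "\<dots> \<le> e / 2 * norm (y - x) + e / 2 * norm (y - x)"
        using e C(2,4) by (intro add_mono mult_left_mono) auto
      finally show ?thesis by simp
    qed
    moreover have "d > 0" using r(1) s(1) by (simp add: d_def)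
    ultimately show "\<exists>d>0. \<forall>y. norm (y - x) < d \<longrightarrow> norm (p y - p x - V x \<bullet> (y - x)) \<le> e * norm (y - x)" by blast
  qed
  then show thesis by (rule that)
qed

lemma divfree_orthogonal_eq_0:
  assumes conn: "connected \<Omega>" and ne: "\<Omega> \<noteq> {}" and v: "divfree v"
    and curl: "\<And>\<psi>. \<psi> \<in> stream_tests \<Longrightarrow> (\<integral>z. v z \<bullet> perp (classical_grad \<psi> z) \<partial>vol) = 0"
  shows "l2norm vol v = 0"
proof -
  have vl: "v \<in> l2 vol" by (rule divfree_l2[OF v])
  have "harmonic_field v"
    unfolding harmonic_field_def
    using vl divfree_smooth[OF v test_functions_smooth] curl[OF test_stream_tests] by blast
  then obtain V where V: "continuous_on \<Omega> V" "AE x in vol. V x = v x" by (rule harmonic_field_continuous)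
  obtain p where p: "\<And>x. x \<in> \<Omega> \<Longrightarrow> (p has_derivative (\<lambda>h. V x \<bullet> h)) (at x)"
    using potential_exists[OF conn ne vl V curl] by blast
  have pc: "continuous_on \<Omega> p"
    by (intro continuous_at_imp_continuous_on ballI) (metis p has_derivative_continuous)
  have Vm: "V \<in> borel_measurable vol" by (rule continuous_on_vol[OF V(1)])
  have Vl: "V \<in> l2 vol"
    by (rule l2_dominated(1)[OF vl Vm]) (use V(2) in \<open>auto elim!: eventually_mono\<close>)
  define k where "k n = real (Suc n)" for n
  define c where "c n x = cos (p x / k n)" for n x
  have cm: "c n \<in> borel_measurable vol" for n
    unfolding c_def by (intro continuous_on_vol continuous_intros pc) (simp add: k_def)
  have "(\<integral>x. (c n x) * (norm (v x))\<^sup>2 \<partial>vol) = 0" for n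
  proof -
    \<comment> \<open>The potential \<open>p\<close> itself need not be square integrable on
      \<Omega>; the sine bounds the function by \<open>k n\<close> and multiplies its gradient by a
      cosine.\<close>
    define \<phi> where "\<phi> x = k n * sin (p x / k n)" for x
    have kn: "k n > 0" by (simp add: k_def)
    have D: "(\<phi> has_derivative (\<lambda>h. (c n x *\<^sub>R V x) \<bullet> h)) (at x)" if "x \<in> \<Omega>" for x
    proof -
      have "((\<lambda>t. k n * sin (t / k n)) has_real_derivative cos (p x / k n)) (at (p x))"
        using kn by (auto intro!: derivative_eq_intros)
      from has_derivative_compose[OF p[OF that] this[unfolded has_field_derivative_def]]
      show ?thesis by (simp add: \<phi>_def[abs_def] c_def)
    qed
    have g: "continuous_on \<Omega> (\<lambda>x. c n x *\<^sub>R V x)"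
      unfolding c_def using kn by (intro continuous_intros pc V) auto
    have gl: "(\<lambda>x. c n x *\<^sub>R V x) \<in> l2 vol"
      by (rule l2_scaleR_bounded(1)[OF Vl cm, of _ 1]) (simp add: c_def)
    have \<phi>l: "\<phi> \<in> l2 vol"
    proof (rule vol.l2_bounded[where K="k n"])
      show "\<phi> \<in> borel_measurable vol" unfolding \<phi>_def by (intro continuous_on_vol continuous_intros pc) (use kn in auto)
      show "AE x in vol. norm (\<phi> x) \<le> k n" using kn by (simp add: \<phi>_def abs_mult)
    qed
    have H: "\<phi> \<in> H1 \<Omega>" "AE x in vol. grad \<Omega> \<phi> x = c n x *\<^sub>R V x"
      using H1I[OF \<phi>l gl weak_gradient_C1[OF D g]] by blast+
    have "0 = (\<integral>x. v x \<bullet> grad \<Omega> \<phi> x \<partial>vol)" using v H(1) by (simp add: divfree_def)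
    also have "\<dots> = (\<integral>x. c n x * (norm (v x))\<^sup>2 \<partial>vol)"
    proof (rule integral_cong_AE)
      show "AE x in vol. v x \<bullet> grad \<Omega> \<phi> x = c n x * (norm (v x))\<^sup>2"
        using H(2) V(2) by eventually_elim (simp add: power2_norm_eq_inner)
      show "(\<lambda>x. v x \<bullet> grad \<Omega> \<phi> x) \<in> borel_measurable vol"
        by (intro borel_measurable_inner l2_measurable vl H1D H)
      show "(\<lambda>x. c n x * (norm (v x))\<^sup>2) \<in> borel_measurable vol"
        by (intro borel_measurable_times cm borel_measurable_integrable[OF l2_integrable_norm2[OF vl]])
    qed
    finally show ?thesis by simp
  qed
  moreover have "(\<lambda>n. \<integral>x. (c n x) * (norm (v x))\<^sup>2 \<partial>vol) \<longlonglongrightarrow> (\<integral>x. (norm (v x))\<^sup>2 \<partial>vol)"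
  proof (rule integral_dominated_convergence[where w="\<lambda>x. (norm (v x))\<^sup>2"])
    show "(\<lambda>x. (norm (v x))\<^sup>2) \<in> borel_measurable vol" by (intro borel_measurable_integrable l2_integrable_norm2 vl)
    then show "(\<lambda>x. c n x * (norm (v x))\<^sup>2) \<in> borel_measurable vol" for n by (intro borel_measurable_times cm)
    show "integrable vol (\<lambda>x. (norm (v x))\<^sup>2)" by (rule l2_integrable_norm2[OF vl])
    have "(\<lambda>n. c n x * (norm (v x))\<^sup>2) \<longlonglongrightarrow> 1 * (norm (v x))\<^sup>2" for x
      unfolding c_def k_def by (intro tendsto_intros cos_scaled_tendsto)
    then show "AE x in vol. (\<lambda>n. c n x * (norm (v x))\<^sup>2) \<longlonglongrightarrow> (norm (v x))\<^sup>2" by simp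
    show "AE x in vol. norm (c n x * (norm (v x))\<^sup>2) \<le> (norm (v x))\<^sup>2" for n
      by (auto simp: c_def abs_mult intro!: mult_left_le_one_le)
  qed
  ultimately have "(\<integral>x. (norm (v x))\<^sup>2 \<partial>vol) = 0" by (simp add: LIMSEQ_const_iff)
  then show ?thesis by (simp add: l2norm_def)
qed

section \<open>Density of smooth streamfunctions\<close>

lemma partial_deriv_stream_test:
  assumes \<psi>: "\<psi> \<in> stream_tests" shows "partial_deriv i \<psi> \<in> test_functions \<Omega>"
proof -
  obtain K where K: "compact K" "K \<subseteq> \<Omega>" "\<And>x. x \<notin> K \<Longrightarrow> classical_grad \<psi> x = 0"
    using \<psi> unfolding stream_tests_def by blast
  show ?thesis
    by (rule test_functionsI[OF smooth_partial_deriv[OF stream_tests_smooth[OF \<psi>]] K(1,2)])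
       (rule partial_deriv_eq_0I[OF K(3)])
qed

text \<open>The partial derivatives of \<psi> are test functions even if \<psi> is a nonzero
  constant near part of the boundary, so the weak gradient of \<phi> may be tested with them. The
  two terms cancel by the symmetry of second derivatives.\<close>

lemma divfree_stream_test:
  assumes \<psi>: "\<psi> \<in> stream_tests" shows "divfree (\<lambda>x. perp (classical_grad \<psi> x))"
  unfolding divfree_def
proof (intro conjI ballI)
  note s = stream_tests_smooth[OF \<psi>]
  show "(\<lambda>x. perp (classical_grad \<psi> x)) \<in> l2 vol" by (intro l2_perp smooth_l2 s)
  fix \<phi> assume \<phi>: "\<phi> \<in> H1 \<Omega>"
  note P = H1D[OF \<phi>]
  have i: "integrable vol (\<lambda>x. grad \<Omega> \<phi> x $ j * partial_deriv k \<psi> x)" for j k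
    by (intro l2_mult_integrable l2_nth P smooth_partial_l2 s)
  have w: "(\<integral>x. grad \<Omega> \<phi> x $ j * partial_deriv k \<psi> x \<partial>vol) = - (\<integral>x. \<phi> x * partial_deriv j (partial_deriv k \<psi>) x \<partial>vol)" for j k
    using P(3) partial_deriv_stream_test[OF \<psi>, of k] unfolding has_weak_gradient_iff by simp
  have "(\<integral>x. perp (classical_grad \<psi> x) \<bullet> grad \<Omega> \<phi> x \<partial>vol)
      = (\<integral>x. grad \<Omega> \<phi> x $ 1 * partial_deriv 2 \<psi> x - grad \<Omega> \<phi> x $ 2 * partial_deriv 1 \<psi> x \<partial>vol)"
    by (intro Bochner_Integration.integral_cong refl) (simp add: inner_vec2 algebra_simps)
  also have "\<dots> = 0"
    using i w[of 1 2] w[of 2 1] by (simp add: partial_deriv_commute[OF s, of 1 2])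
  finally show "(\<integral>x. perp (classical_grad \<psi> x) \<bullet> grad \<Omega> \<phi> x \<partial>vol) = 0" .
qed

text \<open>Projection onto the closure of the rotated gradients: orthogonality to gradients passes
  to the limit, so the residual is again divergence free; being orthogonal to all rotated gradients
  as well, it vanishes.\<close>

lemma stream_tests_dense:
  assumes conn: "connected \<Omega>" and ne: "\<Omega> \<noteq> {}" and u: "divfree u"
  shows "\<exists>\<psi>. (\<forall>n::nat. \<psi> n \<in> stream_tests) \<and> (\<lambda>n. l2norm vol (\<lambda>x. perp (classical_grad (\<psi> n) x) - u x)) \<longlonglongrightarrow> 0"
proof -
  define W where "W = (\<lambda>\<psi> x. perp (classical_grad \<psi> x)) ` stream_tests"
  have ul: "u \<in> l2 vol" by (rule divfree_l2[OF u])
  have Wl: "W \<subseteq> l2 vol" unfolding W_def using l2_perp(1)[OF smooth_l2(2)[OF stream_tests_smooth]] by blast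
  have W0: "(\<lambda>x. 0) \<in> W"
    unfolding W_def by (rule image_eqI[OF _ stream_tests_zero]) (simp add: fun_eq_iff vec_eq_iff forall_2)
  have Wadd: "(\<lambda>x. f x + c *\<^sub>R g x) \<in> W" if fg: "f \<in> W" "g \<in> W" for f g c
  proof -
    obtain \<psi> \<psi>' where \<psi>: "\<psi> \<in> stream_tests" "\<psi>' \<in> stream_tests"
      "f = (\<lambda>x. perp (classical_grad \<psi> x))" "g = (\<lambda>x. perp (classical_grad \<psi>' x))"
      using fg unfolding W_def by blast
    have "(\<lambda>x. f x + c *\<^sub>R g x) = (\<lambda>x. perp (classical_grad (\<lambda>x. \<psi> x + c * \<psi>' x) x))"
      unfolding \<psi>(3,4) stream_tests_lincomb(2)[OF \<psi>(1,2)] by (simp add: perp_add perp_scaleR)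
    then show ?thesis unfolding W_def using stream_tests_lincomb(1)[OF \<psi>(1,2)] by blast
  qed
  obtain w F where w: "w \<in> l2 vol" and F: "\<And>n::nat. F n \<in> W" "(\<lambda>n. l2norm vol (\<lambda>x. F n x - w x)) \<longlonglongrightarrow> 0"
    and orth: "\<And>g. g \<in> W \<Longrightarrow> (\<integral>x. (u x - w x) \<bullet> g x \<partial>vol) = 0"
    using vol.l2norm_projection[OF Wl W0 Wadd ul] by blast
  have Fl: "F n \<in> l2 vol" for n using F(1) Wl by blast
  have "divfree (\<lambda>x. u x - w x)"
    unfolding divfree_def
  proof (intro conjI ballI)
    show "(\<lambda>x. u x - w x) \<in> l2 vol" by (intro l2_diff ul w)
    fix \<phi> assume \<phi>: "\<phi> \<in> H1 \<Omega>"
    note P = H1D[OF \<phi>]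
    have "(\<integral>x. F n x \<bullet> grad \<Omega> \<phi> x \<partial>vol) = 0" for n
      using F(1)[of n] divfree_stream_test \<phi> by (auto simp: W_def divfree_def)
    then have "(\<integral>x. w x \<bullet> grad \<Omega> \<phi> x \<partial>vol) = 0"
      using tendsto_integral_inner[OF Fl w P(2) F(2)] by (simp add: LIMSEQ_const_iff)
    moreover have "(\<integral>x. u x \<bullet> grad \<Omega> \<phi> x \<partial>vol) = 0" using u \<phi> by (simp add: divfree_def)
    ultimately show "(\<integral>x. (u x - w x) \<bullet> grad \<Omega> \<phi> x \<partial>vol) = 0"
      using l2_inner[OF ul P(2)] l2_inner[OF w P(2)] by (simp add: inner_diff_left)
  qed
  moreover have "(\<integral>z. (u z - w z) \<bullet> perp (classical_grad \<psi> z) \<partial>vol) = 0" if "\<psi> \<in> stream_tests" for \<psi>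
    using orth that by (auto simp: W_def)
  ultimately have z: "l2norm vol (\<lambda>x. u x - w x) = 0" by (rule divfree_orthogonal_eq_0[OF conn ne])
  have "\<exists>\<psi>. \<forall>n. \<psi> n \<in> stream_tests \<and> F n = (\<lambda>x. perp (classical_grad (\<psi> n) x))"
    using F(1) unfolding W_def by (intro choice) blast
  then obtain \<psi> where \<psi>: "\<And>n. \<psi> n \<in> stream_tests" "\<And>n. F n = (\<lambda>x. perp (classical_grad (\<psi> n) x))" by blast
  have "(\<lambda>n. l2norm vol (\<lambda>x. F n x - u x)) \<longlonglongrightarrow> 0"
  proof (rule Lim_null_comparison[OF _ F(2)], intro always_eventually allI)
    fix n
    show "norm (l2norm vol (\<lambda>x. F n x - u x)) \<le> l2norm vol (\<lambda>x. F n x - w x)"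
      using l2norm_triangle3[OF Fl w ul, of n] z by (simp add: l2norm_minus_commute[of vol w u])
  qed
  then show ?thesis using \<psi> by auto
qed

end

section \<open>The lower bound\<close>

context planar_domain
begin

text \<open>The form is evaluated at \<theta> = 0 and at a test function \<psi> of nonzero energy,
  where only the term with \<open>a\<close> is left.\<close>

lemma quadratic_form_nonneg_coeff:
  assumes "\<Omega> \<noteq> {}" "\<xi> \<in> H10 \<Omega>" "quadratic_form_nonneg \<Omega> Pe a \<xi>"
  shows "0 \<le> a"
proof -
  obtain \<psi> where \<psi>: "\<psi> \<in> test_functions \<Omega>" "l2norm vol (classical_grad \<psi>) \<noteq> 0"
    using exists_test_energy[OF assms(1)] by blast
  have "\<psi> \<in> streamfunctions \<Omega>" by (intro stream_tests_streamfunctions test_stream_tests \<psi>)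
  then have "0 \<le> quadratic_form \<Omega> Pe a \<xi> \<psi> (\<lambda>x. 0)"
    using assms(3) test_H10[OF test_functions_zero] by (auto simp: quadratic_form_nonneg_def)
  also have "\<dots> = a * (l2norm vol (classical_grad \<psi>))\<^sup>2"
    using quadratic_form_smooth[OF assms(2) test_functions_smooth[OF \<psi>(1)] test_functions_zero]
    by (simp add: l2norm_def)
  finally show ?thesis using \<psi>(2) by (simp add: zero_le_mult_iff)
qed

lemma l2_mult_test_grad:
  "\<xi> \<in> l2 vol \<Longrightarrow> \<theta> \<in> test_functions \<Omega> \<Longrightarrow> (\<lambda>x. \<xi> x *\<^sub>R classical_grad \<theta> x) \<in> l2 vol"
  by (intro l2_mult_smooth_grad test_functions_smooth)

text \<open>Approximating streamfunctions, scaled so that \<open>Pe\<close> cancels, turn the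
  positivity of the form into an inequality for \<open>u\<close>. The limit is safe because
  \<open>h\<close> is square integrable; the norm bound on \<open>u\<close> together with
  \<open>0 \<le> a\<close> removes the factor of \<open>a\<close>.\<close>

lemma quadratic_form_nonneg_velocity:
  assumes conn: "connected \<Omega>" and ne: "\<Omega> \<noteq> {}"
    and \<xi>: "\<xi> \<in> H10 \<Omega>" and Q: "quadratic_form_nonneg \<Omega> Pe a \<xi>"
    and u: "divfree u" "l2norm vol u \<le> Pe" and \<theta>: "\<theta> \<in> test_functions \<Omega>"
  shows "(\<integral>x. \<xi> x * (u x \<bullet> classical_grad \<theta> x) \<partial>vol) \<le> a + (l2norm vol (classical_grad \<theta>))\<^sup>2"
proof -
  have a: "0 \<le> a" by (rule quadratic_form_nonneg_coeff[OF ne \<xi> Q])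
  note s = test_functions_smooth[OF \<theta>] and ul = divfree_l2[OF u(1)]
  have Pe: "0 \<le> Pe" using u(2) l2norm_nonneg[of vol u] by linarith
  define h where "h x = \<xi> x *\<^sub>R classical_grad \<theta> x" for x
  have hl: "h \<in> l2 vol" unfolding h_def using H1D(1)[OF H10_H1[OF \<xi>]] \<theta> by (rule l2_mult_test_grad)
  have hint: "(\<integral>x. \<xi> x * (w x \<bullet> classical_grad \<theta> x) \<partial>vol) = (\<integral>x. w x \<bullet> h x \<partial>vol)" for w
    by (simp add: h_def)
  show ?thesis
  proof (cases "Pe = 0")
    \<comment> \<open>For \<open>Pe = 0\<close> the norm of \<open>u\<close> is 0, so the left side
      is 0 and the sign of \<open>a\<close> decides.\<close>
    case True
    then have "l2norm vol u = 0" using u(2) l2norm_nonneg[of vol u] by linarith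
    then have "\<bar>\<integral>x. u x \<bullet> h x \<partial>vol\<bar> \<le> 0" using l2norm_Cauchy_Schwarz[OF ul hl] by simp
    then show ?thesis using a by (simp add: hint)
  next
    case False
    obtain \<psi> where \<psi>: "\<And>n::nat. \<psi> n \<in> stream_tests"
      "(\<lambda>n. l2norm vol (\<lambda>x. perp (classical_grad (\<psi> n) x) - u x)) \<longlonglongrightarrow> 0"
      using stream_tests_dense[OF conn ne u(1)] by blast
    note s\<psi> = stream_tests_smooth[OF \<psi>(1)]
    have pl: "(\<lambda>x. perp (classical_grad (\<psi> n) x)) \<in> l2 vol" for n by (intro l2_perp smooth_l2 s\<psi>)
    have ineq: "(\<integral>x. perp (classical_grad (\<psi> n) x) \<bullet> h x \<partial>vol)
        \<le> a * (l2norm vol (\<lambda>x. perp (classical_grad (\<psi> n) x)) / Pe)\<^sup>2 + (l2norm vol (classical_grad \<theta>))\<^sup>2" for n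
    proof -
      \<comment> \<open>\<open>Pe\<close> times the rotated gradient of \<zeta> is that of
        \<open>\<psi> n\<close>, which approximates \<open>u\<close>. The summand 0 gives \<zeta>
        the shape of a combination with the zero function.\<close>
      define \<zeta> where "\<zeta> x = 0 + (1 / Pe) * \<psi> n x" for x
      have \<zeta>: "\<zeta> \<in> stream_tests" "classical_grad \<zeta> = (\<lambda>x. (1 / Pe) *\<^sub>R classical_grad (\<psi> n) x)"
        unfolding \<zeta>_def using stream_tests_lincomb[OF stream_tests_zero \<psi>(1), of "1 / Pe" n] by auto
      have "0 \<le> quadratic_form \<Omega> Pe a \<xi> \<zeta> \<theta>"
        using Q stream_tests_streamfunctions[OF \<zeta>(1)] test_H10[OF \<theta>]
        by (auto simp: quadratic_form_nonneg_def)
      also have "\<dots> = a * ((1 / Pe) * l2norm vol (classical_grad (\<psi> n)))\<^sup>2 + (l2norm vol (classical_grad \<theta>))\<^sup>2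
          - Pe * (\<integral>x. (1 / Pe) * (perp (classical_grad (\<psi> n) x) \<bullet> h x) \<partial>vol)"
        using Pe unfolding quadratic_form_smooth[OF \<xi> stream_tests_smooth[OF \<zeta>(1)] \<theta>] \<zeta>(2)
          l2_scaleR(2)[OF smooth_l2(2)[OF s\<psi>]] hint
        by (simp add: perp_scaleR)
      finally show ?thesis using False by (simp add: l2_perp(2))
    qed
    have "(\<integral>x. u x \<bullet> h x \<partial>vol) \<le> a * (l2norm vol u / Pe)\<^sup>2 + (l2norm vol (classical_grad \<theta>))\<^sup>2"
    proof (rule LIMSEQ_le[OF tendsto_integral_inner[OF pl ul hl \<psi>(2)]])
      show "(\<lambda>n. a * (l2norm vol (\<lambda>x. perp (classical_grad (\<psi> n) x)) / Pe)\<^sup>2 + (l2norm vol (classical_grad \<theta>))\<^sup>2)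
         \<longlonglongrightarrow> a * (l2norm vol u / Pe)\<^sup>2 + (l2norm vol (classical_grad \<theta>))\<^sup>2"
        using False by (intro tendsto_intros tendsto_n2[OF pl ul \<psi>(2)])
    qed (use ineq in blast)
    also have "a * (l2norm vol u / Pe)\<^sup>2 \<le> a * 1"
      using u(2) False Pe by (intro mult_left_mono a power_le_one) auto
    finally show ?thesis by (simp add: hint)
  qed
qed

text \<open>At \<open>t = 1 / N\<close> and \<open>t = - 1 / N\<close> the quadratic term is 1,
  which gives the bound from both sides. For \<open>N = 0\<close> the linear function
  \<open>t * L\<close> is bounded above, so \<open>L = 0\<close>.\<close>

lemma linear_bound_of_quadratic_bound:
  fixes L a N :: real
  assumes "\<And>t. t * L \<le> a + t\<^sup>2 * N\<^sup>2" "0 \<le> N"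
  shows "\<bar>L\<bar> \<le> (\<bar>a\<bar> + 1) * N"
proof (cases "N = 0")
  case True
  have "L = 0"
  proof (rule ccontr)
    assume "L \<noteq> 0"
    then show False using assms(1)[of "(a + 1) / L"] True by simp
  qed
  then show ?thesis using True by simp
next
  case False
  then have N: "N > 0" using assms(2) by simp
  have "L / N \<le> a + 1" using assms(1)[of "1 / N"] N by (simp add: power_divide)
  moreover have "- (L / N) \<le> a + 1" using assms(1)[of "- 1 / N"] N by (simp add: power_divide)
  ultimately have "\<bar>L\<bar> / N \<le> \<bar>a\<bar> + 1" using N by (auto simp: abs_if)
  then show ?thesis using N by (simp add: pos_divide_le_eq)
qed

section \<open>The estimate for one velocity and one pair \<open>(a, \<xi>)\<close>\<close>

lemma H_minus_1_tendsto:
  assumes f: "f \<in> H_minus_1 \<Omega>" and \<xi>: "\<xi> \<in> H10 \<Omega>" and \<phi>: "\<And>n. \<phi> n \<in> test_functions \<Omega>"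
    and "(\<lambda>n. l2norm vol (\<lambda>x. \<phi> n x - \<xi> x)) \<longlonglongrightarrow> 0"
    and "(\<lambda>n. l2norm vol (\<lambda>x. classical_grad (\<phi> n) x - grad \<Omega> \<xi> x)) \<longlonglongrightarrow> 0"
  shows "(\<lambda>n. f (\<phi> n)) \<longlonglongrightarrow> f \<xi>"
proof -
  obtain C where C: "\<And>\<zeta>. \<zeta> \<in> H10 \<Omega> \<Longrightarrow> \<bar>f \<zeta>\<bar> \<le> C * H1_norm \<Omega> \<zeta>"
    using f unfolding H_minus_1_def by blast
  have fa: "\<forall>\<xi>\<in>H10 \<Omega>. \<forall>\<zeta>\<in>H10 \<Omega>. f (\<lambda>x. \<xi> x + \<zeta> x) = f \<xi> + f \<zeta>"
    and fm: "\<forall>\<xi>\<in>H10 \<Omega>. \<forall>c. f (\<lambda>x. c * \<xi> x) = c * f \<xi>"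
    using f unfolding H_minus_1_def by blast+
  have m: "(\<lambda>x. -1 * \<xi> x) \<in> H10 \<Omega>" using H10_lincomb[OF test_H10[OF test_functions_zero] \<xi>, of "-1"] by simp
  have eq: "f (\<phi> n) - f \<xi> = f (\<lambda>x. \<phi> n x - \<xi> x)" "(\<lambda>x. \<phi> n x - \<xi> x) \<in> H10 \<Omega>" for n
  proof -
    have add: "f (\<lambda>x. \<phi> n x + (-1 * \<xi> x)) = f (\<phi> n) + f (\<lambda>x. -1 * \<xi> x)"
      by (rule fa[rule_format, OF test_H10[OF \<phi>] m])
    have "f (\<lambda>x. -1 * \<xi> x) = -1 * f \<xi>" by (rule fm[rule_format, OF \<xi>])
    with add show "f (\<phi> n) - f \<xi> = f (\<lambda>x. \<phi> n x - \<xi> x)" by simp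
    show "(\<lambda>x. \<phi> n x - \<xi> x) \<in> H10 \<Omega>" using H10_lincomb[OF test_H10[OF \<phi>] \<xi>, of n "-1"] by simp
  qed
  have "(\<lambda>n. H1_norm \<Omega> (\<lambda>x. \<phi> n x - \<xi> x)) \<longlonglongrightarrow> 0"
    unfolding H1_norm_tendsto_0_iff l2norm_grad_diff_smooth[OF test_functions_smooth[OF \<phi>] H10_H1[OF \<xi>]]
    using assms(4,5) by blast
  then have "(\<lambda>n. C * H1_norm \<Omega> (\<lambda>x. \<phi> n x - \<xi> x)) \<longlonglongrightarrow> 0" by (intro tendsto_mult_right_zero)
  then have "(\<lambda>n. f (\<phi> n) - f \<xi>) \<longlonglongrightarrow> 0"
    by (rule Lim_null_comparison[rotated]) (use C[OF eq(2)] in \<open>simp add: eq(1)\<close>)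
  then show ?thesis by (simp add: LIM_zero_iff)
qed

lemma dirichlet_energy_lower_bound:
  assumes conn: "connected \<Omega>" and ne: "\<Omega> \<noteq> {}"
    and f: "f \<in> H_minus_1 \<Omega>" and u: "divfree u" "l2norm vol u \<le> Pe"
    and T: "weak_solution \<Omega> f u T" and \<xi>: "\<xi> \<in> H10 \<Omega>" and Q: "quadratic_form_nonneg \<Omega> Pe a \<xi>"
  shows "f \<xi> - 1/4 * dirichlet_energy \<Omega> \<xi> - a \<le> dirichlet_energy \<Omega> T"
proof -
  have T10: "T \<in> H10 \<Omega>" using T by (simp add: weak_solution_def)
  note ul = divfree_l2[OF u(1)] and TH = H10_H1[OF T10] and XH = H10_H1[OF \<xi>]
  note TD = H1D[OF TH] and XD = H1D[OF XH]
  obtain \<tau> where \<tau>: "\<And>n::nat. \<tau> n \<in> test_functions \<Omega>" "(\<lambda>n. l2norm vol (\<lambda>x. \<tau> n x - T x)) \<longlonglongrightarrow> 0"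
    "(\<lambda>n. l2norm vol (\<lambda>x. classical_grad (\<tau> n) x - grad \<Omega> T x)) \<longlonglongrightarrow> 0" "AE x in vol. (\<lambda>n. \<tau> n x) \<longlonglongrightarrow> T x"
    using H10_approx[OF T10] by blast
  obtain \<eta> where \<eta>: "\<And>n::nat. \<eta> n \<in> test_functions \<Omega>" "(\<lambda>n. l2norm vol (\<lambda>x. \<eta> n x - \<xi> x)) \<longlonglongrightarrow> 0"
    "(\<lambda>n. l2norm vol (\<lambda>x. classical_grad (\<eta> n) x - grad \<Omega> \<xi> x)) \<longlonglongrightarrow> 0" "AE x in vol. (\<lambda>n. \<eta> n x) \<longlonglongrightarrow> \<xi> x"
    using H10_approx[OF \<xi>] by blast
  note s\<tau> = test_functions_smooth[OF \<tau>(1)] and s\<eta> = test_functions_smooth[OF \<eta>(1)]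
  \<comment> \<open>Advection of \<theta> tested with \<open>X\<close>; the first argument will
    always be smooth, so that this is a genuine integral.\<close>
  define adv where "adv X \<theta> = (\<integral>x. X x * (u x \<bullet> grad \<Omega> \<theta> x) \<partial>vol)" for X \<theta>
  have adv_add: "adv (\<lambda>x. X x + c * Y x) \<theta> = adv X \<theta> + c * adv Y \<theta>"
    if "smooth X" "smooth Y" "\<theta> \<in> H1 \<Omega>" for X Y c \<theta>
    using integrable_advection_smooth[OF ul that(1) H1D(2)[OF that(3)]]
      integrable_advection_smooth[OF ul that(2) H1D(2)[OF that(3)]]
    by (simp add: adv_def distrib_right mult.assoc)
  have adv_sum: "adv X (\<lambda>x. T x + 1 * \<xi> x) = adv X T + adv X \<xi>" if X: "smooth X" for X
  proof -
    have "adv X (\<lambda>x. T x + 1 * \<xi> x) = (\<integral>x. X x * (u x \<bullet> grad \<Omega> T x) + X x * (u x \<bullet> grad \<Omega> \<xi> x) \<partial>vol)"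
      unfolding adv_def
    proof (rule integral_cong_AE)
      show "AE x in vol. X x * (u x \<bullet> grad \<Omega> (\<lambda>x. T x + 1 * \<xi> x) x)
          = X x * (u x \<bullet> grad \<Omega> T x) + X x * (u x \<bullet> grad \<Omega> \<xi> x)"
        using H1_lincomb(2)[OF TH XH, of 1] by eventually_elim (simp add: inner_add_right distrib_left)
    qed (intro borel_measurable_add borel_measurable_times borel_measurable_inner l2_measurable smooth_l2 X ul H1D
        H1_lincomb TH XH)+
    then show ?thesis
      using integrable_advection_smooth[OF ul X TD(2)] integrable_advection_smooth[OF ul X XD(2)]
      by (simp add: adv_def)
  qed
  have advT: "adv X T = f X - (\<integral>x. classical_grad X x \<bullet> grad \<Omega> T x \<partial>vol)" if X: "X \<in> test_functions \<Omega>" for X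
  proof -
    have sX: "smooth X" by (rule test_functions_smooth[OF X])
    have "(\<integral>x. grad \<Omega> X x \<bullet> grad \<Omega> T x \<partial>vol) + advection \<Omega> X u T - f X = 0"
      using T test_H10[OF X] unfolding weak_solution_def set_lint_eq by blast
    \<comment> \<open>A test function is bounded, so the term is the plain integral by definition
      and not the definite description.\<close>
    moreover have "advection \<Omega> X u T = adv X T"
      using test_L_infinity[OF X] by (simp add: advection_def advection_bounded_def set_lint_eq adv_def)
    moreover have "(\<integral>x. grad \<Omega> X x \<bullet> grad \<Omega> T x \<partial>vol) = (\<integral>x. classical_grad X x \<bullet> grad \<Omega> T x \<partial>vol)"
    proof (rule integral_cong_AE)
      show "AE x in vol. grad \<Omega> X x \<bullet> grad \<Omega> T x = classical_grad X x \<bullet> grad \<Omega> T x"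
        using smooth_H1(2)[OF sX] by eventually_elim simp
    qed (intro borel_measurable_inner l2_measurable smooth_l2 H1D smooth_H1 sX TH)+
    ultimately show ?thesis by linarith
  qed
  have adv\<xi>: "adv X \<xi> = - (\<integral>x. \<xi> x * (u x \<bullet> classical_grad X x) \<partial>vol)" if "smooth X" for X
    unfolding adv_def by (rule advection_antisymmetric[OF u(1) that XH])
  obtain Cf where Cf: "\<And>\<zeta>. \<zeta> \<in> H10 \<Omega> \<Longrightarrow> \<bar>f \<zeta>\<bar> \<le> Cf * H1_norm \<Omega> \<zeta>"
    using f unfolding H_minus_1_def by blast
  define C where "C = \<bar>Cf\<bar> + l2norm vol (grad \<Omega> T) + (\<bar>a\<bar> + 1)"
  have C1: "\<bar>adv X T\<bar> \<le> (\<bar>Cf\<bar> + l2norm vol (grad \<Omega> T)) * (l2norm vol X + l2norm vol (classical_grad X))"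
    if X: "X \<in> test_functions \<Omega>" for X
  proof -
    have sX: "smooth X" by (rule test_functions_smooth[OF X])
    have "\<bar>f X\<bar> \<le> Cf * H1_norm \<Omega> X" by (rule Cf[OF test_H10[OF X]])
    also have "\<dots> \<le> \<bar>Cf\<bar> * H1_norm \<Omega> X" by (intro mult_right_mono H1_norm_bounds) simp
    also have "\<dots> \<le> \<bar>Cf\<bar> * (l2norm vol X + l2norm vol (classical_grad X))"
      using H1_norm_bounds(3)[of X] by (intro mult_left_mono) (simp_all add: l2norm_grad_smooth[OF sX])
    finally have "\<bar>f X\<bar> \<le> \<bar>Cf\<bar> * (l2norm vol X + l2norm vol (classical_grad X))" .
    moreover have "\<bar>\<integral>x. classical_grad X x \<bullet> grad \<Omega> T x \<partial>vol\<bar> \<le> l2norm vol (classical_grad X) * l2norm vol (grad \<Omega> T)"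
      by (intro l2norm_Cauchy_Schwarz smooth_l2 sX TD)
    moreover have "l2norm vol (classical_grad X) * l2norm vol (grad \<Omega> T) \<le> l2norm vol (grad \<Omega> T) * (l2norm vol X + l2norm vol (classical_grad X))"
      by (subst mult.commute) (intro mult_left_mono, simp_all)
    ultimately show ?thesis unfolding advT[OF X] by (simp add: distrib_right)
  qed
  \<comment> \<open>The inequality holds for all multiples of \<open>X\<close>, with one side linear
    and the other quadratic in the factor; this leaves a bound that is linear in the norm of the
    gradient.\<close>
  have C2: "\<bar>adv X \<xi>\<bar> \<le> (\<bar>a\<bar> + 1) * (l2norm vol X + l2norm vol (classical_grad X))"
    if X: "X \<in> test_functions \<Omega>" for X
  proof -
    have sX: "smooth X" by (rule test_functions_smooth[OF X])
    have "\<bar>adv X \<xi>\<bar> \<le> (\<bar>a\<bar> + 1) * l2norm vol (classical_grad X)"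
    proof (rule linear_bound_of_quadratic_bound)
      fix t :: real
      \<comment> \<open>The sign of \<open>- t\<close> compensates the sign from the
        antisymmetry.\<close>
      define Y where "Y x = (- t) * X x" for x
      have Y: "Y \<in> test_functions \<Omega>" unfolding Y_def by (intro test_functions_cmult X)
      have gY: "classical_grad Y = (\<lambda>x. (- t) *\<^sub>R classical_grad X x)"
        unfolding Y_def by (intro ext classical_grad_cmult smooth_differentiable sX)
      have "(\<integral>x. \<xi> x * (u x \<bullet> classical_grad Y x) \<partial>vol) = (\<integral>x. (- t) * (\<xi> x * (u x \<bullet> classical_grad X x)) \<partial>vol)"
        by (intro Bochner_Integration.integral_cong) (auto simp: gY)
      also have "\<dots> = t * adv X \<xi>" unfolding adv\<xi>[OF sX] integral_mult_right_zero by simp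
      finally have "t * adv X \<xi> \<le> a + (l2norm vol (classical_grad Y))\<^sup>2"
        using quadratic_form_nonneg_velocity[OF conn ne \<xi> Q u Y] by simp
      also have "(l2norm vol (classical_grad Y))\<^sup>2 = t\<^sup>2 * (l2norm vol (classical_grad X))\<^sup>2"
        unfolding gY l2_scaleR(2)[OF smooth_l2(2)[OF sX]] by (simp add: power_mult_distrib)
      finally show "t * adv X \<xi> \<le> a + t\<^sup>2 * (l2norm vol (classical_grad X))\<^sup>2" .
    qed simp
    also have "\<dots> \<le> (\<bar>a\<bar> + 1) * (l2norm vol X + l2norm vol (classical_grad X))"
      by (intro mult_left_mono) auto
    finally show ?thesis .
  qed
  have l1: "(\<lambda>n. adv (\<tau> n) T) \<longlonglongrightarrow> 0"
    unfolding adv_def by (rule advection_self_tendsto_0[OF u(1) TH \<tau>]) (use C1 in \<open>simp add: adv_def\<close>)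
  have l2: "(\<lambda>n. adv (\<eta> n) \<xi>) \<longlonglongrightarrow> 0"
    unfolding adv_def by (rule advection_self_tendsto_0[OF u(1) XH \<eta>]) (use C2 in \<open>simp add: adv_def\<close>)
  \<comment> \<open>The sum of the two sequences approximates \<open>T + \<xi>\<close>; the factor 1
    keeps the shape of the lemmas on linear combinations.\<close>
  define \<zeta> where "\<zeta> n x = \<tau> n x + 1 * \<eta> n x" for n x
  note H = H1_lincomb[OF TH XH, of 1]
  have cg: "classical_grad (\<lambda>x. \<tau> n x + c * \<eta> n x) x = classical_grad (\<tau> n) x + c *\<^sub>R classical_grad (\<eta> n) x" for c n x
    by (rule stream_tests_lincomb(2)[OF test_stream_tests[OF \<tau>(1)] test_stream_tests[OF \<eta>(1)]])
  have l3: "(\<lambda>n. adv (\<zeta> n) (\<lambda>x. T x + 1 * \<xi> x)) \<longlonglongrightarrow> 0"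
    unfolding adv_def
  proof (rule advection_self_tendsto_0[OF u(1) H(1)])
    show \<zeta>t: "\<zeta> n \<in> test_functions \<Omega>" for n
      unfolding \<zeta>_def by (intro test_functions_add test_functions_cmult \<tau> \<eta>)
    show "(\<lambda>n. l2norm vol (\<lambda>x. \<zeta> n x - (T x + 1 * \<xi> x))) \<longlonglongrightarrow> 0"
      using l2norm_tendsto_lincomb[OF _ TD(1) _ XD(1) \<tau>(2) \<eta>(2), of 1] smooth_l2(1)[OF s\<tau>] smooth_l2(1)[OF s\<eta>]
      by (simp add: \<zeta>_def)
    have "l2norm vol (\<lambda>x. classical_grad (\<zeta> n) x - grad \<Omega> (\<lambda>x. T x + 1 * \<xi> x) x)
        = l2norm vol (\<lambda>x. (classical_grad (\<tau> n) x + 1 *\<^sub>R classical_grad (\<eta> n) x) - (grad \<Omega> T x + 1 *\<^sub>R grad \<Omega> \<xi> x))" for n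
    proof (rule l2norm_cong_AE)
      show "AE x in vol. classical_grad (\<zeta> n) x - grad \<Omega> (\<lambda>x. T x + 1 * \<xi> x) x
         = (classical_grad (\<tau> n) x + 1 *\<^sub>R classical_grad (\<eta> n) x) - (grad \<Omega> T x + 1 *\<^sub>R grad \<Omega> \<xi> x)"
        using H(2) unfolding \<zeta>_def cg by eventually_elim simp
    qed (intro l2_measurable l2_diff l2_add l2_scaleR smooth_l2 test_functions_smooth[OF \<zeta>t] s\<tau> s\<eta> TD XD H1D H)+
    then show "(\<lambda>n. l2norm vol (\<lambda>x. classical_grad (\<zeta> n) x - grad \<Omega> (\<lambda>x. T x + 1 * \<xi> x) x)) \<longlonglongrightarrow> 0"
      using l2norm_tendsto_lincomb[OF _ TD(2) _ XD(2) \<tau>(3) \<eta>(3), of 1] smooth_l2(2)[OF s\<tau>] smooth_l2(2)[OF s\<eta>] by simp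
    show "AE x in vol. (\<lambda>n. \<zeta> n x) \<longlonglongrightarrow> T x + 1 * \<xi> x"
      using \<tau>(4) \<eta>(4) unfolding \<zeta>_def by eventually_elim (intro tendsto_intros)
    fix X assume X: "X \<in> test_functions \<Omega>"
    show "\<bar>\<integral>x. X x * (u x \<bullet> grad \<Omega> (\<lambda>x. T x + 1 * \<xi> x) x) \<partial>vol\<bar> \<le> C * (l2norm vol X + l2norm vol (classical_grad X))"
      using adv_sum[OF test_functions_smooth[OF X]] C1[OF X] C2[OF X]
      unfolding C_def adv_def distrib_right[of "\<bar>Cf\<bar> + l2norm vol (grad \<Omega> T)"] by linarith
  qed
  \<comment> \<open>The value that the weak equation assigns to the advection of \<open>T\<close>
    tested with \<xi>. It is reached as a limit, without inserting \<xi> into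
    \<open>advection\<close>.\<close>
  define m where "m = f \<xi> - (\<integral>x. grad \<Omega> \<xi> x \<bullet> grad \<Omega> T x \<partial>vol)"
  have l4: "(\<lambda>n. adv (\<eta> n) T) \<longlonglongrightarrow> m"
    unfolding advT[OF \<eta>(1)] m_def
    by (intro tendsto_diff H_minus_1_tendsto[OF f \<xi> \<eta>(1-3)] tendsto_integral_inner smooth_l2 s\<eta> XD TD \<eta>)
  \<comment> \<open>Expanding the advection of the sum against itself leaves two mixed terms with
    opposite limits. That \<open>adv (\<tau> n) \<xi>\<close> converges at all is a consequence of
    this identity.\<close>
  have "(\<lambda>n. adv (\<zeta> n) (\<lambda>x. T x + 1 * \<xi> x) - adv (\<tau> n) T - adv (\<eta> n) T - adv (\<eta> n) \<xi>) \<longlonglongrightarrow> 0 - 0 - m - 0"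
    by (intro tendsto_diff l1 l2 l3 l4)
  moreover have "adv (\<zeta> n) (\<lambda>x. T x + 1 * \<xi> x) - adv (\<tau> n) T - adv (\<eta> n) T - adv (\<eta> n) \<xi> = adv (\<tau> n) \<xi>" for n
  proof -
    have "smooth (\<zeta> n)" unfolding \<zeta>_def by (intro smooth_add smooth_mult smooth_const s\<tau> s\<eta>)
    from adv_sum[OF this] show ?thesis
      using adv_add[OF s\<tau> s\<eta> TH, of n 1 n] adv_add[OF s\<tau> s\<eta> XH, of n 1 n]
      unfolding \<zeta>_def[abs_def] by linarith
  qed
  ultimately have l5: "(\<lambda>n. adv (\<tau> n) \<xi>) \<longlonglongrightarrow> - m" by simp
  \<comment> \<open>Approximates \<open>T - \<xi> / 2\<close>; the part along \<xi> drops out of the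
    advection in the limit.\<close>
  define \<theta> where "\<theta> n x = \<tau> n x + (- 1/2) * \<eta> n x" for n x
  have \<theta>t: "\<theta> n \<in> test_functions \<Omega>" for n
    unfolding \<theta>_def by (intro test_functions_add test_functions_cmult \<tau> \<eta>)
  have gl: "(\<lambda>x. grad \<Omega> T x + (- 1/2) *\<^sub>R grad \<Omega> \<xi> x) \<in> l2 vol" by (intro l2_add l2_scaleR TD XD)
  have n\<theta>: "(\<lambda>n. l2norm vol (classical_grad (\<theta> n))) \<longlonglongrightarrow> l2norm vol (\<lambda>x. grad \<Omega> T x + (- 1/2) *\<^sub>R grad \<Omega> \<xi> x)"
  proof (rule tendsto_n2[OF _ gl])
    show "classical_grad (\<theta> n) \<in> l2 vol" for n by (intro smooth_l2 test_functions_smooth[OF \<theta>t])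
    show "(\<lambda>n. l2norm vol (\<lambda>x. classical_grad (\<theta> n) x - (grad \<Omega> T x + (- 1/2) *\<^sub>R grad \<Omega> \<xi> x))) \<longlonglongrightarrow> 0"
      unfolding \<theta>_def cg by (intro l2norm_tendsto_lincomb \<tau> \<eta> TD XD smooth_l2 s\<tau> s\<eta>)
  qed
  have "- (- m + (- 1/2) * 0) \<le> a + (l2norm vol (\<lambda>x. grad \<Omega> T x + (- 1/2) *\<^sub>R grad \<Omega> \<xi> x))\<^sup>2"
  proof (rule LIMSEQ_le)
    show "(\<lambda>n. - (adv (\<tau> n) \<xi> + (- 1/2) * adv (\<eta> n) \<xi>)) \<longlonglongrightarrow> - (- m + (- 1/2) * 0)"
      by (intro tendsto_intros l2 l5)
    show "(\<lambda>n. a + (l2norm vol (classical_grad (\<theta> n)))\<^sup>2) \<longlonglongrightarrow> a + (l2norm vol (\<lambda>x. grad \<Omega> T x + (- 1/2) *\<^sub>R grad \<Omega> \<xi> x))\<^sup>2"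
      by (intro tendsto_intros n\<theta>)
    have "- (adv (\<tau> n) \<xi> + (- 1/2) * adv (\<eta> n) \<xi>) \<le> a + (l2norm vol (classical_grad (\<theta> n)))\<^sup>2" for n
    proof -
      have "adv (\<theta> n) \<xi> = adv (\<tau> n) \<xi> + (- 1/2) * adv (\<eta> n) \<xi>"
        unfolding \<theta>_def by (rule adv_add[OF s\<tau> s\<eta> XH])
      then show ?thesis
        using quadratic_form_nonneg_velocity[OF conn ne \<xi> Q u \<theta>t[of n]] adv\<xi>[OF test_functions_smooth[OF \<theta>t[of n]]] by simp
    qed
    then show "\<exists>N. \<forall>n\<ge>N. - (adv (\<tau> n) \<xi> + (- 1/2) * adv (\<eta> n) \<xi>) \<le> a + (l2norm vol (classical_grad (\<theta> n)))\<^sup>2" by blast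
  qed
  \<comment> \<open>The cross term of the square cancels against the one in \<open>m\<close>, and
    1/4 is the square of the shift factor.\<close>
  moreover have "(l2norm vol (\<lambda>x. grad \<Omega> T x + (- 1/2) *\<^sub>R grad \<Omega> \<xi> x))\<^sup>2
      = dirichlet_energy \<Omega> T - (\<integral>x. grad \<Omega> \<xi> x \<bullet> grad \<Omega> T x \<partial>vol) + 1/4 * dirichlet_energy \<Omega> \<xi>"
    using l2norm_power2_diff_scaleR[OF TD(2) XD(2), of "1/2"]
    by (simp add: dirichlet_energy_eq inner_commute power_divide)
  ultimately show ?thesis by (simp add: m_def)
qed

text \<open>The second bound comes from the pair \<open>a = 0\<close>, \<xi> = 0, at which the
  quadratic form reduces to the energy of \<theta> and the objective is 0.\<close>

lemma cooling_bounds: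
  assumes conn: "connected \<Omega>" and ne: "\<Omega> \<noteq> {}" and f: "f \<in> H_minus_1 \<Omega>"
  shows "cooling_lower_bound \<Omega> f Pe \<le> optimal_cooling \<Omega> f Pe" "0 \<le> cooling_lower_bound \<Omega> f Pe"
proof -
  show "cooling_lower_bound \<Omega> f Pe \<le> optimal_cooling \<Omega> f Pe"
    unfolding cooling_lower_bound_def
  proof (rule Sup_least, clarify)
    fix a \<xi> assume \<xi>: "\<xi> \<in> H10 \<Omega>" "quadratic_form_nonneg \<Omega> Pe a \<xi>"
    show "ereal (f \<xi> - 1/4 * dirichlet_energy \<Omega> \<xi> - a) \<le> optimal_cooling \<Omega> f Pe"
      unfolding optimal_cooling_def
    proof (rule Inf_greatest, clarify)
      fix u T assume u: "u \<in> admissible_velocities \<Omega> Pe" and T: "weak_solution \<Omega> f u T"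
      have "divfree u" "l2norm vol u \<le> Pe"
        using u by (auto simp: admissible_velocities_def divfree_def L2_eq L2_norm_eq set_lint_eq)
      from dirichlet_energy_lower_bound[OF conn ne f this T \<xi>]
      show "ereal (f \<xi> - 1/4 * dirichlet_energy \<Omega> \<xi> - a) \<le> ereal (dirichlet_energy \<Omega> T)" by simp
    qed
  qed
  have z: "(\<lambda>x. 0) \<in> H10 \<Omega>" by (rule test_H10[OF test_functions_zero])
  have "\<forall>\<xi>\<in>H10 \<Omega>. \<forall>c. f (\<lambda>x. c * \<xi> x) = c * f \<xi>" using f unfolding H_minus_1_def by blast
  from this[rule_format, OF z, of 0] have "f (\<lambda>x. 0) = 0" by simp
  moreover have "dirichlet_energy \<Omega> (\<lambda>x. 0) = 0"
    by (simp add: dirichlet_energy_eq l2norm_grad_smooth[OF smooth_const]) (simp add: l2norm_def)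
  moreover have "quadratic_form_nonneg \<Omega> Pe 0 (\<lambda>x. 0)"
    unfolding quadratic_form_nonneg_def quadratic_form_def
    using test_L_infinity[OF test_functions_zero]
    by (simp add: advection_def advection_bounded_def dirichlet_energy_eq)
  ultimately have e: "ereal (f (\<lambda>x. 0) - 1/4 * dirichlet_energy \<Omega> (\<lambda>x. 0) - 0) = 0"
    and "quadratic_form_nonneg \<Omega> Pe 0 (\<lambda>x. 0)" by simp_all
  then have "ereal (f (\<lambda>x. 0) - 1/4 * dirichlet_energy \<Omega> (\<lambda>x. 0) - 0) \<le> cooling_lower_bound \<Omega> f Pe"
    unfolding cooling_lower_bound_def using z by (intro Sup_upper) blast
  then show "0 \<le> cooling_lower_bound \<Omega> f Pe" unfolding e .
qed

end

theorem proposition2p1: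
  fixes \<Omega> :: "(real^2) set"
    and f :: "(real^2 \<Rightarrow> real) \<Rightarrow> real"
    and Pe :: real
  assumes "open \<Omega>" and "connected \<Omega>" and "\<Omega> \<noteq> {}" and "bounded \<Omega>"
    and "lipschitz_boundary \<Omega>"
    and "f \<in> H_minus_1 \<Omega>"
    and "Pe \<ge> 0"
  shows "optimal_cooling \<Omega> f Pe \<ge> cooling_lower_bound \<Omega> f Pe \<and> cooling_lower_bound \<Omega> f Pe \<ge> 0"
proof -
  interpret planar_domain \<Omega>
    using assms(1,4) by unfold_locales
  show ?thesis
    using cooling_bounds[OF assms(2,3,6)] by blast
qed

end
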